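(* Let $\mathfrak{g}$ be a semisimple Lie algebra with an $\mathfrak{sl}_2$-triple $\{e,h,f\}$, and let $\chi,\mathfrak{m},\mathfrak{m}_\chi,\mathfrak{q}$ be the data of the $W$-algebra construction. For each nonzero Kazhdan-degree-homogeneous $Q\in S(\mathfrak{g}_e)$ of degree $k_0$ there is a unique $P\in(S(\mathfrak{g})/S(\mathfrak{g})\mathfrak{m}_\chi)^{\mathfrak{m}}$ of Kazhdan degree $k_0$ whose term of minimum polynomial degree is $Q$. This implies that there is an algebra isomorphism $$\nu:\ S(\mathfrak{g}_e)\longrightarrow (S(\mathfrak{g})/S(\mathfrak{g})\mathfrak{m}_\chi)^{\mathfrak{m}}.$$ Thus, for a basis $x_1,\dots,x_r$ of $\mathfrak{g}_e$, the polynomials $P_i=\nu(x_i)$, $i=1,\dots,r$, generate $(S(\mathfrak{g})/S(\mathfrak{g})\mathfrak{m}_\chi)^{\mathfrak{m}}$; in particular this algebra is polynomial.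
   Context: **Ground field.** $\mathbb{K}$ is a field of characteristic zero containing $\mathbb{R}$; Lie algebras are finite dimensional over $\mathbb{K}$. $\mathfrak{g}_e$ is the centralizer of $e$ in $\mathfrak{g}$. **$W$-algebra data.** $\mathfrak{g}$ is semisimple, $e\in\mathfrak{g}$ is nilpotent, $\{e,h,f\}$ is an $\mathfrak{sl}_2$-triple, $(\cdot,\cdot)$ is a $\mathfrak{g}$-invariant bilinear form with $(e,f)=1$, $\chi(x)=(e,x)$, $\mathfrak{g}(i)=\{\xi\in\mathfrak{g}: [h,\xi]=i\xi\}$, $\omega_\chi(\xi,\eta)=\chi([\xi,\eta])$ (non-degenerate on $\mathfrak{g}(-1)$). $\mathfrak{l}\subset\mathfrak{g}(-1)$ is a lagrangian subspace, $\mathfrak{m}=\mathfrak{l}\oplus\bigoplus_{i\le-2}\mathfrak{g}(i)$ (so $\chi$ is a character of $\mathfrak{m}$), and $\mathfrak{m}_\chi$ is the space generated by $\{\xi-\chi(\xi):\xi\in\mathfrak{m}\}$. **Basis.** $x_1,\dots,x_r$ is a basis of $\mathfrak{g}_e$, extended to a homogeneous basis $x_1,\dots,x_m$ of $\sum_{i\ge0}\mathfrak{g}(i)$ with $x_i\in\mathfrak{g}(n_i)$ for all $i$, such that there are $y_i\in\mathfrak{g}(-n_i-2)\subset\sum_{j\le-2}\mathfrak{g}(j)$, $r+1\le i\le m$, with $\chi([x_i,y_j])=\delta_{ij}$ for $r+1\le i,j\le m$. A Witt basis $z_1,\dots,z_{2s}$ of $\mathfrak{g}(-1)$ is fixed with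 $[z_{i+s},z_j]=\delta_{ij}f$ and $[z_i,z_j]=[z_{i+s},z_{j+s}]=0$ for $1\le i,j\le s$, where $z_1,\dots,z_s$ span $\mathfrak{l}$. Then $\{x_1,\dots,x_m,z_{s+1},\dots,z_{2s}\}$ is a basis of $\mathfrak{q}$, and $\mathfrak{g}=\mathfrak{m}\oplus\mathfrak{q}$. **Invariants.** $S(\mathfrak{g})\mathfrak{m}_\chi$ is the ideal of $S(\mathfrak{g})$ generated by $\mathfrak{m}_\chi$; elements of $S(\mathfrak{g})/S(\mathfrak{g})\mathfrak{m}_\chi$ are written as polynomials in $S(\mathfrak{q})$, and $(S(\mathfrak{g})/S(\mathfrak{g})\mathfrak{m}_\chi)^{\mathfrak{m}}$ is the algebra of $\mathrm{ad}\,\mathfrak{m}$-invariants. **Degrees.** The Kazhdan degree of an element of polynomial degree $j$ and $\mathrm{ad}\,h$-weight $i$ is $i+2j$; so $x_i$ has Kazhdan degree $n_i+2$ and $z_{s+j}$ has Kazhdan degree $1$. The polynomial degree is the usual degree in $S(\mathfrak{q})$.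
   Formalization: Uniqueness of P fails as stated (sl_3, e regular: P_2^2 and P_2^2+P_1^3), so P must also have exactly the terms of Q as its terms in S(g_e); for Q of mixed polynomial degree, the lowest term of P is the lowest term of Q rather than Q itself. *)

theory Defs
  imports Complex_Main "HOL-Library.Poly_Mapping" "HOL-Algebra.QuotRing" "HOL-Algebra.Generated_Rings"
begin

section \<open>Polynomial algebras\<close>

text \<open>
  A monomial is a finitely supported exponent function, a polynomial a finitely supported
  function on monomials; \<^typ>\<open>('v \<Rightarrow>\<^sub>0 nat) \<Rightarrow>\<^sub>0 'k::comm_ring_1\<close> carries the convolution product,
  so it is the polynomial ring with the elements of \<^typ>\<open>'v\<close> as variables.
\<close>

type_synonym ('v, 'k) mpoly = "('v \<Rightarrow>\<^sub>0 nat) \<Rightarrow>\<^sub>0 'k"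

definition mvar :: "'v \<Rightarrow> ('v, 'k::comm_ring_1) mpoly" where
  "mvar v = Poly_Mapping.single (Poly_Mapping.single v 1) 1"

definition mconst :: "'k::comm_ring_1 \<Rightarrow> ('v, 'k) mpoly" where
  "mconst c = Poly_Mapping.single 0 c"

definition poly_ring :: "'v set \<Rightarrow> (('v, 'k::comm_ring_1) mpoly) ring" where
  "poly_ring V = \<lparr>carrier = {p. \<forall>t \<in> Poly_Mapping.keys p. Poly_Mapping.keys t \<subseteq> V},
                  mult = (*), one = 1, zero = 0, add = (+)\<rparr>"

definition mdeg :: "('v \<Rightarrow>\<^sub>0 nat) \<Rightarrow> nat" where
  "mdeg t = (\<Sum>v \<in> Poly_Mapping.keys t. Poly_Mapping.lookup t v)"

definition hom_part :: "nat \<Rightarrow> ('v, 'k::comm_ring_1) mpoly \<Rightarrow> ('v, 'k) mpoly" where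
  "hom_part j p = Poly_Mapping.mapp (\<lambda>t c. c when mdeg t = j) p"

definition lowest_part :: "('v, 'k::comm_ring_1) mpoly \<Rightarrow> ('v, 'k) mpoly" where
  "lowest_part p = hom_part (LEAST j. hom_part j p \<noteq> 0) p"

definition restrict_vars :: "'v set \<Rightarrow> ('v, 'k::comm_ring_1) mpoly \<Rightarrow> ('v, 'k) mpoly" where
  "restrict_vars V p = Poly_Mapping.mapp (\<lambda>t c. c when Poly_Mapping.keys t \<subseteq> V) p"

lemma lowest_part_homogeneous:
  assumes "hom_part j q = q"
  shows "lowest_part q = q"
proof (cases "q = 0")
  case True
  then show ?thesis
    by (auto simp: lowest_part_def hom_part_def lookup_mapp intro!: poly_mapping_eqI)
next
  case False
  have "hom_part i (hom_part j q) = 0" if "i \<noteq> j" for i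
    using that by (auto simp: hom_part_def lookup_mapp when_def intro!: poly_mapping_eqI)
  hence "(LEAST i. hom_part i q \<noteq> 0) = j"
    using assms False by (intro Least_equality) (metis, metis nle_le)
  thus ?thesis using assms by (simp add: lowest_part_def)
qed


section \<open>Lie algebras\<close>

text \<open>
  The class \<^class>\<open>real_field\<close> consists of the fields that are algebras over the reals, i.e. of the
  fields containing the reals (these have characteristic zero).
\<close>

locale lie_algebra = vector_space scale
  for scale :: "'k::real_field \<Rightarrow> 'g::ab_group_add \<Rightarrow> 'g" +
  fixes bracket :: "'g \<Rightarrow> 'g \<Rightarrow> 'g"
  assumes finite_dim: "\<exists>S. finite S \<and> span S = UNIV"
    and bracket_linear_left: "\<And>v. Vector_Spaces.linear scale scale (\<lambda>u. bracket u v)"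
    and bracket_linear_right: "\<And>u. Vector_Spaces.linear scale scale (\<lambda>v. bracket u v)"
    and bracket_self: "\<And>u. bracket u u = 0"
    and jacobi: "\<And>u v w. bracket u (bracket v w) + bracket v (bracket w u) + bracket w (bracket u v) = 0"
begin

definition lie_ideal :: "'g set \<Rightarrow> bool" where
  "lie_ideal I \<longleftrightarrow> subspace I \<and> (\<forall>u. \<forall>v \<in> I. bracket u v \<in> I)"

definition derived :: "'g set \<Rightarrow> 'g set" where
  "derived I = span {bracket u v | u v. u \<in> I \<and> v \<in> I}"

definition solvable :: "'g set \<Rightarrow> bool" where
  "solvable I \<longleftrightarrow> (\<exists>n. (derived ^^ n) I = {0})"

definition semisimple :: bool where
  "semisimple \<longleftrightarrow> (\<forall>I. lie_ideal I \<and> solvable I \<longrightarrow> I = {0})"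

definition nilpotent_element :: "'g \<Rightarrow> bool" where
  "nilpotent_element u \<longleftrightarrow> (\<exists>n. \<forall>v. (bracket u ^^ n) v = 0)"

definition sl2_triple :: "'g \<Rightarrow> 'g \<Rightarrow> 'g \<Rightarrow> bool" where
  "sl2_triple e h f \<longleftrightarrow> bracket h e = scale 2 e \<and> bracket h f = scale (-2) f \<and> bracket e f = h"

definition centralizer :: "'g \<Rightarrow> 'g set" where
  "centralizer u = {v. bracket u v = 0}"

definition weight_space :: "'g \<Rightarrow> int \<Rightarrow> 'g set" where
  "weight_space h i = {v. bracket h v = scale (of_int i) v}"

definition invariant_bilinear :: "('g \<Rightarrow> 'g \<Rightarrow> 'k) \<Rightarrow> bool" where
  "invariant_bilinear form \<longleftrightarrow>
     (\<forall>v. Vector_Spaces.linear scale (*) (\<lambda>u. form u v)) \<and>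
     (\<forall>u. Vector_Spaces.linear scale (*) (\<lambda>v. form u v)) \<and>
     (\<forall>u v w. form (bracket u v) w = form u (bracket v w))"

text \<open>
  \<open>family_basis a J W\<close>: the family \<open>(a i)\<close>, \<open>i \<in> J\<close>, is a basis of the subspace \<open>W\<close>.
\<close>

definition family_basis :: "(nat \<Rightarrow> 'g) \<Rightarrow> nat set \<Rightarrow> 'g set \<Rightarrow> bool" where
  "family_basis a J W \<longleftrightarrow> inj_on a J \<and> independent (a ` J) \<and> span (a ` J) = W"

text \<open>
  Given a basis \<open>B\<close> of the Lie algebra, its symmetric algebra is \<^term>\<open>poly_ring B\<close>; the embedding of
  the Lie algebra as the linear forms is \<open>sym_emb B\<close>.  For a subset \<open>C\<close> of \<open>B\<close> the symmetric algebra
  of \<open>span C\<close> is \<^term>\<open>poly_ring C\<close>.  The map \<open>sym_ad B u\<close> is the derivation of the symmetric algebra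
  that extends \<open>bracket u\<close>: a monomial \<open>t\<close> is sent to the sum over \<open>b\<close> of
  \<open>(\<partial>t / \<partial>b) * [u, b]\<close>.
\<close>

definition sym_emb :: "'g set \<Rightarrow> 'g \<Rightarrow> ('g, 'k) mpoly" where
  "sym_emb B u = (\<Sum>b \<in> B. mconst (representation B u b) * mvar b)"

definition sym_ad :: "'g set \<Rightarrow> 'g \<Rightarrow> ('g, 'k) mpoly \<Rightarrow> ('g, 'k) mpoly" where
  "sym_ad B u p =
     (\<Sum>t \<in> Poly_Mapping.keys p. \<Sum>b \<in> Poly_Mapping.keys t.
        Poly_Mapping.single (t - Poly_Mapping.single b 1)
          (Poly_Mapping.lookup p t * of_nat (Poly_Mapping.lookup t b)) * sym_emb B (bracket u b))"

text \<open>
  Homogeneity of Kazhdan degree \<open>k\<close>: the component of polynomial degree \<open>j\<close> has weight \<open>k - 2j\<close>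
  under the adjoint action of \<open>h\<close>.
\<close>

definition kazhdan_homogeneous :: "'g set \<Rightarrow> 'g \<Rightarrow> int \<Rightarrow> ('g, 'k) mpoly \<Rightarrow> bool" where
  "kazhdan_homogeneous B h k p \<longleftrightarrow>
     (\<forall>j. sym_ad B h (hom_part j p) = mconst (of_int (k - 2 * int j)) * hom_part j p)"

end


section \<open>The data of the W-algebra construction\<close>

text \<open>
  Here \<open>lag\<close> and \<open>mm\<close> are the lagrangian subspace \<open>\<ll>\<close> and the nilpotent subalgebra \<open>\<mm>\<close>,
  whereas the number \<open>m\<close> counts the basis \<open>x\<close> of the nonnegative part.  \<open>B\<close> is an arbitrary basis of
  the whole Lie algebra extending the given basis \<open>qbasis\<close> of the complement of \<open>mm\<close>.

  The relations of the Witt basis are required for the form \<open>\<omega>\<close>; the equations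
  \<open>[z\<^bsub>i+s\<^esub>, z\<^bsub>j\<^esub>] = \<delta>\<^bsub>ij\<^esub> f\<close> would imply them since \<open>\<chi> f = 1\<close>, but can be satisfied only when
  \<open>[\<gg>(-1), \<gg>(-1)]\<close> lies on the line of \<open>f\<close>.
\<close>

locale W_algebra_data = lie_algebra scale bracket
  for scale :: "'k::real_field \<Rightarrow> 'g::ab_group_add \<Rightarrow> 'g"
    and bracket :: "'g \<Rightarrow> 'g \<Rightarrow> 'g" +
  fixes e h f :: 'g
    and form :: "'g \<Rightarrow> 'g \<Rightarrow> 'k"
    and lag :: "'g set"
    and r m s :: nat
    and n :: "nat \<Rightarrow> int"
    and x y z :: "nat \<Rightarrow> 'g"
    and B :: "'g set"
  assumes semisimple: "semisimple"
    and nilpotent: "nilpotent_element e"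
    and triple: "sl2_triple e h f"
    and form_invariant: "invariant_bilinear form"
    and form_e_f: "form e f = 1"
    and lagrangian:
      "subspace lag"
      "lag = {u \<in> weight_space h (-1). \<forall>v \<in> lag. form e (bracket u v) = 0}"
    and r_le_m: "r \<le> m"
    and x_centralizer: "family_basis x {1..r} (centralizer e)"
    and x_basis: "family_basis x {1..m} (span (\<Union>i\<in>{0..}. weight_space h i))"
    and x_weight: "\<And>i. i \<in> {1..m} \<Longrightarrow> x i \<in> weight_space h (n i)"
    and y_weight: "\<And>i. i \<in> {r+1..m} \<Longrightarrow> y i \<in> weight_space h (- n i - 2)"
    and x_y_dual: "\<And>i j. i \<in> {r+1..m} \<Longrightarrow> j \<in> {r+1..m} \<Longrightarrow>
        form e (bracket (x i) (y j)) = (if i = j then 1 else 0)"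
    and z_basis: "family_basis z {1..2*s} (weight_space h (-1))"
    and z_witt: "\<And>i j. i \<in> {1..s} \<Longrightarrow> j \<in> {1..s} \<Longrightarrow>
        form e (bracket (z (i+s)) (z j)) = (if i = j then 1 else 0) \<and>
        form e (bracket (z i) (z j)) = 0 \<and>
        form e (bracket (z (i+s)) (z (j+s))) = 0"
    and z_lag: "span (z ` {1..s}) = lag"
    and B_basis: "independent B" "span B = UNIV"
    and B_extends: "x ` {1..m} \<union> z ` {s+1..2*s} \<subseteq> B"
begin

definition chi :: "'g \<Rightarrow> 'k" where
  "chi u = form e u"

definition mm :: "'g set" where
  "mm = span (lag \<union> (\<Union>i\<in>{..-2}. weight_space h i))"

definition qbasis :: "'g set" where
  "qbasis = x ` {1..m} \<union> z ` {s+1..2*s}"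

definition chi_ideal :: "('g, 'k) mpoly set" where
  "chi_ideal = genideal (poly_ring B) {sym_emb B u - mconst (chi u) | u. u \<in> mm}"

definition quot_ring :: "(('g, 'k) mpoly set) ring" where
  "quot_ring = poly_ring B Quot chi_ideal"

definition quot_const :: "'k \<Rightarrow> ('g, 'k) mpoly set" where
  "quot_const c = chi_ideal +>\<^bsub>poly_ring B\<^esub> mconst c"

text \<open>
  The action of \<open>u \<in> mm\<close> induced on the quotient.  The union is over representatives of one coset and
  all its members agree, as the ideal is stable under \<open>mm\<close>.
\<close>

definition quot_ad :: "'g \<Rightarrow> ('g, 'k) mpoly set \<Rightarrow> ('g, 'k) mpoly set" where
  "quot_ad u P = (\<Union>p\<in>P. chi_ideal +>\<^bsub>poly_ring B\<^esub> sym_ad B u p)"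

definition invariant_ring :: "(('g, 'k) mpoly set) ring" where
  "invariant_ring = quot_ring\<lparr>carrier :=
     {P \<in> carrier quot_ring. \<forall>u \<in> mm. quot_ad u P = \<zero>\<^bsub>quot_ring\<^esub>}\<rparr>"

text \<open>
  \<open>has_initial_term k Q P\<close>: written as a polynomial \<open>p\<close> in the basis \<open>qbasis\<close>, the class \<open>P\<close> is of
  Kazhdan degree \<open>k\<close>, begins with \<open>Q\<close>, and has no terms in the symmetric algebra of the centralizer
  except those of \<open>Q\<close>.

  If \<open>Q\<close> has a single polynomial degree, then \<open>lowest_part Q = Q\<close> by \<open>lowest_part_homogeneous\<close>, so
  the third condition says that \<open>Q\<close> is the term of minimum polynomial degree of \<open>P\<close>; a \<open>Q\<close> with
  several polynomial degrees cannot itself be that term.  Without the fourth condition \<open>P\<close> is not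
  unique: for the regular nilpotent element of \<open>sl\<^sub>3\<close> the invariants are generated by
  \<open>P\<^sub>1\<close>, \<open>P\<^sub>2\<close> of Kazhdan degrees 4, 6 with linear lowest terms, and \<open>P\<^sub>2\<^sup>2\<close> and
  \<open>P\<^sub>2\<^sup>2 + P\<^sub>1\<^sup>3\<close> have the same Kazhdan degree and the same lowest term.
\<close>

definition has_initial_term :: "int \<Rightarrow> ('g, 'k) mpoly \<Rightarrow> ('g, 'k) mpoly set \<Rightarrow> bool" where
  "has_initial_term k Q P \<longleftrightarrow>
     (\<exists>p \<in> carrier (poly_ring qbasis). p \<in> P \<and>
        kazhdan_homogeneous B h k p \<and>
        lowest_part p = lowest_part Q \<and>
        restrict_vars (x ` {1..r}) p = Q)"

end

end

theory Submission
  imports Defs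
begin

text \<open>
  Write \<open>\<qq>\<close> for the span of \<open>qbasis\<close> and identify the quotient with \<open>S(\<qq>)\<close>.  An element \<open>u\<close> of \<open>\<mm>\<close> acts
  on \<open>S(\<qq>)\<close> by a derivation that is the sum of a vector field with constant coefficients
  \<open>\<chi>[u, b]\<close> and of one with linear coefficients.  Because \<open>\<mm>\<close> is dual, under
  \<open>(u, b) \<mapsto> \<chi>[u, b]\<close>, to the span of the basis vectors of \<open>\<qq>\<close> outside the centralizer of \<open>e\<close>, the
  constant parts are the partial derivatives in these "vertical" directions.  Hence the lowest term
  of an invariant only involves the centralizer, so that an invariant is determined by its
  restriction to the variables of the centralizer.  Conversely, every polynomial in these variables
  extends to an invariant degree by degree: the obstruction in each degree is a one-form in the
  vertical directions, closed because \<open>\<mm>\<close> acts by a Lie algebra representation, hence exact.  The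
  process terminates since all variables of \<open>\<qq>\<close> have positive Kazhdan degree.
\<close>

section \<open>Polynomials\<close>

text \<open>The duality between \<open>mm\<close> and the vertical directions is not given:
  \<open>form\<close> is only assumed to be invariant with value 1 on the pair \<open>e\<close>,
  \<open>f\<close>. It is derived from the action of the triple. The kernel of \<open>ad e\<close>
  is spanned by vectors of nonnegative weight, so \<open>ad e\<close> is injective on negative
  weights and carries a degenerate vector up to weight -1 or -2, where the Witt basis and the action
  of \<open>f\<close> exclude it. The decomposition into weight spaces is likewise deduced from the
  nilpotency of \<open>ad e\<close>, since the field need not contain the eigenvalues of a given
  endomorphism. Lowest terms are not additive, so they do not by themselves define a map of
  algebras. Restriction to the variables of the centralizer does: it sets the vertical variables to
  0 and is a ring homomorphism. The primitives of the one-forms are chosen so that every monomial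
  contains a vertical variable; the corrections then leave the restriction untouched, and the
  isomorphism is the inverse of restriction on the invariants.\<close>

abbreviation keys where "keys \<equiv> Poly_Mapping.keys"
abbreviation lookup where "lookup \<equiv> Poly_Mapping.lookup"
abbreviation single where "single \<equiv> Poly_Mapping.single"
abbreviation polys :: "'v set \<Rightarrow> ('v, 'k::comm_ring_1) mpoly set" where
  "polys V \<equiv> carrier (poly_ring V)"

lemma polys_iff: "p \<in> polys V \<longleftrightarrow> (\<forall>t \<in> keys p. keys t \<subseteq> V)"
  by (simp add: poly_ring_def)

lemma polys_mono: "V \<subseteq> W \<Longrightarrow> polys V \<subseteq> polys W"
  by (fastforce simp: polys_iff)

lemma poly_ring_simps [simp]:
  "mult (poly_ring V) = (*)" "one (poly_ring V) = 1" "zero (poly_ring V) = 0" "add (poly_ring V) = (+)"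
  by (simp_all add: poly_ring_def)

lemma keys_add_nat: "keys (s + t :: 'v \<Rightarrow>\<^sub>0 nat) = keys s \<union> keys t"
  by (auto simp: in_keys_iff lookup_add)

lemma polys_0 [simp]: "0 \<in> polys V"
  by (simp add: polys_iff)

lemma polys_mconst [simp]: "mconst c \<in> polys V"
  by (auto simp: polys_iff mconst_def split: if_splits)

lemma polys_mvar [simp]: "v \<in> V \<Longrightarrow> mvar v \<in> polys V"
  by (auto simp: polys_iff mvar_def split: if_splits)

lemma mconst_0 [simp]: "mconst 0 = 0" and mconst_1 [simp]: "mconst 1 = 1"
  by (simp_all add: mconst_def)

lemma mconst_add: "mconst (a + b) = mconst a + mconst b"
  by (simp add: mconst_def single_add)

lemma mconst_mult: "mconst (a * b) = mconst a * mconst b"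
  by (simp add: mconst_def mult_single)

lemma polys_1 [simp]: "1 \<in> polys V"
  using polys_mconst[of 1 V] by simp

lemma polys_add: "p \<in> polys V \<Longrightarrow> q \<in> polys V \<Longrightarrow> p + q \<in> polys V"
  using Poly_Mapping.keys_add[of p q] by (force simp: polys_iff)

lemma polys_uminus: "p \<in> polys V \<Longrightarrow> - p \<in> polys V"
  by (auto simp: polys_iff in_keys_iff)

lemma polys_diff: "p \<in> polys V \<Longrightarrow> q \<in> polys V \<Longrightarrow> p - q \<in> polys V"
  using polys_add[of p V "- q"] polys_uminus[of q V] by simp

lemma polys_mult: "p \<in> polys V \<Longrightarrow> q \<in> polys V \<Longrightarrow> p * q \<in> polys V"
  using keys_mult[of p q] by (fastforce simp: polys_iff keys_add_nat)

lemma polys_sum: "(\<And>i. i \<in> A \<Longrightarrow> g i \<in> polys V) \<Longrightarrow> (\<Sum>i\<in>A. g i) \<in> polys V"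
  by (induction A rule: infinite_finite_induct) (simp_all add: polys_add)

lemma polys_power: "p \<in> polys V \<Longrightarrow> p ^ n \<in> polys V"
  by (induction n) (simp_all add: polys_mult)

lemma poly_ring_cring: "cring (poly_ring V :: ('v, 'k::comm_ring_1) mpoly ring)"
proof (rule cringI)
  show "abelian_group (poly_ring V :: ('v, 'k) mpoly ring)"
    by (rule abelian_groupI)
      (auto simp: polys_add algebra_simps intro!: bexI[of _ "- x" for x] polys_uminus)
  show "Group.comm_monoid (poly_ring V :: ('v, 'k) mpoly ring)"
    by (rule comm_monoidI) (auto simp: polys_mult algebra_simps)
qed (auto simp: algebra_simps)

lemma poly_ring_ring: "ring (poly_ring V :: ('v, 'k::comm_ring_1) mpoly ring)"
  using poly_ring_cring by (rule cring.axioms(1))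

lemma mpoly_eq_sum: "(\<Sum>t\<in>keys p. single t (lookup p t)) = (p :: 'a \<Rightarrow>\<^sub>0 'b::comm_monoid_add)"
proof (rule poly_mapping_eqI)
  fix t
  show "lookup (\<Sum>t\<in>keys p. single t (lookup p t)) t = lookup p t"
    by (auto simp: lookup_sum lookup_single when_def sum.delta[OF finite_keys] in_keys_iff)
qed

text \<open>The single-term case remembers that the term occurs in \<open>p\<close>, so that
  conditions on the support of \<open>p\<close> survive the induction.\<close>

lemma mpoly_additive_induct [case_names single zero add]:
  fixes p :: "'a \<Rightarrow>\<^sub>0 'b::comm_monoid_add"
  assumes "\<And>t c. t \<in> keys p \<Longrightarrow> c = lookup p t \<Longrightarrow> P (single t c)"
    and "P 0" and "\<And>p q. P p \<Longrightarrow> P q \<Longrightarrow> P (p + q)"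
  shows "P p"
proof -
  have "P (\<Sum>t\<in>S. single t (lookup p t))" if "finite S" "S \<subseteq> keys p" for S
    using that by (induction S) (auto intro: assms)
  from this[OF finite_keys order_refl] show ?thesis by (simp add: mpoly_eq_sum)
qed

lemma mvar_power: "(mvar v :: ('v, 'k::comm_ring_1) mpoly) ^ k = single (single v k) 1"
  by (induction k) (simp_all add: mvar_def mult_single single_add[symmetric])

lemma prod_single_1: "(\<Prod>i\<in>A. single (g i) (1::'k::comm_ring_1)) = single (\<Sum>i\<in>A. g i :: 'v \<Rightarrow>\<^sub>0 nat) 1"
  by (induction A rule: infinite_finite_induct) (simp_all add: mult_single)

lemma single_eq_prod:
  "single t (c::'k::comm_ring_1) = mconst c * (\<Prod>v\<in>keys t. mvar v ^ lookup t v)"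
  for t :: "'v \<Rightarrow>\<^sub>0 nat"
  by (simp add: mvar_power prod_single_1 mpoly_eq_sum mconst_def mult_single)

text \<open>Monomials in \<open>V\<close> are constants times products of powers of variables, so
  statements about ring homomorphisms and derivations reduce to their values on variables.
  Membership in \<open>polys V\<close> is handed on to the sum and product cases.\<close>

lemma mpoly_induct [consumes 1, case_names const var add mult]:
  assumes "p \<in> polys V"
    and const: "\<And>c. P (mconst c)"
    and var: "\<And>v. v \<in> V \<Longrightarrow> P (mvar v)"
    and add: "\<And>p q. p \<in> polys V \<Longrightarrow> q \<in> polys V \<Longrightarrow> P p \<Longrightarrow> P q \<Longrightarrow> P (p + q)"
    and mult: "\<And>p q. p \<in> polys V \<Longrightarrow> q \<in> polys V \<Longrightarrow> P p \<Longrightarrow> P q \<Longrightarrow> P (p * q)"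
  shows "P p"
proof -
  let ?P = "\<lambda>p. p \<in> polys V \<and> P p"
  have pow: "?P (mvar v ^ k)" if "v \<in> V" for v k
    by (induction k) (use that in \<open>auto intro!: mult var polys_mult polys_power simp: const[of 1, simplified]\<close>)
  have prod: "?P (\<Prod>v\<in>S. mvar v ^ lookup t v)" if "S \<subseteq> V" for S and t :: "'a \<Rightarrow>\<^sub>0 nat"
    using that
  proof (induction S rule: infinite_finite_induct)
    case (insert v S)
    then show ?case using pow[of v "lookup t v"] by (auto intro!: mult polys_mult)
  qed (use const[of 1] in auto)
  have "?P p"
  proof (induction p rule: mpoly_additive_induct)
    case (single t c)
    then have "keys t \<subseteq> V" using assms(1) by (auto simp: polys_iff)
    from prod[OF this, of t] show ?case
      unfolding single_eq_prod by (auto intro!: polys_mult mult const)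
  next
    case (add p q) then show ?case by (auto intro: assms polys_add)
  qed (use const[of 0] in auto)
  then show ?thesis by simp
qed

subsection \<open>Substitution\<close>

definition mon_subst :: "('v \<Rightarrow> ('w, 'k::comm_ring_1) mpoly) \<Rightarrow> ('v \<Rightarrow>\<^sub>0 nat) \<Rightarrow> ('w, 'k) mpoly" where
  "mon_subst g t = (\<Prod>v\<in>keys t. g v ^ lookup t v)"

definition psubst :: "('v \<Rightarrow> ('w, 'k::comm_ring_1) mpoly) \<Rightarrow> ('v, 'k) mpoly \<Rightarrow> ('w, 'k) mpoly" where
  "psubst g p = (\<Sum>t\<in>keys p. mconst (lookup p t) * mon_subst g t)"

text \<open>Additional variables contribute factors with exponent 0. Two monomials can thus be
  compared over the union of their supports.\<close>

lemma mon_subst_superset: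
  "finite S \<Longrightarrow> keys t \<subseteq> S \<Longrightarrow> mon_subst g t = (\<Prod>v\<in>S. g v ^ lookup t v)"
  unfolding mon_subst_def by (rule prod.mono_neutral_left) (auto simp: in_keys_iff)

lemma mon_subst_add: "mon_subst g (s + t) = mon_subst g s * mon_subst g t"
proof -
  let ?S = "keys s \<union> keys t"
  have "mon_subst g (s + t) = (\<Prod>v\<in>?S. g v ^ lookup (s + t) v)"
    by (rule mon_subst_superset) (auto simp: keys_add_nat)
  also have "\<dots> = (\<Prod>v\<in>?S. g v ^ lookup s v) * (\<Prod>v\<in>?S. g v ^ lookup t v)"
    by (simp add: lookup_add power_add prod.distrib)
  also have "\<dots> = mon_subst g s * mon_subst g t"
    by (simp add: mon_subst_superset[of ?S])
  finally show ?thesis .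
qed

lemma mon_subst_0 [simp]: "mon_subst g 0 = 1"
  by (simp add: mon_subst_def)

lemma psubst_single: "psubst g (single t c) = mconst c * mon_subst g t"
  by (cases "c = 0") (simp_all add: psubst_def)

lemma psubst_0 [simp]: "psubst g 0 = 0"
  by (simp add: psubst_def)

lemma psubst_add: "psubst g (p + q) = psubst g p + psubst g q"
  unfolding psubst_def by (rule setsum_keys_plus_distrib) (simp_all add: mconst_add algebra_simps)

lemma psubst_mconst [simp]: "psubst g (mconst c) = mconst c"
  using psubst_single[of g 0 c] by (simp flip: mconst_def)

lemma psubst_1 [simp]: "psubst g 1 = 1"
  using psubst_mconst[of g 1] by simp

lemma psubst_mvar [simp]: "psubst g (mvar v) = g v"
  by (simp add: mvar_def psubst_single mon_subst_def)

lemma psubst_mult: "psubst g (p * q) = psubst g p * psubst g q"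
proof (induction p rule: mpoly_additive_induct)
  case (single s c)
  show ?case
    by (induction q rule: mpoly_additive_induct)
      (simp_all add: mult_single psubst_single mon_subst_add mconst_mult psubst_add algebra_simps)
qed (simp_all add: psubst_add algebra_simps)

lemma psubst_uminus: "psubst g (- p) = - psubst g p"
  using psubst_add[of g p "- p"] by (simp add: eq_neg_iff_add_eq_0 add.commute)

lemma psubst_diff: "psubst g (p - q) = psubst g p - psubst g q"
  using psubst_add[of g p "- q"] by (simp add: psubst_uminus)

lemma psubst_sum: "psubst g (\<Sum>i\<in>A. h i) = (\<Sum>i\<in>A. psubst g (h i))"
  by (induction A rule: infinite_finite_induct) (simp_all add: psubst_add)

lemma psubst_polys:
  assumes "p \<in> polys V" "\<And>v. v \<in> V \<Longrightarrow> g v \<in> polys W"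
  shows "psubst g p \<in> polys W"
  using assms(1) by (induction rule: mpoly_induct) (auto simp: psubst_add psubst_mult assms polys_add polys_mult)

lemma psubst_comp:
  assumes "p \<in> polys V" "\<And>v. v \<in> V \<Longrightarrow> psubst g (h v) = k v"
  shows "psubst g (psubst h p) = psubst k p"
  using assms(1) by (induction rule: mpoly_induct) (auto simp: psubst_add psubst_mult assms)

lemma psubst_cong:
  assumes "p \<in> polys V" "\<And>v. v \<in> V \<Longrightarrow> g v = h v"
  shows "psubst g p = psubst h p"
  using assms(1) by (induction rule: mpoly_induct) (auto simp: psubst_add psubst_mult assms)

lemma psubst_mvar_id: "psubst mvar p = p"
  by (induction p rule: mpoly_additive_induct)
    (simp_all add: psubst_add psubst_single mon_subst_def single_eq_prod[symmetric])

text \<open>A monomial with a variable outside \<open>V\<close> vanishes as soon as that variable is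
  set to 0. Being a substitution, restriction respects sums and products.\<close>

lemma restrict_vars_eq_psubst:
  fixes p :: "('v, 'k::comm_ring_1) mpoly"
  shows "restrict_vars V p = psubst (\<lambda>v. if v \<in> V then mvar v else 0) p"
proof (induction p rule: mpoly_additive_induct)
  case (single t c)
  let ?r = "\<lambda>v. if v \<in> V then mvar v else 0 :: ('v, 'k) mpoly"
  show ?case
  proof (cases "keys t \<subseteq> V")
    case True
    then have "mon_subst ?r t = mon_subst mvar t"
      unfolding mon_subst_def by (intro prod.cong) auto
    moreover have "restrict_vars V (single t c) = single t c"
      using True by (auto simp: restrict_vars_def lookup_mapp lookup_single when_def intro!: poly_mapping_eqI)
    moreover have "single t c = mconst c * mon_subst mvar t"
      unfolding mon_subst_def by (rule single_eq_prod)
    ultimately show ?thesis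
      unfolding psubst_single by simp
  next
    case False
    then have "mon_subst ?r t = 0"
      unfolding mon_subst_def by (intro prod_zero) (auto simp: in_keys_iff zero_power)
    moreover have "restrict_vars V (single t c) = 0"
      using False by (auto simp: restrict_vars_def lookup_mapp lookup_single when_def split: if_splits intro!: poly_mapping_eqI)
    ultimately show ?thesis by (simp add: psubst_single)
  qed
next
  case (add p q)
  moreover have "restrict_vars V (p + q) = restrict_vars V p + restrict_vars V q"
    by (auto simp: restrict_vars_def lookup_mapp lookup_add when_def in_keys_iff intro!: poly_mapping_eqI)
  ultimately show ?case by (simp add: psubst_add)
qed (auto simp: restrict_vars_def lookup_mapp intro!: poly_mapping_eqI)

lemma lookup_restrict_vars: "lookup (restrict_vars V p) t = (if keys t \<subseteq> V then lookup p t else 0)"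
  by (auto simp: restrict_vars_def lookup_mapp in_keys_iff when_def)

lemma psubst_ring_hom:
  assumes "\<And>v. v \<in> V \<Longrightarrow> g v \<in> polys W"
  shows "psubst g \<in> ring_hom (poly_ring V) (poly_ring W)"
  by (rule ring_hom_memI) (auto simp: psubst_add psubst_mult assms psubst_polys)

subsection \<open>Derivations\<close>

text \<open>The derivation with prescribed values on the variables, given by the formula of
  \<open>sym_ad\<close> so that the latter is a literal instance. Partial derivatives, Euler fields
  and the action of \<open>mm\<close> are further instances.\<close>

definition gderiv :: "('v \<Rightarrow> ('v, 'k::comm_ring_1) mpoly) \<Rightarrow> ('v, 'k) mpoly \<Rightarrow> ('v, 'k) mpoly" where
  "gderiv d p = (\<Sum>t\<in>keys p. \<Sum>b\<in>keys t.
     single (t - single b 1) (lookup p t * of_nat (lookup t b)) * d b)"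

lemma gderiv_single:
  "gderiv d (single t c) = (\<Sum>b\<in>keys t. single (t - single b 1) (c * of_nat (lookup t b)) * d b)"
  by (cases "c = 0") (simp_all add: gderiv_def)

lemma gderiv_single_superset:
  assumes "finite S" "keys t \<subseteq> S"
  shows "gderiv d (single t c) = (\<Sum>b\<in>S. single (t - single b 1) (c * of_nat (lookup t b)) * d b)"
  unfolding gderiv_single using assms by (intro sum.mono_neutral_left) (auto simp: in_keys_iff)

lemma gderiv_0 [simp]: "gderiv d 0 = 0"
  by (simp add: gderiv_def)

lemma gderiv_add: "gderiv d (p + q) = gderiv d p + gderiv d q"
  unfolding gderiv_def
  by (rule setsum_keys_plus_distrib) (simp_all add: single_add algebra_simps sum.distrib)

lemma gderiv_mconst [simp]: "gderiv d (mconst c) = 0"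
  by (simp add: mconst_def gderiv_single)

lemma gderiv_mvar [simp]: "gderiv d (mvar v) = d v"
  by (simp add: mvar_def gderiv_single)

lemma gderiv_mult: "gderiv d (p * q) = gderiv d p * q + p * gderiv d q"
proof (induction p rule: mpoly_additive_induct)
  case (single s a)
  show ?case
  proof (induction q rule: mpoly_additive_induct)
    case (single t c)
    let ?S = "keys s \<union> keys t"
    \<comment> \<open>Truncated subtraction commutes with adding \<open>t\<close> only when
      \<open>b\<close> divides \<open>s\<close>; otherwise the coefficients on both sides are
      0.\<close>
    have 1: "single (s + t - single b 1) (a * c * of_nat (lookup s b)) =
        single (s - single b 1) (a * of_nat (lookup s b)) * single t c" for b
    proof (cases "lookup s b = 0")
      case False
      then have "s + t - single b 1 = (s - single b 1) + t"
        by (intro poly_mapping_eqI) (auto simp: lookup_add lookup_minus lookup_single when_def)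
      then show ?thesis by (simp add: mult_single algebra_simps)
    qed simp
    have 2: "single (s + t - single b 1) (a * c * of_nat (lookup t b)) =
        single s a * single (t - single b 1) (c * of_nat (lookup t b))" for b
    proof (cases "lookup t b = 0")
      case False
      then have "s + t - single b 1 = s + (t - single b 1)"
        by (intro poly_mapping_eqI) (auto simp: lookup_add lookup_minus lookup_single when_def)
      then show ?thesis by (simp add: mult_single algebra_simps)
    qed simp
    have "gderiv d (single s a * single t c) =
        (\<Sum>b\<in>?S. single (s + t - single b 1) (a * c * of_nat (lookup (s + t) b)) * d b)"
      unfolding mult_single by (rule gderiv_single_superset) (auto simp: keys_add_nat)
    also have "\<dots> = (\<Sum>b\<in>?S. single (s - single b 1) (a * of_nat (lookup s b)) * d b * single t c)
        + (\<Sum>b\<in>?S. single s a * (single (t - single b 1) (c * of_nat (lookup t b)) * d b))"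
      unfolding sum.distrib[symmetric]
      by (intro sum.cong refl) (simp only: lookup_add of_nat_add distrib_left single_add 1 2, simp add: algebra_simps)
    also have "\<dots> = gderiv d (single s a) * single t c + single s a * gderiv d (single t c)"
      by (simp add: gderiv_single_superset[of ?S] sum_distrib_left sum_distrib_right)
    finally show ?case .
  qed (simp_all add: gderiv_add algebra_simps)
qed (simp_all add: gderiv_add algebra_simps)

lemma gderiv_uminus: "gderiv d (- p) = - gderiv d p"
  using gderiv_add[of d p "- p"] by (simp add: eq_neg_iff_add_eq_0 add.commute)

lemma gderiv_diff: "gderiv d (p - q) = gderiv d p - gderiv d q"
  using gderiv_add[of d p "- q"] by (simp add: gderiv_uminus)

lemma gderiv_sum: "gderiv d (\<Sum>i\<in>A. h i) = (\<Sum>i\<in>A. gderiv d (h i))"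
  by (induction A rule: infinite_finite_induct) (simp_all add: gderiv_add)

lemma gderiv_polys:
  assumes "p \<in> polys V" "\<And>v. v \<in> V \<Longrightarrow> d v \<in> polys V"
  shows "gderiv d p \<in> polys V"
  using assms(1) by (induction rule: mpoly_induct)
    (auto simp: gderiv_add gderiv_mult assms intro!: polys_add polys_mult)

lemma gderiv_cong:
  assumes "p \<in> polys V" "\<And>v. v \<in> V \<Longrightarrow> d v = d' v"
  shows "gderiv d p = gderiv d' p"
  using assms(1) by (induction rule: mpoly_induct) (auto simp: gderiv_add gderiv_mult assms)

lemma gderiv_plus: "gderiv (\<lambda>v. d v + d' v) p = gderiv d p + gderiv d' p"
  by (simp add: gderiv_def algebra_simps sum.distrib)

text \<open>Derivations depend linearly on their values on variables. This turns the expansion of an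
  element of \<open>mm\<close> in a dual family into an expansion of its action.\<close>

lemma gderiv_lin:
  assumes "p \<in> polys V" "\<And>v. v \<in> V \<Longrightarrow> d v = (\<Sum>i\<in>A. mconst (c i) * d' i v)"
  shows "gderiv d p = (\<Sum>i\<in>A. mconst (c i) * gderiv (d' i) p)"
  using assms(1)
  by (induction rule: mpoly_induct)
    (auto simp: gderiv_add gderiv_mult assms sum.distrib sum_distrib_left sum_distrib_right algebra_simps)

text \<open>Both sides are derivations along the homomorphism \<open>psubst g\<close>, hence
  determined on variables. It transports the adjoint action from the symmetric algebra to the
  quotient.\<close>

lemma psubst_gderiv:
  assumes "p \<in> polys V" "\<And>v. v \<in> V \<Longrightarrow> psubst g (d v) = gderiv d' (g v)"
  shows "psubst g (gderiv d p) = gderiv d' (psubst g p)"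
  using assms(1) by (induction rule: mpoly_induct)
    (auto simp: gderiv_add gderiv_mult psubst_add psubst_mult assms)

text \<open>In the product case the mixed products of first derivatives cancel, so the commutator is
  again a derivation and only variables have to be compared.\<close>

lemma gderiv_commutator:
  assumes "p \<in> polys V"
    and "\<And>v. v \<in> V \<Longrightarrow> gderiv d (d' v) - gderiv d' (d v) = d'' v"
  shows "gderiv d (gderiv d' p) - gderiv d' (gderiv d p) = gderiv d'' p"
  using assms(1)
proof (induction rule: mpoly_induct)
  case (mult p q)
  then show ?case
    by (simp add: gderiv_mult gderiv_add mult.IH[symmetric] algebra_simps)
next
  case (add p q)
  then show ?case by (simp add: gderiv_add add.IH[symmetric] algebra_simps)
qed (auto simp: assms)

abbreviation pd :: "'v \<Rightarrow> ('v, 'k::comm_ring_1) mpoly \<Rightarrow> ('v, 'k) mpoly" where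
  "pd a \<equiv> gderiv (\<lambda>b. if b = a then 1 else 0)"

lemma lookup_pd: "lookup (pd a p) t = of_nat (lookup t a + 1) * lookup p (t + single a 1)"
proof (induction p rule: mpoly_additive_induct)
  case (single s c)
  have eq: "pd a (single s c) = single (s - single a 1) (c * of_nat (lookup s a))"
  proof -
    have "pd a (single s c) = (\<Sum>b\<in>insert a (keys s). single (s - single b 1) (c * of_nat (lookup s b)) * (if b = a then 1 else 0))"
      by (rule gderiv_single_superset) auto
    also have "\<dots> = (\<Sum>b\<in>insert a (keys s). if b = a then single (s - single a 1) (c * of_nat (lookup s a)) else 0)"
      by (intro sum.cong) auto
    finally show ?thesis by simp
  qed
  show ?case
  proof (cases "s = t + single a 1")
    case True
    then show ?thesis unfolding eq by (simp add: lookup_add algebra_simps)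
  next
    case False
    \<comment> \<open>Truncated subtraction can also send a monomial without \<open>a\<close> to
      \<open>t\<close>; its contribution vanishes with the exponent.\<close>
    have "lookup s a = 0" if "s - single a 1 = t"
    proof (rule ccontr)
      assume "lookup s a \<noteq> 0"
      then have "s = s - single a 1 + single a 1"
        by (intro poly_mapping_eqI) (auto simp: lookup_add lookup_minus lookup_single when_def)
      then show False using that False by simp
    qed
    then show ?thesis using False unfolding eq by (auto simp: lookup_single when_def)
  qed
qed (simp_all add: gderiv_add lookup_add algebra_simps)

subsection \<open>Gradings\<close>

definition wdeg :: "('v \<Rightarrow> int) \<Rightarrow> ('v \<Rightarrow>\<^sub>0 nat) \<Rightarrow> int" where
  "wdeg w t = (\<Sum>v\<in>keys t. w v * int (lookup t v))"

definition homog :: "('v \<Rightarrow> int) \<Rightarrow> int \<Rightarrow> ('v, 'k::comm_ring_1) mpoly \<Rightarrow> bool" where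
  "homog w k p \<longleftrightarrow> (\<forall>t\<in>keys p. wdeg w t = k)"

lemma wdeg_superset: "finite S \<Longrightarrow> keys t \<subseteq> S \<Longrightarrow> wdeg w t = (\<Sum>v\<in>S. w v * int (lookup t v))"
  unfolding wdeg_def by (rule sum.mono_neutral_left) (auto simp: in_keys_iff)

lemma wdeg_add: "wdeg w (s + t) = wdeg w s + wdeg w t"
proof -
  let ?S = "keys s \<union> keys t"
  have "wdeg w (s + t) = (\<Sum>v\<in>?S. w v * int (lookup (s + t) v))"
    by (rule wdeg_superset) (auto simp: keys_add_nat)
  also have "\<dots> = wdeg w s + wdeg w t"
    by (simp add: lookup_add algebra_simps sum.distrib wdeg_superset[of ?S])
  finally show ?thesis .
qed

lemma wdeg_0 [simp]: "wdeg w 0 = 0"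
  by (simp add: wdeg_def)

lemma wdeg_single [simp]: "wdeg w (single v n) = w v * int n"
  by (cases "n = 0") (simp_all add: wdeg_def)

lemma mdeg_eq_wdeg: "int (mdeg t) = wdeg (\<lambda>_. 1) t"
  by (simp add: mdeg_def wdeg_def)

lemma homog_0 [simp]: "homog w k 0"
  by (simp add: homog_def)

lemma homog_mconst [simp]: "homog w 0 (mconst c)"
  by (auto simp: homog_def mconst_def split: if_splits)

lemma homog_mvar [simp]: "homog w (w v) (mvar v)"
  by (auto simp: homog_def mvar_def split: if_splits)

lemma homog_add: "homog w k p \<Longrightarrow> homog w k q \<Longrightarrow> homog w k (p + q)"
  using Poly_Mapping.keys_add[of p q] by (force simp: homog_def)

lemma homog_uminus: "homog w k p \<Longrightarrow> homog w k (- p)"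
  by (auto simp: homog_def in_keys_iff)

lemma homog_sum: "(\<And>i. i \<in> A \<Longrightarrow> homog w k (g i)) \<Longrightarrow> homog w k (\<Sum>i\<in>A. g i)"
  by (induction A rule: infinite_finite_induct) (simp_all add: homog_add)

lemma homog_mult: "homog w k p \<Longrightarrow> homog w l q \<Longrightarrow> homog w (k + l) (p * q)"
  using keys_mult[of p q] by (fastforce simp: homog_def wdeg_add)

lemma homog_cmult: "homog w k p \<Longrightarrow> homog w k (mconst c * p)"
  using homog_mult[OF homog_mconst, of w k p c] by simp

text \<open>Each term trades a factor \<open>b\<close> for \<open>d b\<close>, which changes the
  weight by \<open>a\<close>.\<close>

lemma homog_gderiv:
  assumes "p \<in> polys V" "homog w k p" "\<And>v. v \<in> V \<Longrightarrow> homog w (w v + a) (d v)"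
  shows "homog w (k + a) (gderiv d p)"
  unfolding gderiv_def
proof (intro homog_sum)
  fix t b assume t: "t \<in> keys p" and b: "b \<in> keys t"
  have "b \<in> V" using t b assms(1) by (auto simp: polys_iff)
  have "t = (t - single b 1) + single b 1"
    using b by (intro poly_mapping_eqI) (auto simp: lookup_add lookup_minus lookup_single when_def in_keys_iff)
  then have "wdeg w (t - single b 1) = k - w b"
    using assms(2) t wdeg_add[of w "t - single b 1" "single b 1"] by (auto simp: homog_def)
  then have "homog w (k - w b) (single (t - single b 1) (lookup p t * of_nat (lookup t b)))"
    by (auto simp: homog_def split: if_splits)
  from homog_mult[OF this assms(3)[OF \<open>b \<in> V\<close>]]
  show "homog w (k + a) (single (t - single b 1) (lookup p t * of_nat (lookup t b)) * d b)"
    by (simp add: algebra_simps)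
qed

lemma homog_psubst:
  assumes "homog w k p" "p \<in> polys V" "\<And>v. v \<in> V \<Longrightarrow> homog w' (w v) (g v)"
  shows "homog w' k (psubst g p)"
proof -
  have pow: "homog w' (int j * w v) (g v ^ j)" if "v \<in> V" for v j
  proof (induction j)
    case 0 show ?case using homog_mconst[of w' 1] by simp
  next
    case (Suc j)
    then show ?case using homog_mult[OF assms(3)[OF that] Suc] by (simp add: algebra_simps)
  qed
  have "homog w' (\<Sum>v\<in>S. w v * int (lookup t v)) (\<Prod>v\<in>S. g v ^ lookup t v)"
    if "finite S" "S \<subseteq> V" for S t
    using that
  proof (induction S)
    case empty show ?case using homog_mconst[of w' 1] by simp
  next
    case (insert v S)
    then show ?case using homog_mult[OF pow[of v "lookup t v"], of _ "\<Prod>v\<in>S. g v ^ lookup t v"]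
      by (simp add: mult.commute)
  qed
  then show ?thesis using assms(1,2) unfolding psubst_def mon_subst_def
    by (intro homog_sum homog_cmult) (auto simp: homog_def wdeg_def polys_iff)
qed

text \<open>Membership in the \<open>j\<close>-th power of the ideal generated by the variables.
  Error terms are controlled only up to this filtration.\<close>

definition order_ge :: "nat \<Rightarrow> ('v, 'k::comm_ring_1) mpoly \<Rightarrow> bool" where
  "order_ge j p \<longleftrightarrow> (\<forall>t\<in>keys p. j \<le> mdeg t)"

lemma mdeg_add: "mdeg (s + t) = mdeg s + mdeg t"
  using wdeg_add[of "\<lambda>_. 1" s t] by (simp flip: mdeg_eq_wdeg)

lemma mdeg_single [simp]: "mdeg (single v n) = n"
  using wdeg_single[of "\<lambda>_. 1" v n] by (simp flip: mdeg_eq_wdeg)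

lemma order_ge_0 [simp]: "order_ge j 0" and order_ge_zero [simp]: "order_ge 0 p"
  by (simp_all add: order_ge_def)

lemma order_ge_mono: "order_ge j p \<Longrightarrow> i \<le> j \<Longrightarrow> order_ge i p"
  by (auto simp: order_ge_def)

lemma order_ge_add: "order_ge j p \<Longrightarrow> order_ge j q \<Longrightarrow> order_ge j (p + q)"
  using Poly_Mapping.keys_add[of p q] by (force simp: order_ge_def)

lemma order_ge_uminus: "order_ge j p \<Longrightarrow> order_ge j (- p)"
  by (auto simp: order_ge_def in_keys_iff)

lemma order_ge_diff: "order_ge j p \<Longrightarrow> order_ge j q \<Longrightarrow> order_ge j (p - q)"
  using order_ge_add[of j p "- q"] order_ge_uminus[of j q] by simp

lemma order_ge_sum: "(\<And>i. i \<in> A \<Longrightarrow> order_ge j (g i)) \<Longrightarrow> order_ge j (\<Sum>i\<in>A. g i)"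
  by (induction A rule: infinite_finite_induct) (simp_all add: order_ge_add)

lemma order_ge_mult: "order_ge i p \<Longrightarrow> order_ge j q \<Longrightarrow> order_ge (i + j) (p * q)"
  using keys_mult[of p q] by (fastforce simp: order_ge_def mdeg_add)

lemma order_ge_cmult: "order_ge j p \<Longrightarrow> order_ge j (mconst c * p)"
  using order_ge_mult[of 0 "mconst c" j p] by simp

text \<open>Differentiation removes one factor and puts back at least \<open>i\<close> of them;
  hence the order \<open>j + 1\<close> in the hypothesis.\<close>

lemma order_ge_gderiv:
  assumes "p \<in> polys V" "order_ge (j + 1) p" "\<And>v. v \<in> V \<Longrightarrow> order_ge i (d v)"
  shows "order_ge (j + i) (gderiv d p)"
  unfolding gderiv_def
proof (intro order_ge_sum)
  fix t b assume t: "t \<in> keys p" and b: "b \<in> keys t"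
  have "b \<in> V" using t b assms(1) by (auto simp: polys_iff)
  have "t = (t - single b 1) + single b 1"
    using b by (intro poly_mapping_eqI) (auto simp: lookup_add lookup_minus lookup_single when_def in_keys_iff)
  then have "mdeg t = mdeg (t - single b 1) + 1"
    by (metis mdeg_add mdeg_single)
  moreover have "j + 1 \<le> mdeg t"
    using assms(2) t by (auto simp: order_ge_def)
  ultimately have "order_ge j (single (t - single b 1) (lookup p t * of_nat (lookup t b)))"
    by (auto simp: order_ge_def split: if_splits)
  from order_ge_mult[OF this assms(3)[OF \<open>b \<in> V\<close>]]
  show "order_ge (j + i) (single (t - single b 1) (lookup p t * of_nat (lookup t b)) * d b)" .
qed

lemma lookup_hom_part: "lookup (hom_part j p) t = (if mdeg t = j then lookup p t else 0)"
  by (auto simp: hom_part_def lookup_mapp in_keys_iff when_def)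

lemma keys_hom_part: "keys (hom_part j p) = {t \<in> keys p. mdeg t = j}"
  by (auto simp: in_keys_iff lookup_hom_part split: if_splits)

lemma hom_part_polys: "p \<in> polys V \<Longrightarrow> hom_part j p \<in> polys V"
  by (auto simp: polys_iff keys_hom_part)

lemma hom_part_homog: "homog w k p \<Longrightarrow> homog w k (hom_part j p)"
  by (auto simp: homog_def keys_hom_part)

lemma hom_part_homog_1: "homog (\<lambda>_. 1) (int j) (hom_part j p)"
  by (auto simp: homog_def keys_hom_part simp flip: mdeg_eq_wdeg)

lemma order_ge_minus_hom_part: "order_ge j p \<Longrightarrow> order_ge (Suc j) (p - hom_part j p)"
  by (force simp: order_ge_def in_keys_iff lookup_minus lookup_hom_part split: if_splits)

lemma homog_order_ge: "homog (\<lambda>_. 1) (int j) p \<Longrightarrow> order_ge j p"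
  by (auto simp: order_ge_def homog_def simp flip: mdeg_eq_wdeg)

text \<open>The degree is an integer because the lemma is applied to derivatives of components of
  degree \<open>j\<close>, whose degree is -1 when \<open>j = 0\<close>.\<close>

lemma homog_order_ge_imp_0: "homog (\<lambda>_. 1) j p \<Longrightarrow> order_ge i p \<Longrightarrow> j < int i \<Longrightarrow> p = 0"
  by (fastforce simp: order_ge_def homog_def simp flip: mdeg_eq_wdeg keys_eq_empty)

text \<open>Closedness says that \<open>c\<^sub>b(t - b) / t\<^sub>b\<close> does not depend on the variable \<open>b\<close> of the monomial \<open>t\<close>.\<close>

lemma polynomial_poincare:
  fixes c :: "'v \<Rightarrow> ('v, 'k::field_char_0) mpoly"
  assumes J: "finite J"
    and closed: "\<And>a b. a \<in> J \<Longrightarrow> b \<in> J \<Longrightarrow> pd a (c b) = pd b (c a)"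
  obtains q where "\<And>a. a \<in> J \<Longrightarrow> pd a q = c a"
    and "\<And>t. t \<in> keys q \<Longrightarrow> \<exists>b\<in>J. \<exists>s\<in>keys (c b). t = s + single b 1"
proof -
  define B where "B t = (SOME b. b \<in> J \<inter> keys t)" for t :: "'v \<Rightarrow>\<^sub>0 nat"
  \<comment> \<open>Coefficientwise integration in one chosen variable of \<open>J\<close>.
    Monomials free of \<open>J\<close> get 0; this fixes the constant of integration, so that the
    primitive vanishes where all variables of \<open>J\<close> do.\<close>
  define F where "F t = (if J \<inter> keys t = {} then 0 else
      lookup (c (B t)) (t - single (B t) 1) / of_nat (lookup t (B t)))" for t
  have B: "B t \<in> J \<inter> keys t" if "J \<inter> keys t \<noteq> {}" for t
    unfolding B_def by (rule someI_ex) (use that in blast)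
  have split: "t = (t - single b 1) + single b 1" if "b \<in> keys t" for t :: "'v \<Rightarrow>\<^sub>0 nat" and b
    using that by (intro poly_mapping_eqI) (auto simp: lookup_add lookup_minus lookup_single when_def in_keys_iff)
  have supp: "\<exists>b\<in>J. \<exists>s\<in>keys (c b). t = s + single b 1" if "F t \<noteq> 0" for t
  proof -
    from that have ne: "J \<inter> keys t \<noteq> {}" by (auto simp: F_def)
    show ?thesis
      using that B[OF ne] split[of "B t" t] by (auto simp: F_def in_keys_iff intro!: bexI[of _ "B t"] bexI[of _ "t - single (B t) 1"] split: if_splits)
  qed
  have "finite {t. F t \<noteq> 0}"
  proof (rule finite_subset)
    show "{t. F t \<noteq> 0} \<subseteq> (\<Union>b\<in>J. (\<lambda>s. s + single b 1) ` keys (c b))"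
      using supp by blast
  qed (use J in auto)
  then have lookup: "lookup (Abs_poly_mapping F) = F" by (rule lookup_Abs_poly_mapping)
  have indep: "lookup (c a) (t - single a 1) * of_nat (lookup t b) = lookup (c b) (t - single b 1) * of_nat (lookup t a)"
    if a: "a \<in> J" "a \<in> keys t" and b: "b \<in> J" "b \<in> keys t" for a b t
  proof (cases "a = b")
    case False
    let ?s = "t - single a 1 - single b 1"
    have 1: "?s + single b 1 = t - single a 1"
      using a b False by (intro poly_mapping_eqI) (auto simp: lookup_add lookup_minus lookup_single when_def in_keys_iff)
    have 2: "?s + single a 1 = t - single b 1"
      using a b False by (intro poly_mapping_eqI) (auto simp: lookup_add lookup_minus lookup_single when_def in_keys_iff)
    have 3: "lookup ?s a + 1 = lookup t a" "lookup ?s b + 1 = lookup t b"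
      using a b False by (auto simp: lookup_minus lookup_single when_def in_keys_iff)
    \<comment> \<open>Both derivatives are compared at the monomial \<open>t\<close> with one
      \<open>a\<close> and one \<open>b\<close> removed.\<close>
    have "lookup (pd a (c b)) ?s = lookup (pd b (c a)) ?s" using closed[OF a(1) b(1)] by simp
    then show ?thesis unfolding lookup_pd 1 2 3 by (simp add: mult.commute)
  qed simp
  show ?thesis
  proof (rule that)
    fix a assume a: "a \<in> J"
    show "pd a (Abs_poly_mapping F) = c a"
    proof (rule poly_mapping_eqI)
      fix s :: "'v \<Rightarrow>\<^sub>0 nat"
      let ?t = "s + single a 1"
      have at: "a \<in> keys ?t" by (simp add: in_keys_iff lookup_add)
      then have ne: "J \<inter> keys ?t \<noteq> {}" using a by auto
      note Bt = B[OF ne]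
      have ta: "lookup s a + 1 = lookup ?t a" by (simp add: lookup_add)
      have "lookup (c a) (?t - single a 1) * of_nat (lookup ?t (B ?t))
          = lookup (c (B ?t)) (?t - single (B ?t) 1) * of_nat (lookup ?t a)"
        using Bt a at by (intro indep) auto
      moreover have "of_nat (lookup ?t (B ?t)) \<noteq> (0::'k)" using Bt by (auto simp: in_keys_iff)
      ultimately have "of_nat (lookup ?t a) * F ?t = lookup (c a) (?t - single a 1)"
        unfolding F_def using ne by (simp add: field_simps)
      then show "lookup (pd a (Abs_poly_mapping F)) s = lookup (c a) s"
        unfolding lookup_pd lookup ta by simp
    qed
  next
    fix t assume "t \<in> keys (Abs_poly_mapping F)"
    then show "\<exists>b\<in>J. \<exists>s\<in>keys (c b). t = s + single b 1"
      using supp by (simp add: in_keys_iff lookup)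
  qed
qed

lemma lookup_mconst_mult: "lookup (mconst a * p) t = a * lookup p t"
proof (induction p rule: mpoly_additive_induct)
  case (single s c)
  then show ?case by (simp add: mconst_def mult_single lookup_single when_def)
qed (simp_all add: lookup_add algebra_simps)

text \<open>The Euler field with weights \<open>w\<close>, of which every monomial is an
  eigenvector. On the polynomials in \<open>qbasis\<close> the action of \<open>h\<close> is of this
  kind.\<close>

lemma lookup_euler: "lookup (gderiv (\<lambda>b. mconst (of_int (w b)) * mvar b) p) t = of_int (wdeg w t) * lookup p t"
proof (induction p rule: mpoly_additive_induct)
  case (single s c)
  have eq: "s - single b 1 + single b 1 = s" if "b \<in> keys s" for b
    using that by (intro poly_mapping_eqI) (auto simp: lookup_add lookup_minus lookup_single when_def in_keys_iff)
  have "gderiv (\<lambda>b. mconst (of_int (w b)) * mvar b) (single s c)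
      = (\<Sum>b\<in>keys s. single s (c * of_int (w b * int (lookup s b))))"
    unfolding gderiv_single
    by (intro sum.cong refl) (simp only: mconst_def mvar_def mult_single eq add_0_left mult_1_right mult_1_left
        of_int_mult of_int_of_nat_eq, simp only: ac_simps)
  also have "\<dots> = single s (c * of_int (wdeg w s))"
    by (intro poly_mapping_eqI)
      (simp add: wdeg_def lookup_sum lookup_single when_def sum_distrib_left)
  finally show ?case by (simp add: lookup_single when_def)
qed (simp_all add: gderiv_add lookup_add algebra_simps)

lemma wdeg_ge_mdeg: "(\<And>v. v \<in> keys t \<Longrightarrow> w v \<ge> 1) \<Longrightarrow> int (mdeg t) \<le> wdeg w t"
  unfolding mdeg_eq_wdeg wdeg_def by (intro sum_mono mult_right_mono) auto

text \<open>Characteristic zero enters: a monomial containing \<open>b\<close> leaves a nonzero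
  multiple of its coefficient in the derivative.\<close>

lemma polys_of_pd_zero:
  fixes p :: "('v, 'k::{comm_ring_1, ring_char_0, ring_no_zero_divisors}) mpoly"
  assumes "p \<in> polys V" "\<And>b. b \<in> J \<Longrightarrow> pd b p = 0"
  shows "p \<in> polys (V - J)"
  unfolding polys_iff
proof (intro ballI subsetI)
  fix t b assume t: "t \<in> keys p" and b: "b \<in> keys t"
  then have "b \<in> V" using assms(1) by (auto simp: polys_iff)
  moreover have "b \<notin> J"
  proof
    assume "b \<in> J"
    have eq: "t - single b 1 + single b 1 = t"
      using b by (intro poly_mapping_eqI) (auto simp: lookup_add lookup_minus lookup_single when_def in_keys_iff)
    have "lookup (pd b p) (t - single b 1) = 0" using assms(2)[OF \<open>b \<in> J\<close>] by simp
    then have "of_nat (lookup (t - single b 1) b + 1) * lookup p t = 0" unfolding lookup_pd eq .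
    moreover have "of_nat (lookup (t - single b 1) b + 1) \<noteq> (0::'k)" by (simp only: of_nat_eq_0_iff)
    ultimately have "lookup p t = 0" by simp
    then show False using t by (simp add: in_keys_iff)
  qed
  ultimately show "b \<in> V - J" by simp
qed

lemma hom_part_0 [simp]: "hom_part j 0 = 0"
  by (rule poly_mapping_eqI) (simp add: lookup_hom_part)

lemma restrict_vars_polys: "restrict_vars V p \<in> polys V"
  unfolding polys_iff by (metis in_keys_iff lookup_restrict_vars)

lemma restrict_vars_id: "p \<in> polys V \<Longrightarrow> restrict_vars V p = p"
  by (rule poly_mapping_eqI) (auto simp: lookup_restrict_vars polys_iff in_keys_iff)

lemma hom_part_restrict_vars: "hom_part j (restrict_vars V p) = restrict_vars V (hom_part j p)"
  by (rule poly_mapping_eqI) (simp add: lookup_restrict_vars lookup_hom_part)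

lemma lowest_hom_part:
  assumes "p \<noteq> 0"
  obtains j where "order_ge j p" "hom_part j p \<noteq> 0" "lowest_part p = hom_part j p"
proof -
  define j where "j = (LEAST j. hom_part j p \<noteq> 0)"
  obtain t where "t \<in> keys p" using assms by (metis keys_eq_empty ex_in_conv)
  then have "hom_part (mdeg t) p \<noteq> 0"
    using keys_hom_part[of "mdeg t" p] by auto
  then have "hom_part j p \<noteq> 0" unfolding j_def by (rule LeastI)
  moreover have "order_ge j p"
    unfolding order_ge_def
  proof
    fix t assume "t \<in> keys p"
    then have "hom_part (mdeg t) p \<noteq> 0" using keys_hom_part[of "mdeg t" p] by auto
    then show "j \<le> mdeg t" unfolding j_def by (rule Least_le)
  qed
  ultimately show ?thesis using that by (simp add: lowest_part_def j_def)
qed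

lemma lowest_part_eqI:
  assumes "order_ge j p" "hom_part j p \<noteq> 0"
  shows "lowest_part p = hom_part j p"
proof -
  have "hom_part i p = 0" if "i < j" for i
    using assms(1) that unfolding order_ge_def Ball_def in_keys_iff
    by (intro poly_mapping_eqI) (auto simp: lookup_hom_part)
  then have "(LEAST j. hom_part j p \<noteq> 0) = j"
    using assms(2) by (intro Least_equality) (auto simp: not_less[symmetric])
  then show ?thesis by (simp add: lowest_part_def)
qed

section \<open>The grading\<close>

context lie_algebra
begin

section \<open>Rules for the bracket\<close>

lemma bracket_add_left: "bracket (u + u') v = bracket u v + bracket u' v"
  using module_hom.add[OF Vector_Spaces.linear.axioms(3)[OF bracket_linear_left]] .

lemma bracket_add_right: "bracket u (v + v') = bracket u v + bracket u v'"
  using module_hom.add[OF Vector_Spaces.linear.axioms(3)[OF bracket_linear_right]] .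

lemma bracket_scale_left: "bracket (scale c u) v = scale c (bracket u v)"
  using module_hom.scale[OF Vector_Spaces.linear.axioms(3)[OF bracket_linear_left]] .

lemma bracket_scale_right: "bracket u (scale c v) = scale c (bracket u v)"
  using module_hom.scale[OF Vector_Spaces.linear.axioms(3)[OF bracket_linear_right]] .

lemma bracket_zero_left [simp]: "bracket 0 v = 0"
  using bracket_scale_left[of 0 0 v] by simp

lemma bracket_zero_right [simp]: "bracket u 0 = 0"
  using bracket_scale_right[of u 0 0] by simp

lemma bracket_minus_left: "bracket (- u) v = - bracket u v"
  using bracket_scale_left[of "-1" u v] by simp

lemma bracket_minus_right: "bracket u (- v) = - bracket u v"
  using bracket_scale_right[of u "-1" v] by simp

lemma bracket_diff_left: "bracket (u - u') v = bracket u v - bracket u' v"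
  using bracket_add_left[of u "- u'" v] by (simp add: bracket_minus_left)

lemma bracket_diff_right: "bracket u (v - v') = bracket u v - bracket u v'"
  using bracket_add_right[of u v "- v'"] by (simp add: bracket_minus_right)

lemma bracket_sum_left: "bracket (\<Sum>i\<in>A. c i) v = (\<Sum>i\<in>A. bracket (c i) v)"
  by (induction A rule: infinite_finite_induct) (simp_all add: bracket_add_left)

lemma bracket_sum_right: "bracket u (\<Sum>i\<in>A. c i) = (\<Sum>i\<in>A. bracket u (c i))"
  by (induction A rule: infinite_finite_induct) (simp_all add: bracket_add_right)

lemma bracket_anti: "bracket u v = - bracket v u"
proof -
  have "bracket u v + bracket v u = 0"
    using bracket_self[of "u + v"] unfolding bracket_add_left bracket_add_right
    by (simp add: bracket_self add.commute)
  then show ?thesis by (simp add: eq_neg_iff_add_eq_0)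
qed

text \<open>The Jacobi identity in the form that makes \<open>bracket\<close> a representation of
  the Lie algebra on itself; all later arguments use it in this shape.\<close>

lemma bracket_bracket: "bracket (bracket u v) w = bracket u (bracket v w) - bracket v (bracket u w)"
  using jacobi[of u v w] bracket_anti[of "bracket u v" w] bracket_anti[of w u]
  by (simp add: bracket_minus_right) (metis add_diff_cancel_right' add.commute add_eq_0_iff minus_minus)

lemma span_family:
  assumes "finite A" "v \<in> span (a ` A)"
  obtains c where "v = (\<Sum>i\<in>A. scale (c i) (a i))"
proof -
  have "v \<in> span (a ` A) \<Longrightarrow> \<exists>c. v = (\<Sum>i\<in>A. scale (c i) (a i))" using assms(1)
  proof (induction A arbitrary: v)
    case (insert i A)
    then obtain k where "v - scale k (a i) \<in> span (a ` A)"
      using span_breakdown_eq[of v "a i" "a ` A"] by auto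
    then obtain c where c: "v - scale k (a i) = (\<Sum>i\<in>A. scale (c i) (a i))" using insert.IH by blast
    have "(\<Sum>j\<in>A. scale ((c(i := k)) j) (a j)) = (\<Sum>j\<in>A. scale (c j) (a j))"
      using insert.hyps by (intro sum.cong) auto
    then have "v = (\<Sum>j\<in>insert i A. scale ((c(i := k)) j) (a j))"
      using insert.hyps c by (simp add: algebra_simps)
    then show ?case by blast
  qed simp
  with assms(2) that show ?thesis by blast
qed

lemma bracket_span_subspace:
  assumes "u \<in> span S" "v \<in> span T" "subspace W" "\<And>u v. u \<in> S \<Longrightarrow> v \<in> T \<Longrightarrow> bracket u v \<in> W"
  shows "bracket u v \<in> W"
proof -
  have 1: "bracket u v \<in> W" if "u \<in> S" "v \<in> span T" for u v
    using that(2) by (rule span_induct)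
      (use assms(3,4) that(1) in \<open>auto simp: subspace_def bracket_add_right bracket_scale_right\<close>)
  show ?thesis
    using assms(1) by (rule span_induct)
      (use assms(2,3) 1 in \<open>auto simp: subspace_def bracket_add_left bracket_scale_left\<close>)
qed

section \<open>Weight spaces of an arbitrary element\<close>

lemma weight_spaceD: "v \<in> weight_space h i \<Longrightarrow> bracket h v = scale (of_int i) v"
  by (simp add: weight_space_def)

lemma subspace_weight_space: "subspace (weight_space h i)"
  by (auto simp: subspace_def weight_space_def bracket_add_right bracket_scale_right
      scale_right_distrib mult.commute)

lemma weight_space_bracket:
  assumes "u \<in> weight_space h i" "v \<in> weight_space h j"
  shows "bracket u v \<in> weight_space h (i + j)"
proof -
  have "bracket h (bracket u v) = bracket (bracket h u) v + bracket u (bracket h v)"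
    using bracket_bracket[of h u v] by simp
  then show ?thesis using assms
    by (simp add: weight_space_def bracket_scale_left bracket_scale_right scale_left_distrib)
qed

text \<open>Subtracting \<open>j\<close> times the relation from its image under \<open>ad h\<close>
  removes the component of weight \<open>j\<close> and multiplies the others by
  \<open>i - j\<close>, which is nonzero in the field.\<close>

lemma weight_space_independent:
  assumes "finite F" "\<And>i. i \<in> F \<Longrightarrow> c i \<in> weight_space h i" "(\<Sum>i\<in>F. c i) = 0" "i \<in> F"
  shows "c i = 0"
  using assms
proof (induction F arbitrary: c i)
  case (insert j F)
  have "bracket h (\<Sum>i\<in>insert j F. c i) - scale (of_int j) (\<Sum>i\<in>insert j F. c i)
      = (\<Sum>i\<in>insert j F. bracket h (c i) - scale (of_int j) (c i))"
    by (simp only: bracket_sum_right scale_sum_right sum_subtractf)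
  also have "\<dots> = (\<Sum>i\<in>insert j F. scale (of_int (i - j)) (c i))"
    by (intro sum.cong refl) (use insert.prems(1) in \<open>simp add: weight_space_def scale_left_diff_distrib\<close>)
  also have "\<dots> = (\<Sum>i\<in>F. scale (of_int (i - j)) (c i))"
    using insert.hyps by simp
  finally have sum: "(\<Sum>i\<in>F. scale (of_int (i - j)) (c i)) = 0"
    using insert.prems(2) by simp
  have 0: "c k = 0" if "k \<in> F" for k
  proof -
    have "scale (of_int (k - j)) (c k) = 0"
      by (rule insert.IH[OF _ sum that])
        (use insert.prems(1) subspace_weight_space in \<open>auto intro: subspace_scale\<close>)
    moreover have "of_int (k - j) \<noteq> (0::'k)" using that insert.hyps by auto
    ultimately show ?thesis by (simp add: scale_eq_0_iff)
  qed
  moreover have "c j = 0" using insert.prems(2) insert.hyps 0 by simp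
  ultimately show ?case using insert.prems(3) by auto
qed simp

lemma weight_sum_explicit:
  assumes "v \<in> span (\<Union>i\<in>I. weight_space h i)"
  obtains F c where "finite F" "F \<subseteq> I" "\<And>i. c i \<in> weight_space h i" "v = (\<Sum>i\<in>F. c i)"
proof -
  define T where "T = {v. \<exists>F c. finite F \<and> F \<subseteq> I \<and> (\<forall>i. c i \<in> weight_space h i) \<and> v = (\<Sum>i\<in>F. c i)}"
  have "subspace T"
    unfolding subspace_def
  proof (intro conjI ballI allI)
    show "0 \<in> T" unfolding T_def using subspace_0[OF subspace_weight_space]
      by (auto intro!: exI[of _ "{}"] exI[of _ "\<lambda>_. 0"])
  next
    fix u v assume "u \<in> T" "v \<in> T"
    then obtain F c F' c' where
      u: "finite F" "F \<subseteq> I" "\<And>i. c i \<in> weight_space h i" "u = (\<Sum>i\<in>F. c i)" and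
      v: "finite F'" "F' \<subseteq> I" "\<And>i. c' i \<in> weight_space h i" "v = (\<Sum>i\<in>F'. c' i)"
      unfolding T_def by blast
    define d where "d i = (if i \<in> F then c i else 0) + (if i \<in> F' then c' i else 0)" for i
    have "d i \<in> weight_space h i" for i
      unfolding d_def using u(3) v(3) subspace_weight_space
      by (auto intro: subspace_add subspace_0)
    moreover have "u + v = (\<Sum>i\<in>F \<union> F'. d i)"
    proof -
      have "(\<Sum>i\<in>F \<union> F'. if i \<in> F then c i else 0) = u"
        unfolding u(4) using u(1) v(1) by (subst sum.inter_restrict[symmetric]) (auto intro: sum.cong)
      moreover have "(\<Sum>i\<in>F \<union> F'. if i \<in> F' then c' i else 0) = v"
        unfolding v(4) using u(1) v(1) by (subst sum.inter_restrict[symmetric]) (auto intro: sum.cong)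
      ultimately show ?thesis by (simp add: d_def sum.distrib)
    qed
    ultimately show "u + v \<in> T" unfolding T_def using u(1,2) v(1,2)
      by (intro CollectI exI[of _ "F \<union> F'"] exI[of _ d]) auto
  next
    fix a u assume "u \<in> T"
    then obtain F c where
      u: "finite F" "F \<subseteq> I" "\<And>i. c i \<in> weight_space h i" "u = (\<Sum>i\<in>F. c i)"
      unfolding T_def by blast
    then show "scale a u \<in> T" unfolding T_def
      using subspace_weight_space
      by (intro CollectI exI[of _ F] exI[of _ "\<lambda>i. scale a (c i)"])
        (auto simp: scale_sum_right intro: subspace_scale)
  qed
  moreover have "(\<Union>i\<in>I. weight_space h i) \<subseteq> T"
  proof
    fix u assume "u \<in> (\<Union>i\<in>I. weight_space h i)"
    then obtain i where "i \<in> I" "u \<in> weight_space h i" by blast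
    then show "u \<in> T" unfolding T_def using subspace_0[OF subspace_weight_space]
      by (intro CollectI exI[of _ "{i}"] exI[of _ "\<lambda>j. if j = i then u else 0"]) auto
  qed
  ultimately have "v \<in> T" using assms span_minimal by blast
  then show ?thesis using that unfolding T_def by blast
qed

text \<open>Two expansions over disjoint sets of weights combine into one vanishing sum of weight
  vectors.\<close>

lemma weight_span_disjoint:
  assumes u: "u \<in> span (\<Union>i\<in>I. weight_space h i)" "u \<in> span (\<Union>i\<in>I'. weight_space h i)" and disj: "I \<inter> I' = {}"
  shows "u = 0"
proof -
  obtain F c where F: "finite F" "F \<subseteq> I" "\<And>i. c i \<in> weight_space h i" "u = (\<Sum>i\<in>F. c i)"
    using weight_sum_explicit[OF u(1)] by metis
  obtain F' c' where F': "finite F'" "F' \<subseteq> I'" "\<And>i. c' i \<in> weight_space h i" "u = (\<Sum>i\<in>F'. c' i)"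
    using weight_sum_explicit[OF u(2)] by metis
  have FF: "F \<inter> F' = {}" using F F' disj by blast
  define d where "d i = (if i \<in> F then c i else - c' i)" for i
  have d: "d i \<in> weight_space h i" for i
    using F(3) F'(3) subspace_neg[OF subspace_weight_space] by (auto simp: d_def)
  have "(\<Sum>i\<in>F \<union> F'. d i) = (\<Sum>i\<in>F. d i) + (\<Sum>i\<in>F'. d i)"
    using F(1) F'(1) FF by (rule sum.union_disjoint)
  also have "(\<Sum>i\<in>F. d i) = u" by (simp add: d_def F(4))
  also have "(\<Sum>i\<in>F'. d i) = (\<Sum>i\<in>F'. - c' i)" using FF by (intro sum.cong) (auto simp: d_def)
  also have "\<dots> = - u" by (simp add: F'(4) sum_negf)
  finally have "(\<Sum>i\<in>F \<union> F'. d i) = 0" by simp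
  then have "d i = 0" if "i \<in> F \<union> F'" for i
    using weight_space_independent[of "F \<union> F'" d h i] d that F(1) F'(1) by blast
  then have "(\<Sum>i\<in>F. d i) = 0" by simp
  then show ?thesis by (simp add: d_def F(4))
qed

lemma weight_spaces_disjoint:
  "u \<in> weight_space h i \<Longrightarrow> u \<in> weight_space h j \<Longrightarrow> i \<noteq> j \<Longrightarrow> u = 0"
  using weight_span_disjoint[of u h "{i}" "{j}"] by (simp add: span_base)

end

context W_algebra_data
begin

section \<open>Action of the triple on the weight spaces\<close>

abbreviation gw :: "int \<Rightarrow> 'g set" where "gw i \<equiv> weight_space h i"

lemma e_weight: "e \<in> gw 2" and f_weight: "f \<in> gw (-2)" and bracket_e_f: "bracket e f = h"
  using triple by (auto simp: sl2_triple_def weight_space_def)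

lemma ad_e_weight: "u \<in> gw i \<Longrightarrow> bracket e u \<in> gw (i + 2)"
  using weight_space_bracket[OF e_weight, of u i] by (simp add: add.commute)

lemma ad_f_weight: "u \<in> gw i \<Longrightarrow> bracket f u \<in> gw (i - 2)"
  using weight_space_bracket[OF f_weight, of u i] by simp

lemma ad_e_f: "bracket e (bracket f v) = bracket f (bracket e v) + bracket h v"
  using bracket_bracket[of e f v] by (simp add: bracket_e_f)

lemma ad_h_e: "bracket h (bracket e v) = bracket e (bracket h v) + scale 2 (bracket e v)"
  using bracket_bracket[of h e v] weight_spaceD[OF e_weight] by (simp add: bracket_scale_left algebra_simps)

lemma ad_e_pow_weight: "u \<in> gw i \<Longrightarrow> (bracket e ^^ k) u \<in> gw (i + 2 * int k)"
proof (induction k)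
  case (Suc k)
  then show ?case using ad_e_weight[of "(bracket e ^^ k) u" "i + 2 * int k"] by (simp add: algebra_simps)
qed simp

text \<open>Moving \<open>f\<close> past \<open>k + 1\<close> factors \<open>ad e\<close> produces
  \<open>h\<close> at the weights \<open>j\<close>, \<open>j + 2\<close>, ...,
  \<open>j + 2k\<close>, whose sum is \<open>(k + 1)(j + k)\<close>.\<close>

lemma ad_e_pow_f:
  assumes w: "w \<in> gw j"
  shows "(bracket e ^^ Suc k) (bracket f w) =
    bracket f ((bracket e ^^ Suc k) w) + scale (of_int ((int k + 1) * (j + int k))) ((bracket e ^^ k) w)"
proof (induction k)
  case 0
  then show ?case using weight_spaceD[OF w] by (simp add: ad_e_f)
next
  case (Suc k)
  let ?c = "of_int ((int k + 1) * (j + int k)) :: 'k"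
  have wk: "bracket h ((bracket e ^^ Suc k) w) = scale (of_int (j + 2 * int (Suc k))) ((bracket e ^^ Suc k) w)"
    using weight_spaceD[OF ad_e_pow_weight[OF w]] .
  have "(bracket e ^^ Suc (Suc k)) (bracket f w) =
      bracket e (bracket f ((bracket e ^^ Suc k) w) + scale ?c ((bracket e ^^ k) w))"
    using Suc by simp
  also have "\<dots> = bracket f ((bracket e ^^ Suc (Suc k)) w) + bracket h ((bracket e ^^ Suc k) w)
     + scale ?c ((bracket e ^^ Suc k) w)"
    by (simp add: bracket_add_right bracket_scale_right ad_e_f)
  also have "\<dots> = bracket f ((bracket e ^^ Suc (Suc k)) w) +
     scale (of_int (j + 2 * int (Suc k)) + ?c) ((bracket e ^^ Suc k) w)"
    unfolding wk by (simp add: scale_left_distrib add.assoc)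
  also have "of_int (j + 2 * int (Suc k)) + ?c = of_int ((int (Suc k) + 1) * (j + int (Suc k)))"
    by (simp add: algebra_simps)
  finally show ?case .
qed

lemma ad_e_pow_add: "(bracket e ^^ k) (u + v) = (bracket e ^^ k) u + (bracket e ^^ k) v"
  by (induction k) (simp_all add: bracket_add_right)

lemma ad_e_pow_scale: "(bracket e ^^ k) (scale c u) = scale c ((bracket e ^^ k) u)"
  by (induction k) (simp_all add: bracket_scale_right)

lemma ad_e_nilpotent: obtains N where "\<And>v. (bracket e ^^ N) v = 0"
  using nilpotent by (auto simp: nilpotent_element_def)

text \<open>If \<open>ad e\<^sup>k\<^sup>+\<^sup>1 w = 0\<close>, then \<open>ad e\<^sup>k\<close> kills \<open>[e, [f, w]] - (k + 1)(j + k) w\<close>, and the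
  scalar is nonzero for \<open>j > 0\<close>.\<close>

lemma ad_e_surjective:
  assumes "w \<in> gw j" "j > 0"
  obtains w' where "w' \<in> gw (j - 2)" "bracket e w' = w"
proof -
  have "\<exists>w'. w' \<in> gw (j - 2) \<and> bracket e w' = w" if "(bracket e ^^ k) w = 0" "w \<in> gw j" for k w
    using that
  proof (induction k arbitrary: w)
    case 0
    then show ?case using subspace_0[OF subspace_weight_space] by (intro exI[of _ 0]) simp
  next
    case (Suc k)
    define c where "c = (of_int ((int k + 1) * (j + int k)) :: 'k)"
    have c: "c \<noteq> 0" unfolding c_def using assms(2) by (simp only: of_int_eq_0_iff) auto
    define w1 where "w1 = bracket e (bracket f w) + scale (- c) w"
    have "(bracket e ^^ k) w1 = (bracket e ^^ Suc k) (bracket f w) - scale c ((bracket e ^^ k) w)"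
      unfolding w1_def ad_e_pow_add ad_e_pow_scale by (simp add: funpow_swap1)
    also have "\<dots> = 0"
      unfolding ad_e_pow_f[OF Suc.prems(2)] Suc.prems(1) c_def by simp
    finally have "(bracket e ^^ k) w1 = 0" .
    moreover have "w1 \<in> gw j"
      unfolding w1_def
      using ad_e_weight[OF ad_f_weight[OF Suc.prems(2)]] Suc.prems(2)
      by (intro subspace_add[OF subspace_weight_space] subspace_scale[OF subspace_weight_space]) auto
    ultimately obtain w2 where w2: "w2 \<in> gw (j - 2)" "bracket e w2 = w1" using Suc.IH by blast
    \<comment> \<open>Since \<open>[e, w2] = [e, [f, w]] - c w\<close>, the vector
      \<open>[f, w] - w2\<close> is sent to \<open>c w\<close>.\<close>
    have "bracket e (scale (inverse c) (bracket f w - w2)) = w"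
      using c by (simp add: bracket_scale_right bracket_diff_right w2 w1_def)
    moreover have "scale (inverse c) (bracket f w - w2) \<in> gw (j - 2)"
      using ad_f_weight[OF Suc.prems(2)] w2(1) subspace_weight_space
      by (intro subspace_scale subspace_diff) auto
    ultimately show ?case by blast
  qed
  with ad_e_nilpotent assms(1) that show ?thesis by metis
qed

lemma x_in_centralizer: "i \<in> {1..r} \<Longrightarrow> bracket e (x i) = 0"
proof -
  assume "i \<in> {1..r}"
  then have "x i \<in> centralizer e"
    using x_centralizer span_base[of "x i" "x ` {1..r}"] by (auto simp: family_basis_def)
  then show ?thesis by (simp add: centralizer_def)
qed

lemma x_inj: "inj_on x {1..m}" and x_indep: "independent (x ` {1..m})"
  and x_span: "span (x ` {1..m}) = span (\<Union>i\<in>{0..}. gw i)"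
  using x_basis by (auto simp: family_basis_def)

lemma x_nonzero: "i \<in> {1..m} \<Longrightarrow> x i \<noteq> 0"
  using x_indep dependent_zero by (metis imageI)

lemma n_nonneg: "i \<in> {1..m} \<Longrightarrow> n i \<ge> 0"
proof (rule ccontr)
  assume i: "i \<in> {1..m}" and "\<not> n i \<ge> 0"
  moreover have "x i \<in> span (\<Union>i\<in>{0..}. gw i)"
    unfolding x_span[symmetric] using i by (auto intro: span_base)
  moreover have "x i \<in> span (\<Union>i\<in>{n i}. gw i)"
    using x_weight[OF i] by (auto intro: span_base)
  ultimately have "x i = 0" using weight_span_disjoint[of "x i" h "{0..}" "{n i}"] by auto
  with x_nonzero[OF i] show False by simp
qed

lemma centralizer_explicit:
  assumes "bracket e u = 0"
  obtains c where "u = (\<Sum>i\<in>{1..r}. scale (c i) (x i))"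
  using span_family[of "{1..r}" u x] assms x_centralizer
  by (auto simp: family_basis_def centralizer_def)

lemma centralizer_nonneg:
  assumes "bracket e u = 0"
  shows "u \<in> span (\<Union>i\<in>{0..}. gw i)"
  using assms x_centralizer span_mono[of "x ` {1..r}" "x ` {1..m}"] r_le_m
  unfolding x_span[symmetric] by (force simp: family_basis_def centralizer_def)

text \<open>The kernel of \<open>ad e\<close> is spanned by vectors of nonnegative weight, so it
  contains no nonzero vector of negative weight.\<close>

lemma ad_e_inj:
  assumes "u \<in> gw i" "i < 0" "bracket e u = 0"
  shows "u = 0"
  using weight_span_disjoint[OF centralizer_nonneg[OF assms(3)], of "{i}"] assms by (simp add: span_base)

text \<open>Surjectivity of \<open>ad e\<close> is known only onto positive weights, so here the
  weights are stripped off one at a time. Applying \<open>ad h - (j - 2)\<close> to \<open>v\<close>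
  removes \<open>w j\<close> from the image. This operator is then inverted on the pieces found by
  induction; the remaining part of \<open>v\<close> is killed by it and therefore has weight
  \<open>j - 2\<close>.\<close>

lemma ad_e_preimage_nonpos:
  assumes "finite F" "\<And>i. i \<in> F \<Longrightarrow> i \<le> 0" "\<And>i. i \<in> F \<Longrightarrow> w i \<in> gw i"
    and "bracket e v = (\<Sum>i\<in>F. w i)"
  shows "\<exists>a u. (\<forall>i\<in>F. a i \<in> gw (i - 2)) \<and> bracket e u = 0 \<and> v = (\<Sum>i\<in>F. a i) + u"
  using assms
proof (induction F arbitrary: v w)
  case empty
  then show ?case by (auto intro!: exI[of _ v])
next
  case (insert j F)
  define v1 where "v1 = bracket h v - scale (of_int (j - 2)) v"
  have "bracket e v1 = bracket h (bracket e v) - scale (of_int j) (bracket e v)"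
    by (simp add: v1_def bracket_diff_right bracket_scale_right ad_h_e scale_left_diff_distrib)
  also have "\<dots> = (\<Sum>i\<in>insert j F. scale (of_int (i - j)) (w i))"
    unfolding insert.prems(3) bracket_sum_right scale_sum_right sum_subtractf[symmetric]
    by (intro sum.cong refl) (use insert.prems(2) in \<open>simp add: weight_space_def scale_left_diff_distrib\<close>)
  also have "\<dots> = (\<Sum>i\<in>F. scale (of_int (i - j)) (w i))"
    using insert.hyps by simp
  finally have "bracket e v1 = (\<Sum>i\<in>F. scale (of_int (i - j)) (w i))" .
  then have "\<exists>a u. (\<forall>i\<in>F. a i \<in> gw (i - 2)) \<and> bracket e u = 0 \<and> v1 = (\<Sum>i\<in>F. a i) + u"
    by (intro insert.IH) (use insert.prems subspace_scale[OF subspace_weight_space] in auto)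
  then obtain a u where a: "\<And>i. i \<in> F \<Longrightarrow> a i \<in> gw (i - 2)" and u: "bracket e u = 0"
    and v1: "v1 = (\<Sum>i\<in>F. a i) + u" by blast
  obtain c where c: "u = (\<Sum>l\<in>{1..r}. scale (c l) (x l))" using centralizer_explicit[OF u] .
  \<comment> \<open>On \<open>x l\<close> the operator \<open>ad h - (j - 2)\<close> acts by
    \<open>n l - j + 2\<close>, which is at least 2 because
    \<open>n l \<ge> 0 \<ge> j\<close>.\<close>
  define u' where "u' = (\<Sum>l\<in>{1..r}. scale (c l / of_int (n l - j + 2)) (x l))"
  define a' where "a' i = scale (1 / of_int (i - j)) (a i)" for i
  have u'0: "bracket e u' = 0"
    by (simp add: u'_def bracket_sum_right bracket_scale_right x_in_centralizer)
  have hu': "bracket h u' - scale (of_int (j - 2)) u' = u"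
    unfolding u'_def c bracket_sum_right scale_sum_right sum_subtractf[symmetric]
  proof (intro sum.cong refl)
    fix l assume l: "l \<in> {1..r}"
    then have "l \<in> {1..m}" using r_le_m by auto
    then have "n l - j + 2 \<noteq> 0" and hx: "bracket h (x l) = scale (of_int (n l)) (x l)"
      using n_nonneg[of l] insert.prems(1)[of j] weight_spaceD[OF x_weight] by auto
    then have nz: "of_int (n l - j + 2) \<noteq> (0::'k)" by (simp only: of_int_eq_0_iff) simp
    have d: "of_int (n l - j + 2) = (of_int (n l) - of_int (j - 2) :: 'k)" by simp
    have "bracket h (scale (c l / of_int (n l - j + 2)) (x l)) - scale (of_int (j - 2)) (scale (c l / of_int (n l - j + 2)) (x l))
      = scale (c l / of_int (n l - j + 2) * of_int (n l - j + 2)) (x l)"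
      unfolding bracket_scale_right hx scale_scale scale_left_diff_distrib[symmetric]
      by (rule arg_cong[of _ _ "\<lambda>k. scale k (x l)"]) (simp only: d left_diff_distrib right_diff_distrib mult.commute)
    then show "bracket h (scale (c l / of_int (n l - j + 2)) (x l)) - scale (of_int (j - 2)) (scale (c l / of_int (n l - j + 2)) (x l)) = scale (c l) (x l)"
      using nz by simp
  qed
  have ha': "bracket h (a' i) - scale (of_int (j - 2)) (a' i) = a i" if i: "i \<in> F" for i
  proof -
    have nz: "of_int (i - j) \<noteq> (0::'k)" using i insert.hyps by (simp only: of_int_eq_0_iff) auto
    have d: "of_int (i - j) = (of_int (i - 2) - of_int (j - 2) :: 'k)" by simp
    have ha: "bracket h (a i) = scale (of_int (i - 2)) (a i)" using weight_spaceD[OF a[OF i]] .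
    have "bracket h (a' i) - scale (of_int (j - 2)) (a' i) = scale (1 / of_int (i - j) * of_int (i - j)) (a i)"
      unfolding a'_def bracket_scale_right ha scale_scale scale_left_diff_distrib[symmetric]
      by (rule arg_cong[of _ _ "\<lambda>k. scale k (a i)"]) (simp only: d left_diff_distrib right_diff_distrib mult.commute)
    then show ?thesis using nz by simp
  qed
  define b where "b = v - (\<Sum>i\<in>F. a' i) - u'"
  have "bracket h b - scale (of_int (j - 2)) b
     = v1 - (\<Sum>i\<in>F. bracket h (a' i) - scale (of_int (j - 2)) (a' i)) - (bracket h u' - scale (of_int (j - 2)) u')"
    by (simp add: b_def v1_def bracket_diff_right bracket_sum_right bracket_add_right scale_right_diff_distrib scale_sum_right sum.distrib sum_subtractf algebra_simps)
  also have "\<dots> = 0"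
    unfolding hu' v1 using sum.cong[OF refl ha', of F] by (simp del: of_int_diff)
  finally have b: "b \<in> gw (j - 2)" by (simp add: weight_space_def)
  define a'' where "a'' i = (if i = j then b else a' i)" for i
  have "(\<Sum>i\<in>F. a'' i) = (\<Sum>i\<in>F. a' i)"
    using insert.hyps by (intro sum.cong) (auto simp: a''_def)
  then have "v = (\<Sum>i\<in>insert j F. a'' i) + u'"
    using insert.hyps by (simp add: a''_def b_def)
  moreover have "\<forall>i\<in>insert j F. a'' i \<in> gw (i - 2)"
    using b a subspace_scale[OF subspace_weight_space] by (auto simp: a''_def a'_def)
  ultimately show ?case using u'0 by blast
qed

text \<open>If \<open>[e, v]\<close> is a sum of weight vectors, then so is \<open>v\<close>:
  positive weights in \<open>[e, v]\<close> are lifted by surjectivity, the others by the preceding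
  lemma. Since a power of \<open>ad e\<close> sends \<open>v\<close> to 0, this reaches
  \<open>v\<close> after finitely many steps.\<close>

lemma weight_decomposition: "v \<in> span (\<Union>i. gw i)"
proof -
  have step: "v \<in> span (\<Union>i. gw i)" if ev: "bracket e v \<in> span (\<Union>i. gw i)" for v
  proof -
    obtain F w where F: "finite F" "\<And>i. w i \<in> gw i" "bracket e v = (\<Sum>i\<in>F. w i)"
      using weight_sum_explicit[OF ev] by metis
    have "\<forall>i. \<exists>w'. i > 0 \<longrightarrow> w' \<in> gw (i - 2) \<and> bracket e w' = w i"
      using ad_e_surjective[OF F(2)] by metis
    then obtain w' where w': "\<And>i. i > 0 \<Longrightarrow> w' i \<in> gw (i - 2) \<and> bracket e (w' i) = w i" by metis
    define F1 F2 where "F1 = {i\<in>F. i > 0}" and "F2 = {i\<in>F. i \<le> 0}"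
    have fin: "finite F1" "finite F2" using F by (auto simp: F1_def F2_def)
    have "F = F1 \<union> F2" "F1 \<inter> F2 = {}" by (auto simp: F1_def F2_def)
    then have "bracket e v = (\<Sum>i\<in>F1. w i) + (\<Sum>i\<in>F2. w i)"
      using F(3) fin by (simp add: sum.union_disjoint)
    moreover have "bracket e (\<Sum>i\<in>F1. w' i) = (\<Sum>i\<in>F1. w i)"
      unfolding bracket_sum_right by (intro sum.cong) (auto simp: w' F1_def)
    ultimately have "bracket e (v - (\<Sum>i\<in>F1. w' i)) = (\<Sum>i\<in>F2. w i)"
      by (simp add: bracket_diff_right)
    from ad_e_preimage_nonpos[OF fin(2) _ _ this] obtain a u where
      a: "\<forall>i\<in>F2. a i \<in> gw (i - 2)" and u: "bracket e u = 0" and v: "v - (\<Sum>i\<in>F1. w' i) = (\<Sum>i\<in>F2. a i) + u"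
      using F(2) by (auto simp: F2_def)
    have "v = (\<Sum>i\<in>F1. w' i) + ((\<Sum>i\<in>F2. a i) + u)" using v by (simp add: algebra_simps)
    moreover have "(\<Sum>i\<in>F1. w' i) \<in> span (\<Union>i. gw i)"
      using w' by (intro span_sum span_base) (auto simp: F1_def)
    moreover have "(\<Sum>i\<in>F2. a i) \<in> span (\<Union>i. gw i)"
      using a by (intro span_sum span_base) auto
    moreover have "u \<in> span (\<Union>i. gw i)"
      using centralizer_nonneg[OF u] span_mono[of "\<Union>i\<in>{0..}. gw i" "\<Union>i. gw i"] by auto
    ultimately show ?thesis by (metis span_add)
  qed
  obtain N where N: "\<And>v. (bracket e ^^ N) v = 0" using ad_e_nilpotent by blast
  have "(bracket e ^^ k) v \<in> span (\<Union>i. gw i) \<Longrightarrow> v \<in> span (\<Union>i. gw i)" for k v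
    by (induction k) (auto intro: step)
  with N span_zero show ?thesis by metis
qed

text \<open>A finite spanning set involves finitely many weights. This is what makes
  \<open>ad f\<close> nilpotent on weight vectors.\<close>

lemma finitely_many_weights: obtains F where "finite F" "\<And>i u. u \<in> gw i \<Longrightarrow> i \<notin> F \<Longrightarrow> u = 0"
proof -
  obtain S where S: "finite S" "span S = UNIV" using finite_dim by blast
  have "\<exists>F. finite F \<and> u \<in> span (\<Union>i\<in>F. gw i)" for u
  proof -
    obtain F c where "finite F" "\<And>i. c i \<in> gw i" "u = (\<Sum>i\<in>F. c i)"
      using weight_sum_explicit[OF weight_decomposition[of u]] by metis
    then show ?thesis by (intro exI[of _ F] conjI) (simp_all, blast intro: span_sum span_base)
  qed
  then obtain F where F: "\<And>u. finite (F u) \<and> u \<in> span (\<Union>i\<in>F u. gw i)" by metis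
  let ?F = "\<Union>u\<in>S. F u"
  have "S \<subseteq> span (\<Union>i\<in>?F. gw i)"
    using F span_mono[of "\<Union>i\<in>F u. gw i" "\<Union>i\<in>?F. gw i" for u] by blast
  then have all: "span (\<Union>i\<in>?F. gw i) = UNIV"
    using S span_minimal[OF _ subspace_span] by blast
  show ?thesis
  proof (rule that)
    show "finite ?F" using S F by blast
    fix i u assume "u \<in> gw i" "i \<notin> ?F"
    then show "u = 0" using weight_span_disjoint[of u h ?F "{i}"] all by (simp add: span_base)
  qed
qed

subsection \<open>Nondegeneracy of the pairing\<close>

lemma form_add_left: "form (u + u') v = form u v + form u' v"
  and form_scale_left: "form (scale c u) v = c * form u v"
  and form_add_right: "form u (v + v') = form u v + form u v'"
  and form_scale_right: "form u (scale c v) = c * form u v"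
  and form_bracket: "form (bracket u v) w = form u (bracket v w)"
proof -
  have 1: "module_hom scale (*) (\<lambda>u. form u v)" and 2: "module_hom scale (*) (\<lambda>v. form u v)" for u v
    using form_invariant Vector_Spaces.linear.axioms(3) unfolding invariant_bilinear_def by blast+
  show "form (u + u') v = form u v + form u' v" "form (scale c u) v = c * form u v"
    by (rule module_hom.add[OF 1] module_hom.scale[OF 1])+
  show "form u (v + v') = form u v + form u v'" "form u (scale c v) = c * form u v"
    by (rule module_hom.add[OF 2] module_hom.scale[OF 2])+
  show "form (bracket u v) w = form u (bracket v w)"
    using form_invariant unfolding invariant_bilinear_def by blast
qed

lemma form_zero_left [simp]: "form 0 v = 0" and form_zero_right [simp]: "form v 0 = 0"
  using form_scale_left[of 0 0 v] form_scale_right[of v 0 0] by simp_all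

lemma chi_add: "chi (u + v) = chi u + chi v" and chi_scale: "chi (scale c u) = c * chi u"
  and chi_0 [simp]: "chi 0 = 0"
  by (simp_all add: chi_def form_add_right form_scale_right)

lemma chi_minus: "chi (- u) = - chi u"
  using chi_scale[of "-1" u] by simp

lemma chi_diff: "chi (u - v) = chi u - chi v"
  using chi_add[of u "- v"] by (simp add: chi_minus)

lemma chi_sum: "chi (\<Sum>i\<in>A. c i) = (\<Sum>i\<in>A. chi (c i))"
  by (induction A rule: infinite_finite_induct) (simp_all add: chi_add)

lemma subspace_chi_kernel: "subspace {u. chi u = 0}"
  by (auto simp: subspace_def chi_add chi_scale)

lemma chi_bracket: "chi (bracket u v) = form (bracket e u) v"
  by (simp add: chi_def form_bracket)

text \<open>Invariance gives \<open>chi [h, u] = ([e, h], u) = -2 chi u\<close>, whereas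
  \<open>[h, u] = i u\<close>.\<close>

lemma chi_weight: "u \<in> gw i \<Longrightarrow> i \<noteq> -2 \<Longrightarrow> chi u = 0"
proof -
  assume u: "u \<in> gw i" and i: "i \<noteq> -2"
  have "bracket e h = scale (-2) e"
    using weight_spaceD[OF e_weight] bracket_anti[of e h] by simp
  then have "- 2 * chi u = chi (bracket h u)"
    using form_bracket[of e h u] form_scale_left[of "-2" e u] by (simp add: chi_def)
  also have "\<dots> = of_int i * chi u" using weight_spaceD[OF u] by (simp add: chi_scale)
  finally have "of_int i * chi u = - 2 * chi u" by simp
  then have "of_int (i + 2) * chi u = 0" by (simp add: distrib_right)
  moreover have "of_int (i + 2) \<noteq> (0::'k)" using i by (simp only: of_int_eq_0_iff)
  ultimately show ?thesis by simp
qed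

lemma form_radical_ideal:
  assumes "\<And>w. form v w = 0"
  shows "form (bracket a v) w = 0"
proof -
  have "form (bracket a v) w = - form (bracket v a) w"
    using bracket_anti[of a v] form_scale_left[of "-1" "bracket v a" w] by simp
  then show ?thesis by (simp add: form_bracket assms)
qed

lemma chi_x_centralizer: "i \<in> {1..r} \<Longrightarrow> chi (bracket (x i) v) = 0"
  by (simp add: chi_bracket x_in_centralizer)

text \<open>With \<open>w\<close> also \<open>[e, w]\<close> lies in the radical of the form, and
  pairing it with \<open>y j\<close> reads off the coefficient of \<open>x j\<close> in
  \<open>w\<close>. Only the \<open>x i\<close> with \<open>i \<le> r\<close> survive, and these
  commute with \<open>e\<close>.\<close>

lemma radical_weight_0:
  assumes "\<And>v. form w v = 0" "w \<in> gw 0"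
  shows "bracket e w = 0"
proof -
  have "w \<in> span (x ` {1..m})"
    unfolding x_span using assms(2) by (auto intro: span_base)
  then obtain c where c: "w = (\<Sum>i\<in>{1..m}. scale (c i) (x i))"
    using span_family[of "{1..m}" w x] by auto
  have "c j = 0" if j: "j \<in> {r+1..m}" for j
  proof -
    have "0 = form (bracket e w) (y j)" using form_radical_ideal[OF assms(1)] by simp
    also have "\<dots> = (\<Sum>i\<in>{1..m}. c i * chi (bracket (x i) (y j)))"
      unfolding chi_bracket[symmetric] by (simp add: c bracket_sum_left chi_sum bracket_scale_left chi_scale)
    also have "\<dots> = (\<Sum>i\<in>{1..m}. if i = j then c j else 0)"
    proof (intro sum.cong refl)
      fix i assume "i \<in> {1..m}"
      then consider "i \<in> {1..r}" | "i \<in> {r+1..m}" by fastforce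
      then show "c i * chi (bracket (x i) (y j)) = (if i = j then c j else 0)"
        using j x_y_dual[of i j] chi_x_centralizer[of i "y j"] by cases (auto simp: chi_def)
    qed
    also have "\<dots> = c j" using j by simp
    finally show ?thesis by simp
  qed
  then have "scale (c i) (bracket e (x i)) = 0" if "i \<in> {1..m}" for i
    using that x_in_centralizer[of i] by (cases "i \<le> r") auto
  then show ?thesis
    unfolding c bracket_sum_right bracket_scale_right by (intro sum.neutral ballI)
qed

lemma sum_split_2s: "(\<Sum>j\<in>{1..2*s}. g j) = (\<Sum>j\<in>{1..s}. g j) + (\<Sum>j\<in>{1..s}. g (j + s))"
  for g :: "nat \<Rightarrow> 'c::comm_monoid_add"
proof -
  have "{1..2*s} = {1..s} \<union> {1+s..s+s}" by auto
  then have "(\<Sum>j\<in>{1..2*s}. g j) = (\<Sum>j\<in>{1..s}. g j) + (\<Sum>j\<in>{1+s..s+s}. g j)"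
    by (simp add: sum.union_disjoint)
  then show ?thesis by (simp only: sum.shift_bounds_cl_nat_ivl)
qed

lemma z_inj: "inj_on z {1..2*s}" and z_span: "span (z ` {1..2*s}) = gw (-1)"
  using z_basis by (auto simp: family_basis_def)

lemma z_weight: "i \<in> {1..2*s} \<Longrightarrow> z i \<in> gw (-1)"
  unfolding z_span[symmetric] by (auto intro: span_base)

lemma chi_z:
  assumes "i \<in> {1..s}" "j \<in> {1..s}"
  shows "chi (bracket (z (i+s)) (z j)) = (if i = j then 1 else 0)"
    "chi (bracket (z j) (z (i+s))) = (if i = j then -1 else 0)"
    "chi (bracket (z i) (z j)) = 0" "chi (bracket (z (i+s)) (z (j+s))) = 0"
  using z_witt[OF assms] bracket_anti[of "z j" "z (i+s)"] chi_minus by (auto simp: chi_def)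

text \<open>In weight \<open>-2\<close> the vector \<open>v = [e, u]\<close> is killed by \<open>e\<close> and \<open>f\<close>, so that
  \<open>[e, f\<^sup>k\<^sup>+\<^sup>1 u] = -(k + 1)(k + 2) f\<^sup>k u\<close>, whereas \<open>f\<close> is nilpotent.\<close>

lemma pairing_nondegenerate_weight:
  assumes "u \<in> gw i" "i < 0" "\<And>v. chi (bracket u v) = 0"
  shows "u = 0"
  using assms
proof (induction "nat (- i)" arbitrary: i u rule: less_induct)
  case less
  have rad: "form (bracket e u) v = 0" for v using less.prems(3) by (simp add: chi_bracket)
  \<comment> \<open>Weight -1 is settled by the Witt basis and weights below -2 by induction along
    \<open>ad e\<close>. The exceptional weight is -2, where \<open>[e, u]\<close> reaches weight 0
    and injectivity of \<open>ad e\<close> is lost.\<close>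
  consider "i = -1" | "i = -2" | "i < -2" using less.prems(2) by linarith
  then show ?case
  proof cases
    case 1
    then have "u \<in> span (z ` {1..2*s})" using less.prems(1) z_span by simp
    then obtain c where "u = (\<Sum>j\<in>{1..2*s}. scale (c j) (z j))" using span_family by blast
    then have c: "u = (\<Sum>j\<in>{1..s}. scale (c j) (z j)) + (\<Sum>j\<in>{1..s}. scale (c (j+s)) (z (j+s)))"
      by (simp only: sum_split_2s)
    have c1: "c (k + s) = 0" if k: "k \<in> {1..s}" for k
    proof -
      have "0 = chi (bracket u (z k))" using less.prems(3) by simp
      also have "\<dots> = (\<Sum>j\<in>{1..s}. c j * chi (bracket (z j) (z k))) + (\<Sum>j\<in>{1..s}. c (j+s) * chi (bracket (z (j+s)) (z k)))"
        by (simp add: c bracket_add_left bracket_sum_left bracket_scale_left chi_add chi_sum chi_scale)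
      also have "(\<Sum>j\<in>{1..s}. c j * chi (bracket (z j) (z k))) = 0"
        using k by (intro sum.neutral) (auto simp: chi_z)
      also have "(\<Sum>j\<in>{1..s}. c (j+s) * chi (bracket (z (j+s)) (z k))) = (\<Sum>j\<in>{1..s}. if j = k then c (k+s) else 0)"
        using k by (intro sum.cong) (auto simp: chi_z)
      finally show ?thesis using k by simp
    qed
    have c2: "c k = 0" if k: "k \<in> {1..s}" for k
    proof -
      have "0 = chi (bracket u (z (k + s)))" using less.prems(3) by simp
      also have "\<dots> = (\<Sum>j\<in>{1..s}. c j * chi (bracket (z j) (z (k+s)))) + (\<Sum>j\<in>{1..s}. c (j+s) * chi (bracket (z (j+s)) (z (k+s))))"
        by (simp add: c bracket_add_left bracket_sum_left bracket_scale_left chi_add chi_sum chi_scale)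
      also have "(\<Sum>j\<in>{1..s}. c (j+s) * chi (bracket (z (j+s)) (z (k+s)))) = 0"
        using k by (intro sum.neutral) (auto simp: chi_z)
      also have "(\<Sum>j\<in>{1..s}. c j * chi (bracket (z j) (z (k+s)))) = (\<Sum>j\<in>{1..s}. if j = k then - c k else 0)"
        using k by (intro sum.cong) (auto simp: chi_z)
      finally show ?thesis using k by simp
    qed
    show ?thesis by (simp add: c c1 c2)
  next
    case 2
    define v where "v = bracket e u"
    have v0: "v \<in> gw 0" using ad_e_weight[OF less.prems(1)] 2 by (simp add: v_def)
    have ev: "bracket e v = 0" using radical_weight_0[OF _ v0] rad by (simp add: v_def)
    have "bracket e (bracket f v) = 0"
      using ev weight_spaceD[OF v0] by (simp add: ad_e_f)
    then have fv: "bracket f v = 0" using ad_e_inj[OF ad_f_weight[OF v0]] by simp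
    have fw: "(bracket f ^^ k) u \<in> gw (-2 - 2 * int k)" for k
    proof (induction k)
      case 0 show ?case using less.prems(1) 2 by simp
    next
      case (Suc k)
      then show ?case using ad_f_weight[OF Suc] by (simp add: algebra_simps)
    qed
    have ef: "bracket e ((bracket f ^^ Suc k) u) = scale (of_int (- ((int k + 1) * (int k + 2)))) ((bracket f ^^ k) u)" for k
    proof (induction k)
      case 0
      then show ?case using fv weight_spaceD[OF fw[of 0]] by (simp add: ad_e_f v_def[symmetric])
    next
      case (Suc k)
      have "bracket e ((bracket f ^^ Suc (Suc k)) u) =
          bracket f (bracket e ((bracket f ^^ Suc k) u)) + bracket h ((bracket f ^^ Suc k) u)"
        by (simp add: ad_e_f)
      also have "\<dots> = scale (of_int (- ((int k + 1) * (int k + 2)))) ((bracket f ^^ Suc k) u)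
          + scale (of_int (-2 - 2 * int (Suc k))) ((bracket f ^^ Suc k) u)"
        unfolding Suc weight_spaceD[OF fw] by (simp add: bracket_scale_right bracket_minus_right)
      also have "\<dots> = scale (of_int (- ((int k + 1) * (int k + 2))) + of_int (-2 - 2 * int (Suc k))) ((bracket f ^^ Suc k) u)"
        by (simp only: scale_left_distrib)
      also have "of_int (- ((int k + 1) * (int k + 2))) + of_int (-2 - 2 * int (Suc k)) = (of_int (- ((int (Suc k) + 1) * (int (Suc k) + 2))) :: 'k)"
        by (simp add: algebra_simps)
      finally show ?case .
    qed
    obtain F where F: "finite F" "\<And>i u. u \<in> gw i \<Longrightarrow> i \<notin> F \<Longrightarrow> u = 0"
      using finitely_many_weights by metis
    \<comment> \<open>The vectors \<open>(ad f)^k u\<close> have distinct weights, of which only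
      finitely many occur, so one of them is 0. The nonzero scalars in \<open>ef\<close> carry this
      back to \<open>u\<close>.\<close>
    have "\<exists>k. -2 - 2 * int k \<notin> F"
    proof (rule ccontr)
      assume "\<not> ?thesis"
      then have "range (\<lambda>k. -2 - 2 * int k) \<subseteq> F" by auto
      then have "finite (range (\<lambda>k. -2 - 2 * int k))" using F(1) finite_subset by blast
      moreover have "inj (\<lambda>k. -2 - 2 * int k)" by (auto intro: injI)
      ultimately show False using finite_imageD infinite_UNIV_nat by blast
    qed
    then obtain k where "(bracket f ^^ k) u = 0" using F(2) fw by blast
    then show ?thesis
    proof (induction k)
      case (Suc k)
      have "of_int (- ((int k + 1) * (int k + 2))) \<noteq> (0::'k)" by (simp only: of_int_eq_0_iff) simp
      then have "(bracket f ^^ k) u = 0" using ef[of k] Suc.prems by (simp del: of_int_minus of_int_mult)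
      then show ?case by (rule Suc.IH)
    qed simp
  next
    case 3
    \<comment> \<open>The radical of the form is an ideal, so the pairing degenerates on
      \<open>[e, u]\<close> too, and its weight \<open>i + 2\<close> is still negative.\<close>
    have "bracket e u = 0"
    proof (rule less.hyps)
      show "bracket e u \<in> gw (i + 2)" using ad_e_weight less.prems(1) by blast
      show "chi (bracket (bracket e u) v) = 0" for v
        using form_radical_ideal[OF rad] by (simp add: chi_bracket)
    qed (use 3 in auto)
    then show ?thesis using ad_e_inj less.prems by blast
  qed
qed

subsection \<open>The complement of \<open>\<mm>\<close>\<close>

lemma lag_weight: "lag \<subseteq> gw (-1)"
  using lagrangian(2) by auto

lemma lag_mm: "lag \<subseteq> mm" and weight_mm: "i \<le> -2 \<Longrightarrow> gw i \<subseteq> mm"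
  unfolding mm_def by (auto intro: span_base)

lemma subspace_mm: "subspace mm"
  unfolding mm_def by (rule subspace_span)

lemma mm_weights: "mm \<subseteq> span (\<Union>i\<in>{..-1}. gw i)"
  unfolding mm_def using lag_weight by (intro span_mono) fastforce

text \<open>Two elements of \<open>lag\<close> pair to 0 because \<open>lag\<close> is isotropic. In
  all other cases the weights add up to less than -2, where \<open>chi\<close> vanishes.\<close>

lemma chi_mm_mm: "u \<in> mm \<Longrightarrow> v \<in> mm \<Longrightarrow> chi (bracket u v) = 0"
proof -
  let ?S = "lag \<union> (\<Union>i\<in>{..-2}. gw i)"
  assume "u \<in> mm" "v \<in> mm"
  then have "bracket u v \<in> {u. chi u = 0}" unfolding mm_def
  proof (rule bracket_span_subspace[OF _ _ subspace_chi_kernel])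
    fix a b assume ab: "a \<in> ?S" "b \<in> ?S"
    show "bracket a b \<in> {u. chi u = 0}"
    proof (cases "a \<in> lag \<and> b \<in> lag")
      case True
      then show ?thesis using lagrangian(2) by (auto simp: chi_def)
    next
      case False
      then obtain i j where "a \<in> gw i" "b \<in> gw j" "i + j < -2"
        using ab lag_weight by fastforce
      then show ?thesis using chi_weight[OF weight_space_bracket, of a i b j] by simp
    qed
  qed
  then show ?thesis by simp
qed

lemma bracket_mm: "u \<in> mm \<Longrightarrow> v \<in> mm \<Longrightarrow> bracket u v \<in> mm"
proof -
  let ?S = "lag \<union> (\<Union>i\<in>{..-2}. gw i)"
  assume "u \<in> mm" "v \<in> mm"
  then show "bracket u v \<in> mm" unfolding mm_def
  proof (rule bracket_span_subspace[OF _ _ subspace_span])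
    fix a b assume ab: "a \<in> ?S" "b \<in> ?S"
    then obtain i j where "a \<in> gw i" "b \<in> gw j" "i \<le> -1" "j \<le> -1"
      using lag_weight by fastforce
    then have "bracket a b \<in> gw (i + j)" "i + j \<le> -2" using weight_space_bracket by auto
    then show "bracket a b \<in> span ?S" by (auto intro: span_base)
  qed
qed

lemma z_lag_mem: "i \<in> {1..s} \<Longrightarrow> z i \<in> lag"
  unfolding z_lag[symmetric] by (auto intro: span_base)

lemma y_mm: "i \<in> {r+1..m} \<Longrightarrow> y i \<in> mm"
  using y_weight[of i] n_nonneg[of i] weight_mm[of "- n i - 2"] by auto

lemma finite_qbasis: "finite qbasis"
  by (simp add: qbasis_def)

lemma finite_B: "finite B"
  using finite_dim independent_span_bound[OF _ B_basis(1)] by auto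

lemma qbasis_subset_B: "qbasis \<subseteq> B"
  using B_extends by (simp add: qbasis_def)

lemma qbasis_indep: "independent qbasis"
  using B_basis(1) qbasis_subset_B independent_mono by blast

lemma q_plus_mm: "\<exists>a\<in>span qbasis. v - a \<in> mm"
proof -
  have "gw i \<subseteq> span (qbasis \<union> mm)" for i
  proof -
    consider "i \<ge> 0" | "i = -1" | "i \<le> -2" by linarith
    then show ?thesis
    proof cases
      case 1
      then have "gw i \<subseteq> span (x ` {1..m})" unfolding x_span by (auto intro: span_base)
      also have "\<dots> \<subseteq> span (qbasis \<union> mm)" by (intro span_mono) (auto simp: qbasis_def)
      finally show ?thesis .
    next
      case 2
      have "z ` {1..2*s} \<subseteq> qbasis \<union> mm"
      proof (clarsimp simp del: One_nat_def)
        fix j assume j: "1 \<le> j" "j \<le> 2 * s" "z j \<notin> mm"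
        then have "\<not> j \<le> s" using z_lag_mem[of j] lag_mm by auto
        then show "z j \<in> qbasis" using j by (auto simp: qbasis_def)
      qed
      then show ?thesis using 2 z_span span_mono by blast
    next
      case 3
      then show ?thesis using weight_mm[of i] span_superset by blast
    qed
  qed
  then have "span (\<Union>i. gw i) \<subseteq> span (qbasis \<union> mm)"
    by (intro span_minimal) auto
  then have "v \<in> span (qbasis \<union> mm)" using weight_decomposition by blast
  then show ?thesis
    unfolding span_Un span_eq_iff[THEN iffD2, OF subspace_mm]
    by (auto intro: rev_bexI)
qed

text \<open>Weights separate off the part in the \<open>x i\<close>. What remains is a combination
  of the \<open>z (j + s)\<close>; its coefficients are its pairings with the \<open>z j\<close> in
  \<open>lag\<close>, and these vanish within \<open>mm\<close>.\<close>

lemma q_int_mm: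
  assumes "u \<in> span qbasis" "u \<in> mm"
  shows "u = 0"
proof -
  obtain a c where a: "a \<in> span (x ` {1..m})" and c: "c \<in> span (z ` {s+1..2*s})" and u: "u = a + c"
    using assms(1) unfolding qbasis_def span_Un by auto
  have "span (z ` {s+1..2*s}) \<subseteq> span (z ` {1..2*s})" by (intro span_mono) auto
  then have c1: "c \<in> gw (-1)" using c z_span by auto
  have "a = u - c" by (simp add: u)
  moreover have "c \<in> span (\<Union>i\<in>{..-1}. gw i)" using c1 by (auto intro: span_base)
  ultimately have "a \<in> span (\<Union>i\<in>{..-1}. gw i)" using mm_weights assms(2) by (auto intro: span_diff)
  moreover have "{..-1} \<inter> {0::int..} = {}" by auto
  ultimately have "a = 0" using weight_span_disjoint[of a h "{..-1}" "{0..}"] a x_span by simp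
  then have uc: "u = c" using u by simp
  obtain k where k: "c = (\<Sum>j\<in>{s+1..2*s}. scale (k j) (z j))"
    using span_family[OF _ c] by auto
  have "{s+1..2*s} = {1+s..s+s}" by auto
  then have k: "c = (\<Sum>j\<in>{1..s}. scale (k (j+s)) (z (j+s)))"
    unfolding k by (simp only: sum.shift_bounds_cl_nat_ivl)
  have "k (j + s) = 0" if j: "j \<in> {1..s}" for j
  proof -
    have "0 = chi (bracket c (z j))" using chi_mm_mm assms(2) uc z_lag_mem[OF j] lag_mm by auto
    also have "\<dots> = (\<Sum>i\<in>{1..s}. k (i+s) * chi (bracket (z (i+s)) (z j)))"
      by (simp add: k bracket_sum_left bracket_scale_left chi_sum chi_scale)
    also have "\<dots> = (\<Sum>i\<in>{1..s}. if i = j then k (j+s) else 0)"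
      using j by (intro sum.cong) (auto simp: chi_z)
    finally show ?thesis using j by simp
  qed
  then show ?thesis by (simp add: uc k)
qed

section \<open>Projection to the complement along \<open>mm\<close>\<close>

definition qproj :: "'g \<Rightarrow> 'g" where
  "qproj v = (THE a. a \<in> span qbasis \<and> v - a \<in> mm)"

lemma qproj_eqI: "a \<in> span qbasis \<Longrightarrow> v - a \<in> mm \<Longrightarrow> qproj v = a"
  unfolding qproj_def
proof (rule the_equality)
  fix b assume a: "a \<in> span qbasis" "v - a \<in> mm" and b: "b \<in> span qbasis \<and> v - b \<in> mm"
  have "b - a \<in> mm" using subspace_diff[OF subspace_mm a(2), of "v - b"] b by simp
  then have "b - a = 0" using a b by (intro q_int_mm span_diff) auto
  then show "b = a" by simp
qed simp

lemma qproj_span: "qproj v \<in> span qbasis" and qproj_mm: "v - qproj v \<in> mm"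
  using q_plus_mm[of v] qproj_eqI by auto

lemma qproj_add: "qproj (u + v) = qproj u + qproj v"
  using subspace_add[OF subspace_mm qproj_mm[of u] qproj_mm[of v]]
  by (intro qproj_eqI span_add qproj_span) (simp add: algebra_simps)

lemma qproj_scale: "qproj (scale c v) = scale c (qproj v)"
  using subspace_scale[OF subspace_mm qproj_mm[of v], of c]
  by (intro qproj_eqI span_scale qproj_span) (simp add: scale_right_diff_distrib)

lemma qproj_q: "v \<in> span qbasis \<Longrightarrow> qproj v = v"
  using subspace_0[OF subspace_mm] by (intro qproj_eqI) auto

lemma qproj_of_mm: "v \<in> mm \<Longrightarrow> qproj v = 0"
  by (intro qproj_eqI span_zero) simp

text \<open>Both summands are graded, and -1 is the only weight that is split between them.\<close>

lemma qproj_weight: "v \<in> gw i \<Longrightarrow> qproj v \<in> gw i"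
proof -
  assume v: "v \<in> gw i"
  consider "i \<ge> 0" | "i = -1" | "i \<le> -2" by linarith
  then show ?thesis
  proof cases
    case 1
    then have "v \<in> span (x ` {1..m})" unfolding x_span using v by (auto intro: span_base)
    also have "\<dots> \<subseteq> span qbasis" by (intro span_mono) (auto simp: qbasis_def)
    finally show ?thesis using v by (simp add: qproj_q)
  next
    case 2
    have "{1..2*s} = {1..s} \<union> {s+1..2*s}" by auto
    then have "v \<in> span (z ` {1..s} \<union> z ` {s+1..2*s})" using v 2 z_span by (metis image_Un)
    then obtain a b where a: "a \<in> lag" and b: "b \<in> span (z ` {s+1..2*s})" and v: "v = a + b"
      unfolding span_Un z_lag by auto
    have "span (z ` {s+1..2*s}) \<subseteq> span qbasis" by (intro span_mono) (auto simp: qbasis_def)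
    then have "qproj v = b" using a b lag_mm by (intro qproj_eqI) (auto simp: v)
    moreover have "b \<in> gw (-1)"
      using b z_span span_mono[OF image_mono, of "{s+1..2*s}" "{1..2*s}" z] by auto
    ultimately show ?thesis using 2 by simp
  next
    case 3
    then have "v \<in> mm" using v weight_mm by blast
    then show ?thesis using subspace_0[OF subspace_weight_space] by (simp add: qproj_of_mm)
  qed
qed

text \<open>The default -1 is the correct weight of the \<open>z j\<close>, the only elements of
  \<open>qbasis\<close> that are not among the \<open>x i\<close>.\<close>

definition wt :: "'g \<Rightarrow> int" where
  "wt b = (if b \<in> x ` {1..m} then n (inv_into {1..m} x b) else - 1)"

lemma x_z_disjoint: "i \<in> {1..m} \<Longrightarrow> j \<in> {1..2*s} \<Longrightarrow> x i \<noteq> z j"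
  using weight_spaces_disjoint[OF x_weight[of i], of "-1"] z_weight[of j] n_nonneg[of i] x_nonzero[of i]
  by fastforce

lemma wt_x: "i \<in> {1..m} \<Longrightarrow> wt (x i) = n i"
  unfolding wt_def using x_inj by (simp add: inv_into_f_f)

lemma wt_z: "j \<in> {1..2*s} \<Longrightarrow> wt (z j) = -1"
  unfolding wt_def using x_z_disjoint by force

lemma qbasis_cases:
  assumes "b \<in> qbasis"
  obtains (centralizer) i where "i \<in> {1..r}" "b = x i"
    | (x) i where "i \<in> {r+1..m}" "b = x i"
    | (z) j where "j \<in> {1..s}" "b = z (j + s)"
proof -
  consider i where "i \<in> {1..m}" "b = x i" | j where "j \<in> {s+1..2*s}" "b = z j"
    using assms by (auto simp: qbasis_def)
  then show ?thesis
  proof cases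
    case (1 i)
    then show ?thesis using that(1)[of i] that(2)[of i] by (cases "i \<le> r") auto
  next
    case (2 j)
    then have "j - s \<in> {1..s}" "b = z (j - s + s)" by auto
    then show ?thesis by (rule that(3))
  qed
qed

lemma qbasis_weight: "b \<in> qbasis \<Longrightarrow> b \<in> gw (wt b)"
  by (auto simp: qbasis_def wt_x wt_z x_weight z_weight)

lemma wt_ge: "b \<in> qbasis \<Longrightarrow> wt b \<ge> -1"
  using n_nonneg by (force simp: qbasis_def wt_x wt_z)

lemma chi_qbasis: "b \<in> qbasis \<Longrightarrow> chi b = 0"
  using chi_weight[OF qbasis_weight] wt_ge by fastforce

lemma chi_q: "v \<in> span qbasis \<Longrightarrow> chi v = 0"
  using span_minimal[OF _ subspace_chi_kernel, of qbasis] chi_qbasis by auto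

section \<open>Vertical directions and the dual basis of \<open>mm\<close>\<close>

definition vert :: "'g set" where
  "vert = x ` {r+1..m} \<union> z ` {s+1..2*s}"

text \<open>The signs come from the order of the bracket: \<open>chi [x i, y i] = 1\<close> becomes
  \<open>chi [- y i, x i] = 1\<close>, and likewise for \<open>z (j + s)\<close> and
  \<open>z j\<close>.\<close>

definition dual :: "'g \<Rightarrow> 'g" where
  "dual b = (if b \<in> x ` {1..m} then - y (inv_into {1..m} x b) else - z (inv_into {1..2*s} z b - s))"

lemma dual_x: "i \<in> {r+1..m} \<Longrightarrow> dual (x i) = - y i"
  unfolding dual_def using x_inj by (simp add: inv_into_f_f)

lemma dual_z: "j \<in> {1..s} \<Longrightarrow> dual (z (j + s)) = - z j"
proof -
  assume j: "j \<in> {1..s}"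
  then have "z (j + s) \<notin> x ` {1..m}" using x_z_disjoint[of _ "j + s"] by force
  then show ?thesis unfolding dual_def using inv_into_f_f[OF z_inj, of "j + s"] j by simp
qed

lemma vert_cases:
  assumes "b \<in> vert"
  obtains (x) i where "i \<in> {r+1..m}" "b = x i"
    | (z) j where "j \<in> {1..s}" "b = z (j + s)"
proof -
  consider i where "i \<in> {r+1..m}" "b = x i" | j where "j \<in> {s+1..2*s}" "b = z j"
    using assms by (auto simp: vert_def)
  then show ?thesis
  proof cases
    case (1 i)
    then show ?thesis by (rule that(1))
  next
    case (2 j)
    then have "j - s \<in> {1..s}" "b = z (j - s + s)" by auto
    then show ?thesis by (rule that(2))
  qed
qed

lemma vert_qbasis: "vert \<subseteq> qbasis"
  by (auto simp: vert_def qbasis_def)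

lemma finite_vert: "finite vert"
  by (simp add: vert_def)

lemma vert_eq: "vert = qbasis - x ` {1..r}"
proof
  show "vert \<subseteq> qbasis - x ` {1..r}"
  proof
    fix b assume b: "b \<in> vert"
    then have "b \<notin> x ` {1..r}"
    proof (cases rule: vert_cases)
      case (x i)
      have "i = k" if "k \<in> {1..r}" "x i = x k" for k
        using inj_onD[OF x_inj that(2)] that(1) x(1) r_le_m by auto
      then show ?thesis using x by fastforce
    next
      case (z j)
      then have "x k \<noteq> b" if "k \<in> {1..r}" for k
        using x_z_disjoint[of k "j + s"] r_le_m that by auto
      then show ?thesis by blast
    qed
    then show "b \<in> qbasis - x ` {1..r}" using b vert_qbasis by auto
  qed
  show "qbasis - x ` {1..r} \<subseteq> vert"
  proof
    fix b assume b: "b \<in> qbasis - x ` {1..r}"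
    then have "b \<in> qbasis" by simp
    then show "b \<in> vert"
    proof (cases rule: qbasis_cases)
      case (z j)
      then have "j + s \<in> {s+1..2*s}" by simp
      then show ?thesis using z(2) unfolding vert_def by blast
    qed (use b in \<open>auto simp: vert_def\<close>)
  qed
qed

lemma dual_mm: "b \<in> vert \<Longrightarrow> dual b \<in> mm"
  by (elim vert_cases) (use z_lag_mem lag_mm in \<open>auto simp: dual_x dual_z intro!: subspace_neg[OF subspace_mm] y_mm\<close>)

lemma dual_weight: "b \<in> vert \<Longrightarrow> dual b \<in> gw (- wt b - 2)"
proof (elim vert_cases)
  fix i assume "i \<in> {r+1..m}" "b = x i"
  then show ?thesis
    using y_weight[of i] by (simp add: dual_x wt_x subspace_neg[OF subspace_weight_space])
next
  fix j assume "j \<in> {1..s}" "b = z (j + s)"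
  then show ?thesis
    using z_weight[of j] by (simp add: dual_z wt_z subspace_neg[OF subspace_weight_space])
qed

text \<open>As \<open>chi\<close> lives in weight -2, different weights pair to 0; this removes the
  mixed pairs of an \<open>x\<close> and a \<open>z\<close>. Equal weights are covered by the
  relations of the two bases and by the vanishing of \<open>chi [x k, v]\<close> on the
  centralizer.\<close>

lemma chi_dual:
  assumes b: "b \<in> vert" and c: "c \<in> qbasis"
  shows "chi (bracket (dual b) c) = (if b = c then 1 else 0)"
proof (cases "wt b = wt c")
  case False
  then have "chi (bracket (dual b) c) = 0"
    using chi_weight[OF weight_space_bracket[OF dual_weight[OF b] qbasis_weight[OF c]]] by simp
  with False show ?thesis by auto
next
  case wt: True
  have flip: "chi (bracket (- v) c) = chi (bracket c v)" for v
    using bracket_anti[of c v] by (metis bracket_minus_left)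
  from b show ?thesis
  proof (cases rule: vert_cases)
    case bx: (x i)
    have *: "chi (bracket (dual b) c) = chi (bracket c (y i))"
      unfolding bx(2) dual_x[OF bx(1)] by (rule flip)
    from c show ?thesis
    proof (cases rule: qbasis_cases)
      case (centralizer k)
      then have "c \<notin> vert" using vert_eq by auto
      then have "b \<noteq> c" using b by auto
      moreover have "chi (bracket c (y i)) = 0"
        unfolding centralizer(2) by (rule chi_x_centralizer[OF centralizer(1)])
      ultimately show ?thesis using * by simp
    next
      case (x k)
      have "x i = x k \<longleftrightarrow> k = i" using inj_onD[OF x_inj, of i k] bx(1) x(1) by auto
      then have "b = c \<longleftrightarrow> k = i" using bx(2) x(2) by simp
      moreover have "chi (bracket c (y i)) = (if k = i then 1 else 0)"
        unfolding x(2) chi_def by (rule x_y_dual[OF x(1) bx(1)])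
      ultimately show ?thesis using * by simp
    next
      case (z j)
      then show ?thesis using wt bx n_nonneg[of i] wt_x[of i] wt_z[of "j + s"] by simp
    qed
  next
    case bz: (z j)
    have *: "chi (bracket (dual b) c) = chi (bracket c (z j))"
      unfolding bz(2) dual_z[OF bz(1)] by (rule flip)
    have wb: "wt b = -1" using bz wt_z[of "j + s"] by simp
    from c show ?thesis
    proof (cases rule: qbasis_cases)
      case (centralizer k)
      then show ?thesis using wt wb n_nonneg[of k] wt_x[of k] r_le_m by simp
    next
      case (x k)
      then show ?thesis using wt wb n_nonneg[of k] wt_x[of k] by simp
    next
      case (z k)
      have "z (j + s) = z (k + s) \<longleftrightarrow> k = j"
        using inj_onD[OF z_inj, of "j + s" "k + s"] bz(1) z(1) by auto
      then have "b = c \<longleftrightarrow> k = j" using bz(2) z(2) by simp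
      moreover have "chi (bracket c (z j)) = (if k = j then 1 else 0)"
        unfolding z(2) by (rule chi_z(1)[OF z(1) bz(1)])
      ultimately show ?thesis using * by simp
    qed
  qed
qed

text \<open>Testing on \<open>qbasis\<close> suffices because \<open>chi\<close> vanishes on
  \<open>[mm, mm]\<close>. A component of weight \<open>i\<close> pairs nontrivially only with
  weight \<open>-2 - i\<close>, so each weight component of \<open>u\<close> is degenerate by
  itself.\<close>

lemma pairing_nondegenerate:
  assumes u: "u \<in> mm" and 0: "\<And>b. b \<in> qbasis \<Longrightarrow> chi (bracket u b) = 0"
  shows "u = 0"
proof -
  have "chi (bracket u v) = 0" if "v \<in> span qbasis" for v
    using that by (rule span_induct) (auto simp: subspace_def bracket_add_right bracket_scale_right chi_add chi_scale 0)
  then have all: "chi (bracket u v) = 0" for v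
    using chi_mm_mm[OF u qproj_mm[of v]] qproj_span[of v] by (simp add: bracket_diff_right chi_diff)
  obtain F c where F: "finite F" "F \<subseteq> {..-1}" "\<And>i. c i \<in> gw i" "u = (\<Sum>i\<in>F. c i)"
    using weight_sum_explicit[of u h "{..-1}"] mm_weights u by (metis subsetD)
  have "c i = 0" if i: "i \<in> F" for i
  proof (rule pairing_nondegenerate_weight)
    show "c i \<in> gw i" by (rule F)
    show "i < 0" using i F(2) by auto
    fix v
    have gen: "chi (bracket (c i) w) = 0" if w: "w \<in> gw j" for w j
    proof (cases "i + j = -2")
      case True
      have "0 = chi (bracket u w)" using all by simp
      also have "\<dots> = (\<Sum>k\<in>F. chi (bracket (c k) w))" by (simp add: F(4) bracket_sum_left chi_sum)
      also have "\<dots> = (\<Sum>k\<in>F. if k = i then chi (bracket (c i) w) else 0)"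
        using True chi_weight[OF weight_space_bracket[OF F(3) w]] by (intro sum.cong) auto
      finally show ?thesis using i F(1) by simp
    next
      case False
      then show ?thesis using chi_weight[OF weight_space_bracket[OF F(3) w]] by blast
    qed
    have "v \<in> span (\<Union>i. gw i)" by (rule weight_decomposition)
    then show "chi (bracket (c i) v) = 0"
      by (rule span_induct) (auto simp: subspace_def bracket_add_right bracket_scale_right chi_add chi_scale intro: gen)
  qed
  then show ?thesis by (simp add: F(4))
qed

text \<open>The difference of the two sides lies in \<open>mm\<close> and pairs to 0 with
  \<open>qbasis\<close>. Thus the vectors \<open>dual b\<close> span \<open>mm\<close>.\<close>

lemma mm_explicit:
  assumes u: "u \<in> mm"
  shows "u = (\<Sum>b\<in>vert. scale (chi (bracket u b)) (dual b))"
proof -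
  define u' where "u' = u - (\<Sum>b\<in>vert. scale (chi (bracket u b)) (dual b))"
  have "u' = 0"
  proof (rule pairing_nondegenerate)
    show "u' \<in> mm" unfolding u'_def
      using u by (intro subspace_diff[OF subspace_mm] subspace_sum[OF subspace_mm] subspace_scale[OF subspace_mm] dual_mm)
    fix c assume c: "c \<in> qbasis"
    have "chi (bracket u' c) = chi (bracket u c) - (\<Sum>b\<in>vert. chi (bracket u b) * chi (bracket (dual b) c))"
      by (simp add: u'_def bracket_diff_left bracket_sum_left bracket_scale_left chi_diff chi_sum chi_scale)
    also have "(\<Sum>b\<in>vert. chi (bracket u b) * chi (bracket (dual b) c)) = (\<Sum>b\<in>vert. if b = c then chi (bracket u c) else 0)"
      using c by (intro sum.cong) (auto simp: chi_dual)
    also have "\<dots> = (if c \<in> vert then chi (bracket u c) else 0)" using finite_vert by simp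
    also have "chi (bracket u c) = 0" if "c \<notin> vert"
    proof -
      obtain i where "i \<in> {1..r}" "c = x i" using \<open>c \<notin> vert\<close> c vert_eq by auto
      then show ?thesis using chi_x_centralizer[of i u] bracket_anti[of u c] by (simp add: chi_minus)
    qed
    then have "chi (bracket u c) - (if c \<in> vert then chi (bracket u c) else 0) = 0" by auto
    finally show "chi (bracket u' c) = 0" .
  qed
  then show ?thesis by (simp add: u'_def)
qed

subsection \<open>Linear forms\<close>

lemma span_B [simp]: "v \<in> span B"
  using B_basis(2) by simp

lemma sym_emb_add: "sym_emb B (u + v) = sym_emb B u + sym_emb B v"
  unfolding sym_emb_def by (simp add: representation_add[OF B_basis(1)] mconst_add algebra_simps sum.distrib)

lemma sym_emb_scale: "sym_emb B (scale c u) = mconst c * sym_emb B u"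
  unfolding sym_emb_def by (simp add: representation_scale[OF B_basis(1)] mconst_mult sum_distrib_left algebra_simps)

lemma sym_emb_0 [simp]: "sym_emb B 0 = 0"
  using sym_emb_scale[of 0 0] by simp

lemma sym_emb_diff: "sym_emb B (u - v) = sym_emb B u - sym_emb B v"
  using sym_emb_add[of "u - v" v] by simp

lemma sym_emb_basis: "b \<in> B \<Longrightarrow> sym_emb B b = mvar b"
proof -
  assume b: "b \<in> B"
  have "sym_emb B b = (\<Sum>c\<in>B. if c = b then mvar b else 0)"
    unfolding sym_emb_def using representation_basis[OF B_basis(1) b] by (intro sum.cong) auto
  also have "\<dots> = mvar b" using b finite_B by simp
  finally show ?thesis .
qed

lemma representation_outside:
  assumes "v \<in> span C" "C \<subseteq> B" "b \<notin> C"
  shows "representation B v b = 0"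
  using representation_extend[OF B_basis(1) assms(1,2)] representation_ne_zero assms(3) by metis

lemma sym_emb_restrict:
  assumes "v \<in> span C" "C \<subseteq> B"
  shows "sym_emb B v = (\<Sum>b\<in>C. mconst (representation B v b) * mvar b)"
  unfolding sym_emb_def using assms finite_B representation_outside[OF assms]
  by (intro sum.mono_neutral_right) auto

lemma sum_representation_restrict:
  assumes "v \<in> span C" "C \<subseteq> B"
  shows "v = (\<Sum>b\<in>C. scale (representation B v b) b)"
proof -
  have "v = (\<Sum>b\<in>B. scale (representation B v b) b)"
    using sum_representation_eq[OF B_basis(1) _ finite_B, of v] by simp
  also have "\<dots> = (\<Sum>b\<in>C. scale (representation B v b) b)"
    using assms finite_B representation_outside[OF assms] by (intro sum.mono_neutral_right) auto
  finally show ?thesis .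
qed

lemma sym_emb_polys:
  assumes "v \<in> span C" "C \<subseteq> B"
  shows "sym_emb B v \<in> polys C"
  unfolding sym_emb_restrict[OF assms] by (intro polys_sum polys_mult) auto

definition kdeg :: "'g \<Rightarrow> int" where
  "kdeg b = wt b + 2"

lemma sym_emb_homog:
  assumes v: "v \<in> span qbasis" "v \<in> gw i"
  shows "homog kdeg (i + 2) (sym_emb B v)"
  unfolding sym_emb_restrict[OF v(1) qbasis_subset_B]
proof (intro homog_sum)
  let ?c = "representation B v"
  fix b assume b: "b \<in> qbasis"
  \<comment> \<open>Applying \<open>ad h - i\<close> to the expansion of \<open>v\<close> shows that
    only basis vectors of weight \<open>i\<close> occur in it.\<close>
  have "(\<Sum>b\<in>qbasis. scale (?c b * (of_int (wt b) - of_int i)) b) = bracket h v - scale (of_int i) v"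
    apply (subst (2 3) sum_representation_restrict[OF v(1) qbasis_subset_B])
    unfolding bracket_sum_right scale_sum_right sum_subtractf[symmetric]
    by (intro sum.cong refl) (simp add: bracket_scale_right weight_spaceD[OF qbasis_weight]
        scale_left_diff_distrib algebra_simps)
  also have "\<dots> = 0" using v(2) by (simp add: weight_space_def)
  finally have "?c b * (of_int (wt b) - of_int i) = 0"
    using independentD[OF qbasis_indep finite_qbasis order_refl _ b, of "\<lambda>b. ?c b * (of_int (wt b) - of_int i)"] by simp
  then have "?c b = 0 \<or> wt b = i" by (metis of_int_diff of_int_eq_0_iff mult_eq_0_iff right_minus_eq)
  then show "homog kdeg (i + 2) (mconst (?c b) * mvar b)"
    using homog_cmult[OF homog_mvar[of kdeg b]] by (auto simp: kdeg_def)
qed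

section \<open>The action of \<open>\<mm>\<close> on \<open>S(\<qq>)\<close>\<close>

text \<open>The normal form of the linear form \<open>u\<close> modulo \<open>chi_ideal\<close>: the
  part in \<open>mm\<close> becomes a scalar. Since \<open>chi\<close> vanishes on the span of
  \<open>qbasis\<close>, \<open>chi u\<close> is already the value at that part.\<close>

definition redl :: "'g \<Rightarrow> ('g, 'k) mpoly" where
  "redl u = sym_emb B (qproj u) + mconst (chi u)"

definition red :: "('g, 'k) mpoly \<Rightarrow> ('g, 'k) mpoly" where
  "red = psubst redl"

text \<open>The adjoint action transported to normal forms. The transport is justified by
  \<open>red_sym_ad\<close>, for \<open>u\<close> in \<open>mm\<close>.\<close>

definition act :: "'g \<Rightarrow> ('g, 'k) mpoly \<Rightarrow> ('g, 'k) mpoly" where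
  "act u = gderiv (\<lambda>b. redl (bracket u b))"

lemma redl_add: "redl (u + v) = redl u + redl v"
  by (simp add: redl_def qproj_add sym_emb_add chi_add mconst_add)

lemma redl_scale: "redl (scale c u) = mconst c * redl u"
  by (simp add: redl_def qproj_scale sym_emb_scale chi_scale mconst_mult algebra_simps)

lemma redl_0 [simp]: "redl 0 = 0"
  using redl_scale[of 0 0] by simp

lemma redl_diff: "redl (u - v) = redl u - redl v"
  using redl_add[of "u - v" v] by simp

lemma redl_sum: "redl (\<Sum>i\<in>A. g i) = (\<Sum>i\<in>A. redl (g i))"
  by (induction A rule: infinite_finite_induct) (simp_all add: redl_add)

lemma redl_polys: "redl u \<in> polys qbasis"
  unfolding redl_def by (intro polys_add sym_emb_polys qproj_span qbasis_subset_B polys_mconst)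

lemma redl_mm: "u \<in> mm \<Longrightarrow> redl u = mconst (chi u)"
  by (simp add: redl_def qproj_of_mm)

lemma redl_qbasis: "b \<in> qbasis \<Longrightarrow> redl b = mvar b"
  using qbasis_subset_B by (auto simp: redl_def qproj_q span_base chi_qbasis sym_emb_basis)

text \<open>An arbitrary linear \<open>g\<close> serves both the identity and
  \<open>bracket u\<close>.\<close>

lemma sym_emb_combination:
  fixes g :: "'g \<Rightarrow> 'g"
  assumes add: "\<And>u v. g (u + v) = g u + g v" and scale: "\<And>c u. g (scale c u) = scale c (g u)"
  shows "(\<Sum>b\<in>B. mconst (representation B v b) * redl (g b)) = redl (g v)"
proof -
  have sum: "g (\<Sum>b\<in>A. c b) = (\<Sum>b\<in>A. g (c b))" for A :: "'g set" and c
    using scale[of 0 0] by (induction A rule: infinite_finite_induct) (simp_all add: add)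
  have "redl (g v) = redl (g (\<Sum>b\<in>B. scale (representation B v b) b))"
    using sum_representation_restrict[of v B] by simp
  also have "\<dots> = (\<Sum>b\<in>B. mconst (representation B v b) * redl (g b))"
    by (simp add: sum scale redl_sum redl_scale)
  finally show ?thesis by simp
qed

lemma red_sym_emb: "red (sym_emb B v) = redl v"
  using sym_emb_combination[of "\<lambda>v. v" v]
  by (simp add: red_def sym_emb_def psubst_sum psubst_mult)

lemma act_sym_emb: "act u (sym_emb B v) = redl (bracket u v)"
  using sym_emb_combination[of "bracket u" v]
  by (simp add: act_def sym_emb_def gderiv_sum gderiv_mult bracket_add_right bracket_scale_right)

lemma red_polys: "red p \<in> polys qbasis"
  unfolding red_def by (rule psubst_polys[of p UNIV]) (auto simp: polys_iff[of _ UNIV] redl_polys)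

lemma red_id: "p \<in> polys qbasis \<Longrightarrow> red p = p"
  unfolding red_def using psubst_cong[of p qbasis redl mvar] by (simp add: redl_qbasis psubst_mvar_id)

lemma act_polys: "p \<in> polys qbasis \<Longrightarrow> act u p \<in> polys qbasis"
  unfolding act_def by (rule gderiv_polys) (auto simp: redl_polys)

text \<open>The projection changes \<open>[u, v]\<close> by an element of \<open>[mm, mm]\<close>,
  which lies in \<open>mm\<close> and is killed by \<open>chi\<close>, so its normal form is
  0.\<close>

lemma redl_bracket_mm: "u \<in> mm \<Longrightarrow> redl (bracket u (qproj v)) = redl (bracket u v)"
proof -
  assume u: "u \<in> mm"
  have "redl (bracket u v) - redl (bracket u (qproj v)) = redl (bracket u (v - qproj v))"
    by (simp add: bracket_diff_right redl_diff)
  also have "\<dots> = 0"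
    using u qproj_mm[of v] by (simp add: redl_mm bracket_mm chi_mm_mm)
  finally show ?thesis by simp
qed

lemma act_redl: "u \<in> mm \<Longrightarrow> act u (redl v) = redl (bracket u v)"
  using act_sym_emb[of u "qproj v"] unfolding act_def redl_def[of v]
  by (simp add: gderiv_add redl_bracket_mm)

lemma sym_ad_eq_gderiv: "sym_ad B u = gderiv (\<lambda>b. sym_emb B (bracket u b))"
  by (rule ext) (simp add: sym_ad_def gderiv_def)

text \<open>On variables this is the insensitivity of the normal form of \<open>[u, v]\<close> to
  the projection of \<open>v\<close>. It makes the action descend to the quotient.\<close>

lemma red_sym_ad: "u \<in> mm \<Longrightarrow> red (sym_ad B u p) = act u (red p)"
  unfolding sym_ad_eq_gderiv red_def act_def
  by (rule psubst_gderiv[of p UNIV])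
    (auto simp: polys_iff[of _ UNIV] red_sym_emb[unfolded red_def] act_redl[unfolded act_def])

lemma act_commutator:
  assumes "u \<in> mm" "v \<in> mm"
  shows "act u (act v p) - act v (act u p) = act (bracket u v) p"
  unfolding act_def
  by (rule gderiv_commutator[of p UNIV])
    (use assms in \<open>simp_all add: polys_iff[of _ UNIV] act_redl[unfolded act_def] bracket_bracket redl_diff\<close>)

lemma act_linear:
  "act (\<Sum>b\<in>A. scale (c b) (g b)) p = (\<Sum>b\<in>A. mconst (c b) * act (g b) p)"
  unfolding act_def
  by (rule gderiv_lin[of p UNIV])
    (simp_all add: polys_iff[of _ UNIV] bracket_sum_left bracket_scale_left redl_sum redl_scale)

text \<open>Invariance under \<open>mm\<close> thereby amounts to finitely many equations, one for
  each vertical variable.\<close>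

lemma act_mm: "u \<in> mm \<Longrightarrow> act u p = (\<Sum>b\<in>vert. mconst (chi (bracket u b)) * act (dual b) p)"
  using act_linear[of "\<lambda>b. chi (bracket u b)" dual vert p] mm_explicit[of u] by simp

definition act1 :: "'g \<Rightarrow> ('g, 'k) mpoly \<Rightarrow> ('g, 'k) mpoly" where
  "act1 u = gderiv (\<lambda>b. sym_emb B (qproj (bracket u b)))"

lemma act_dual: "b \<in> vert \<Longrightarrow> p \<in> polys qbasis \<Longrightarrow> act (dual b) p = act1 (dual b) p + pd b p"
proof -
  assume b: "b \<in> vert" and p: "p \<in> polys qbasis"
  have "gderiv (\<lambda>c. mconst (chi (bracket (dual b) c))) p = pd b p"
    using p by (rule gderiv_cong) (simp add: chi_dual[OF b])
  then show ?thesis by (simp add: act_def act1_def redl_def gderiv_plus)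
qed

lemma order_ge_1_sym_emb: "order_ge 1 (sym_emb B v)"
  unfolding sym_emb_def
  by (intro order_ge_sum order_ge_cmult) (auto simp: order_ge_def mvar_def)

text \<open>A linear vector field replaces one variable by a linear form and so never lowers the
  order, in contrast to \<open>pd\<close>, which may lower it by one.\<close>

lemma order_ge_act1: "order_ge j p \<Longrightarrow> order_ge j (act1 u p)"
  using order_ge_gderiv[of p UNIV "j - 1" 1 "\<lambda>b. sym_emb B (qproj (bracket u b))"] order_ge_1_sym_emb
  unfolding act1_def by (cases j) (auto simp: polys_iff[of _ UNIV])

lemma order_ge_pd: "order_ge (Suc j) p \<Longrightarrow> order_ge j (pd b p)"
  using order_ge_gderiv[of p UNIV j 0] by (simp add: polys_iff[of _ UNIV])

lemma homog_pd: "homog (\<lambda>_. 1) k p \<Longrightarrow> homog (\<lambda>_. 1) (k - 1) (pd b p)"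
  for p :: "('g, 'k) mpoly"
proof -
  assume "homog (\<lambda>_. 1) k p"
  moreover have "homog (\<lambda>_. 1) (1 + - 1) (if c = b then 1 else 0 :: ('g, 'k) mpoly)" for c
    using homog_mconst[of "\<lambda>_ :: 'g. 1" "1 :: 'k"] by simp
  ultimately show ?thesis
    using homog_gderiv[of p UNIV "\<lambda>_. 1" k "-1"] by (simp add: polys_iff[of _ UNIV])
qed

lemma kdeg_ge: "b \<in> qbasis \<Longrightarrow> kdeg b \<ge> 1"
  using wt_ge[of b] by (simp add: kdeg_def)

lemma redl_homog: "v \<in> gw i \<Longrightarrow> homog kdeg (i + 2) (redl v)"
proof -
  assume v: "v \<in> gw i"
  have "homog kdeg (i + 2) (mconst (chi v))"
    using homog_mconst[of kdeg "chi v"] chi_weight[OF v] by (cases "i = -2") auto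
  then show ?thesis unfolding redl_def
    by (intro homog_add sym_emb_homog qproj_span qproj_weight v)
qed

lemma act_homog:
  assumes "u \<in> gw i" "p \<in> polys qbasis" "homog kdeg k p"
  shows "homog kdeg (k + i) (act u p)"
  unfolding act_def
proof (rule homog_gderiv[OF assms(2,3)])
  fix b assume "b \<in> qbasis"
  from redl_homog[OF weight_space_bracket[OF assms(1) qbasis_weight[OF this]]]
  show "homog kdeg (kdeg b + i) (redl (bracket u b))"
    by (simp add: kdeg_def algebra_simps)
qed

text \<open>Every variable in \<open>qbasis\<close> counts at least 1, so the Kazhdan degree bounds
  the polynomial degree.\<close>

lemma homog_order_ge_kdeg:
  assumes "p \<in> polys qbasis" "homog kdeg k p" "order_ge j p" "k < int j"
  shows "p = 0"
proof (rule ccontr)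
  assume "p \<noteq> 0"
  then obtain t where t: "t \<in> keys p" by (metis keys_eq_empty ex_in_conv)
  then have "int (mdeg t) \<le> wdeg kdeg t"
    using assms(1) kdeg_ge by (intro wdeg_ge_mdeg) (auto simp: polys_iff)
  then show False using t assms(2-4) by (auto simp: homog_def order_ge_def)
qed

text \<open>In \<open>act (dual b) p\<close> only the partial derivative of the lowest component has
  degree \<open>j - 1\<close>; everything else has order at least \<open>j\<close>.\<close>

lemma pd_hom_part_zero:
  assumes p: "p \<in> polys qbasis" "order_ge j p" and b: "b \<in> vert" "order_ge j (act (dual b) p)"
  shows "pd b (hom_part j p) = 0"
proof -
  let ?q = "p - hom_part j p"
  have "pd b p = pd b (hom_part j p) + pd b ?q"
    by (simp add: gderiv_add[symmetric])
  then have "pd b (hom_part j p) = act (dual b) p - act1 (dual b) p - pd b ?q"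
    using act_dual[OF b(1) p(1)] by (simp add: algebra_simps)
  moreover have "order_ge j (pd b ?q)"
    using p(2) by (intro order_ge_pd order_ge_minus_hom_part)
  ultimately have "order_ge j (pd b (hom_part j p))"
    using b(2) p(2) by (auto intro!: order_ge_diff order_ge_act1)
  then show ?thesis
    using homog_pd[OF hom_part_homog_1[of j p], of b] by (auto intro: homog_order_ge_imp_0)
qed

section \<open>Invariants and their restriction to the centralizer\<close>

definition invs :: "('g, 'k) mpoly set" where
  "invs = {p \<in> polys qbasis. \<forall>u\<in>mm. act u p = 0}"

abbreviation X :: "'g set" where "X \<equiv> x ` {1..r}"

lemma X_subset: "X \<subseteq> qbasis"
  using r_le_m by (auto simp: qbasis_def)

lemma qbasis_minus_vert: "qbasis - vert = X"
  using vert_eq X_subset by blast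

lemma hom_part_invs:
  assumes "p \<in> invs" "order_ge j p"
  shows "hom_part j p \<in> polys X"
  using polys_of_pd_zero[of "hom_part j p" qbasis vert] assms pd_hom_part_zero[of p j] dual_mm
  by (auto simp: invs_def qbasis_minus_vert hom_part_polys)

text \<open>The lowest component involves the centralizer variables only, so restriction neither
  kills nor alters it.\<close>

lemma lowest_part_invs:
  assumes "p \<in> invs"
  shows "lowest_part p = lowest_part (restrict_vars X p)" and "p \<noteq> 0 \<Longrightarrow> restrict_vars X p \<noteq> 0"
proof -
  have *: "lowest_part p = lowest_part (restrict_vars X p) \<and> restrict_vars X p \<noteq> 0" if "p \<noteq> 0"
  proof -
    obtain j where j: "order_ge j p" "hom_part j p \<noteq> 0" "lowest_part p = hom_part j p"
      using lowest_hom_part[OF \<open>p \<noteq> 0\<close>] .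
    have eq: "hom_part j (restrict_vars X p) = hom_part j p"
      using restrict_vars_id[OF hom_part_invs[OF assms j(1)]] by (simp add: hom_part_restrict_vars)
    moreover have "order_ge j (restrict_vars X p)"
      using j(1) by (auto simp: order_ge_def in_keys_iff lookup_restrict_vars split: if_splits)
    ultimately show ?thesis using lowest_part_eqI[of j "restrict_vars X p"] j by auto
  qed
  then show "p \<noteq> 0 \<Longrightarrow> restrict_vars X p \<noteq> 0" by blast
  show "lowest_part p = lowest_part (restrict_vars X p)"
    using * by (cases "p = 0") (auto simp: restrict_vars_eq_psubst)
qed

lemma restrict_add: "restrict_vars V (p + q) = restrict_vars V p + restrict_vars V q"
  and restrict_diff: "restrict_vars V (p - q) = restrict_vars V p - restrict_vars V q"
  by (simp_all add: restrict_vars_eq_psubst psubst_add psubst_diff)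

lemma invs_add: "p \<in> invs \<Longrightarrow> q \<in> invs \<Longrightarrow> p + q \<in> invs"
  and invs_mult: "p \<in> invs \<Longrightarrow> q \<in> invs \<Longrightarrow> p * q \<in> invs"
  and invs_diff: "p \<in> invs \<Longrightarrow> q \<in> invs \<Longrightarrow> p - q \<in> invs"
  and invs_mconst: "mconst c \<in> invs"
  by (auto simp: invs_def act_def gderiv_add gderiv_diff gderiv_mult polys_add polys_mult polys_diff)

lemma invs_eqI:
  assumes "p \<in> invs" "q \<in> invs" "restrict_vars X p = restrict_vars X q"
  shows "p = q"
  using lowest_part_invs(2)[OF invs_diff[OF assms(1,2)]] assms(3) by (auto simp: restrict_diff)

text \<open>Comparing terms of degree \<open>j - 1\<close> in the commutator relation shows that the components
  of degree \<open>j\<close> of the \<open>act (dual b) p\<close> form a closed one-form.\<close>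

lemma invariant_step:
  assumes p: "p \<in> polys qbasis" "homog kdeg k p" and ord: "\<And>u. u \<in> mm \<Longrightarrow> order_ge j (act u p)"
  shows "\<exists>p'\<in>polys qbasis. homog kdeg k p' \<and> (\<forall>u\<in>mm. order_ge (Suc j) (act u p')) \<and>
    restrict_vars X p' = restrict_vars X p"
proof -
  define c where "c b = - hom_part j (act (dual b) p)" for b
  have actp: "act (dual b) p \<in> polys qbasis" for b using act_polys[OF p(1)] .
  have c_polys: "c b \<in> polys qbasis" for b
    unfolding c_def by (intro polys_uminus hom_part_polys actp)
  have c_1: "homog (\<lambda>_. 1) (int j) (c b)" for b
    unfolding c_def by (intro homog_uminus hom_part_homog_1)
  have c_k: "homog kdeg (k - kdeg b) (c b)" if "b \<in> vert" for b
    using act_homog[OF dual_weight[OF that] p] unfolding c_def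
    by (intro homog_uminus hom_part_homog) (simp add: kdeg_def algebra_simps)
  have rest: "order_ge (Suc j) (act (dual b) p + c b)" if "b \<in> vert" for b
    using order_ge_minus_hom_part[OF ord[OF dual_mm[OF that]]] by (simp add: c_def)
  \<comment> \<open>Modulo order \<open>j\<close> the iterated action is
    \<open>- pd a (c b)\<close>: the remainder \<open>act (dual b) p + c b\<close> has order
    \<open>j + 1\<close>, and the linear part of the field keeps \<open>c b\<close> in order
    \<open>j\<close>.\<close>
  have half: "order_ge j (act (dual a) (act (dual b) p) + pd a (c b))" if a: "a \<in> vert" and b: "b \<in> vert" for a b
  proof -
    let ?r = "act (dual b) p + c b"
    have "act (dual a) (act (dual b) p) + act (dual a) (c b) = act (dual a) ?r"
      by (simp add: act_def gderiv_add)
    moreover have "act (dual a) (c b) = act1 (dual a) (c b) + pd a (c b)"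
      by (rule act_dual[OF a c_polys])
    moreover have "act (dual a) ?r = act1 (dual a) ?r + pd a ?r"
      by (intro act_dual[OF a] polys_add actp c_polys)
    ultimately have "act (dual a) (act (dual b) p) + pd a (c b) = act1 (dual a) ?r + pd a ?r - act1 (dual a) (c b)"
      by (simp add: algebra_simps)
    moreover have "order_ge j (act1 (dual a) ?r)"
      using rest[OF b] by (intro order_ge_act1) (rule order_ge_mono, auto)
    ultimately show ?thesis
      using order_ge_pd[OF rest[OF b]] order_ge_act1[OF homog_order_ge[OF c_1]]
      by (auto intro!: order_ge_diff order_ge_add)
  qed
  have closed: "pd a (c b) = pd b (c a)" if a: "a \<in> vert" and b: "b \<in> vert" for a b
  proof -
    \<comment> \<open>The commutator is the action of another element of \<open>mm\<close>, so it
      has order \<open>j\<close> by assumption. A form of degree \<open>j - 1\<close> with this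
      order must vanish.\<close>
    let ?d = "pd a (c b) - pd b (c a)"
    have "?d = (act (dual a) (act (dual b) p) + pd a (c b)) - (act (dual b) (act (dual a) p) + pd b (c a))
        - act (bracket (dual a) (dual b)) p"
      by (simp add: act_commutator[OF dual_mm[OF a] dual_mm[OF b], symmetric])
    then have "order_ge j ?d"
      using half[OF a b] half[OF b a] ord[OF bracket_mm[OF dual_mm[OF a] dual_mm[OF b]]]
      by (simp only: order_ge_diff)
    moreover have "homog (\<lambda>_. 1) (int j - 1) ?d"
      using homog_add[OF homog_pd[OF c_1] homog_uminus[OF homog_pd[OF c_1]]] by simp
    ultimately have "?d = 0" using homog_order_ge_imp_0[of "int j - 1" ?d j] by auto
    then show ?thesis by simp
  qed
  \<comment> \<open>The support condition gives everything else that is needed of \<open>q\<close>: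
    its variables, Kazhdan degree \<open>k\<close>, order \<open>j + 1\<close>, and a vertical
    variable in each monomial.\<close>
  obtain q where q: "\<And>a. a \<in> vert \<Longrightarrow> pd a q = c a"
    and supp: "\<And>t. t \<in> keys q \<Longrightarrow> \<exists>b\<in>vert. \<exists>t'\<in>keys (c b). t = t' + single b 1"
    using polynomial_poincare[OF finite_vert closed] by metis
  have q_polys: "q \<in> polys qbasis"
    unfolding polys_iff
  proof
    fix t assume "t \<in> keys q"
    then obtain b t' where "b \<in> vert" "t' \<in> keys (c b)" "t = t' + single b 1" using supp by blast
    then show "keys t \<subseteq> qbasis"
      using c_polys[of b] vert_qbasis by (auto simp: polys_iff keys_add_nat)
  qed
  have q_k: "homog kdeg k q"
    unfolding homog_def
  proof
    fix t assume "t \<in> keys q"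
    then obtain b t' where "b \<in> vert" "t' \<in> keys (c b)" "t = t' + single b 1" using supp by blast
    then show "wdeg kdeg t = k" using c_k[of b] by (auto simp: homog_def wdeg_add)
  qed
  have q_ord: "order_ge (Suc j) q"
    unfolding order_ge_def
  proof
    fix t assume "t \<in> keys q"
    then obtain b t' where "b \<in> vert" "t' \<in> keys (c b)" "t = t' + single b 1" using supp by blast
    then show "Suc j \<le> mdeg t" using homog_order_ge[OF c_1[of b]] by (auto simp: order_ge_def mdeg_add)
  qed
  have q_0: "restrict_vars X q = 0"
  proof (rule poly_mapping_eqI)
    fix t
    show "lookup (restrict_vars X q) t = lookup 0 t"
    proof (cases "t \<in> keys q")
      case True
      then obtain b t' where b: "b \<in> vert" "t = t' + single b 1" using supp by blast
      then have "b \<in> keys t" "b \<notin> X" using vert_eq by (auto simp: keys_add_nat)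
      then show ?thesis by (auto simp: lookup_restrict_vars)
    qed (simp add: lookup_restrict_vars in_keys_iff)
  qed
  have dual: "order_ge (Suc j) (act (dual b) (p + q))" if b: "b \<in> vert" for b
  proof -
    \<comment> \<open>The term \<open>pd b q\<close> supplies exactly the missing
      \<open>c b\<close>.\<close>
    have "act (dual b) (p + q) = (act (dual b) p + c b) + act1 (dual b) q"
      using act_dual[OF b q_polys] q[OF b] by (simp add: act_def gderiv_add)
    then show ?thesis using rest[OF b] order_ge_act1[OF q_ord] by (simp add: order_ge_add)
  qed
  show ?thesis
  proof (intro bexI[of _ "p + q"] conjI ballI)
    fix u assume "u \<in> mm"
    then show "order_ge (Suc j) (act u (p + q))"
      unfolding act_mm[OF \<open>u \<in> mm\<close>] by (intro order_ge_sum order_ge_cmult dual)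
  qed (use p q_polys q_k q_0 in \<open>auto simp: restrict_add intro: homog_add polys_add\<close>)
qed

lemma invariant_extension:
  assumes "p \<in> polys qbasis" "homog kdeg k p"
  shows "\<exists>p'\<in>invs. homog kdeg k p' \<and> restrict_vars X p' = restrict_vars X p"
proof -
  have "\<exists>p'\<in>polys qbasis. homog kdeg k p' \<and> (\<forall>u\<in>mm. order_ge j (act u p')) \<and>
    restrict_vars X p' = restrict_vars X p" for j
  proof (induction j)
    case 0
    then show ?case using assms by auto
  next
    case (Suc j)
    then obtain p' where "p' \<in> polys qbasis" "homog kdeg k p'" "\<And>u. u \<in> mm \<Longrightarrow> order_ge j (act u p')"
      "restrict_vars X p' = restrict_vars X p" by blast
    with invariant_step[of p' k j] show ?case by auto
  qed
  \<comment> \<open>After \<open>nat k + 1\<close> corrections \<open>act (dual b) p'\<close> has an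
    order above its Kazhdan degree \<open>k - kdeg b\<close>, which forces it to be 0.\<close>
  from this[of "Suc (nat k)"] obtain p' where p': "p' \<in> polys qbasis" "homog kdeg k p'"
    "\<And>u. u \<in> mm \<Longrightarrow> order_ge (Suc (nat k)) (act u p')" "restrict_vars X p' = restrict_vars X p" by blast
  have "act (dual b) p' = 0" if b: "b \<in> vert" for b
  proof (rule homog_order_ge_kdeg)
    show "homog kdeg (k + (- wt b - 2)) (act (dual b) p')"
      by (rule act_homog[OF dual_weight[OF b] p'(1,2)])
    show "k + (- wt b - 2) < int (Suc (nat k))"
      using wt_ge[of b] b vert_qbasis by auto
  qed (auto intro: act_polys p' dual_mm b)
  then have "act u p' = 0" if "u \<in> mm" for u
    unfolding act_mm[OF that] by simp
  then show ?thesis using p' by (auto simp: invs_def)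
qed

text \<open>Weight \<open>k - 2j\<close> in polynomial degree \<open>j\<close> is total weight
  \<open>k\<close> once each variable counts 2 more, which is the shift from \<open>wt\<close> to
  \<open>kdeg\<close>.\<close>

lemma kazhdan_homogeneous_iff:
  assumes p: "p \<in> polys qbasis"
  shows "kazhdan_homogeneous B h k p \<longleftrightarrow> homog kdeg k p"
proof -
  have ad: "sym_ad B h q = gderiv (\<lambda>b. mconst (of_int (wt b)) * mvar b) q" if "q \<in> polys qbasis" for q
    unfolding sym_ad_eq_gderiv using that
    by (rule gderiv_cong) (use qbasis_subset_B in \<open>auto simp: weight_spaceD[OF qbasis_weight] sym_emb_scale sym_emb_basis\<close>)
  have wdeg: "wdeg kdeg t = wdeg wt t + 2 * int (mdeg t)" for t
    unfolding mdeg_eq_wdeg wdeg_def by (simp add: kdeg_def algebra_simps sum.distrib sum_distrib_left)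
  have "kazhdan_homogeneous B h k p \<longleftrightarrow>
      (\<forall>j t. of_int (wdeg wt t) * lookup (hom_part j p) t = of_int (k - 2 * int j) * lookup (hom_part j p) t)"
    unfolding kazhdan_homogeneous_def ad[OF hom_part_polys[OF p]] poly_mapping_eq_iff fun_eq_iff
      lookup_euler lookup_mconst_mult ..
  also have "\<dots> \<longleftrightarrow> (\<forall>t. lookup p t \<noteq> 0 \<longrightarrow> wdeg wt t = k - 2 * int (mdeg t))"
    unfolding mult_cancel_right of_int_eq_iff lookup_hom_part by auto
  also have "\<dots> \<longleftrightarrow> homog kdeg k p"
    unfolding homog_def Ball_def in_keys_iff wdeg by (auto simp: algebra_simps)
  finally show ?thesis .
qed

end

section \<open>The algebra of invariants\<close>

declare One_nat_def [simp del]

context W_algebra_data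
begin

section \<open>The quotient and its normal forms\<close>

definition coset :: "('g, 'k) mpoly \<Rightarrow> ('g, 'k) mpoly set" where
  "coset p = chi_ideal +>\<^bsub>poly_ring B\<^esub> p"

lemma polys_qbasis_B: "p \<in> polys qbasis \<Longrightarrow> p \<in> polys B"
  using polys_mono[OF qbasis_subset_B] by blast

lemma sym_emb_polys_B: "sym_emb B u \<in> polys B"
  by (rule sym_emb_polys) auto

lemma red_add: "red (p + q) = red p + red q" and red_diff: "red (p - q) = red p - red q"
  and red_mult: "red (p * q) = red p * red q" and red_mconst [simp]: "red (mconst c) = mconst c"
  and red_0 [simp]: "red 0 = 0" and red_1 [simp]: "red 1 = 1"
  by (simp_all add: red_def psubst_add psubst_diff psubst_mult)

lemma ideal_chi_ideal: "ideal chi_ideal (poly_ring B)"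
  unfolding chi_ideal_def
  by (rule ring.genideal_ideal[OF poly_ring_ring]) (auto intro: polys_diff sym_emb_polys_B)

text \<open>The homomorphism \<open>red\<close> kills the generators, because the normal form of
  \<open>u\<close> in \<open>mm\<close> is the constant \<open>chi u\<close>.\<close>

lemma chi_ideal_subset: "chi_ideal \<subseteq> {p \<in> polys B. red p = 0}"
proof -
  have "red \<in> ring_hom (poly_ring B) (poly_ring qbasis)"
    by (rule ring_hom_memI) (simp_all add: red_polys red_add red_mult)
  then have "ring_hom_ring (poly_ring B) (poly_ring qbasis) red"
    by (intro ring_hom_ringI2 poly_ring_ring)
  then have ker: "ideal (a_kernel (poly_ring B) (poly_ring qbasis) red) (poly_ring B)"
    by (rule ring_hom_ring.kernel_is_ideal)
  have "chi_ideal \<subseteq> a_kernel (poly_ring B) (poly_ring qbasis) red"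
    unfolding chi_ideal_def
  proof (rule ring.genideal_minimal[OF poly_ring_ring ker])
    show "{sym_emb B u - mconst (chi u) |u. u \<in> mm} \<subseteq> a_kernel (poly_ring B) (poly_ring qbasis) red"
      by (auto simp: a_kernel_def' red_diff red_sym_emb redl_mm intro: polys_diff sym_emb_polys_B)
  qed
  then show ?thesis by (simp add: a_kernel_def')
qed

text \<open>For a variable the difference is a generator of the ideal, as \<open>b - qproj b\<close>
  lies in \<open>mm\<close> and \<open>chi (qproj b) = 0\<close>. Products follow from
  \<open>p q - red p red q = (p - red p) q + red p (q - red q)\<close>.\<close>

lemma minus_red_chi_ideal: "p \<in> polys B \<Longrightarrow> p - red p \<in> chi_ideal"
proof (induction rule: mpoly_induct)
  case (const c)
  then show ?case
    using additive_subgroup.zero_closed[OF ideal.axioms(1)[OF ideal_chi_ideal]] by simp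
next
  case (var b)
  have "mvar b - red (mvar b) = sym_emb B (b - qproj b) - mconst (chi (b - qproj b))"
    using var by (simp add: red_def redl_def sym_emb_diff sym_emb_basis chi_diff chi_q[OF qproj_span])
  moreover have "\<dots> \<in> chi_ideal"
    unfolding chi_ideal_def
    by (rule subsetD[OF ring.genideal_self[OF poly_ring_ring]])
      (auto intro: polys_diff sym_emb_polys_B qproj_mm)
  ultimately show ?case by simp
next
  case (add p q)
  have "p - red p + (q - red q) \<in> chi_ideal"
    using additive_subgroup.a_closed[OF ideal.axioms(1)[OF ideal_chi_ideal] add.IH] by simp
  then show ?case by (simp add: red_add algebra_simps)
next
  case (mult p q)
  have "(p - red p) * q \<in> chi_ideal"
    using ideal.I_r_closed[OF ideal_chi_ideal mult.IH(1) mult.hyps(2)] by simp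
  moreover have "red p * (q - red q) \<in> chi_ideal"
    using ideal.I_l_closed[OF ideal_chi_ideal mult.IH(2) polys_qbasis_B[OF red_polys]] by simp
  ultimately have "(p - red p) * q + red p * (q - red q) \<in> chi_ideal"
    using additive_subgroup.a_closed[OF ideal.axioms(1)[OF ideal_chi_ideal]] by fastforce
  then show ?case by (simp add: red_mult algebra_simps)
qed

lemma chi_ideal_iff: "p \<in> chi_ideal \<longleftrightarrow> p \<in> polys B \<and> red p = 0"
  using chi_ideal_subset minus_red_chi_ideal[of p] by auto

lemma coset_mem_iff: "p \<in> polys B \<Longrightarrow> q \<in> coset p \<longleftrightarrow> q \<in> polys B \<and> red q = red p"
proof -
  assume p: "p \<in> polys B"
  have "q \<in> coset p \<longleftrightarrow> (\<exists>a\<in>chi_ideal. q = a + p)"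
    by (auto simp: coset_def a_r_coset_def')
  also have "\<dots> \<longleftrightarrow> q - p \<in> chi_ideal"
    by (metis add_diff_cancel_right' diff_add_cancel)
  also have "\<dots> \<longleftrightarrow> q \<in> polys B \<and> red q = red p"
    using p polys_diff[of q B p] polys_add[of "q - p" B p] by (auto simp: chi_ideal_iff red_diff)
  finally show ?thesis .
qed

lemma coset_eq_iff:
  assumes "p \<in> polys B" "q \<in> polys B"
  shows "coset p = coset q \<longleftrightarrow> red p = red q"
  using coset_mem_iff[OF assms(1)] coset_mem_iff[OF assms(2)] assms by (auto intro: set_eqI)

lemma coset_0: "coset 0 = chi_ideal"
  by (auto simp: coset_mem_iff chi_ideal_iff)

lemma coset_red: "p \<in> polys B \<Longrightarrow> coset (red p) = coset p"
  by (simp add: coset_eq_iff polys_qbasis_B red_polys red_id)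

lemma sym_ad_polys_B: "p \<in> polys B \<Longrightarrow> sym_ad B u p \<in> polys B"
  unfolding sym_ad_eq_gderiv by (rule gderiv_polys) (auto simp: sym_emb_polys_B)

text \<open>All representatives share a normal form, and that of \<open>sym_ad B u q\<close> depends
  only on that of \<open>q\<close>; so the union is one of equal cosets.\<close>

lemma quot_ad_coset:
  assumes "p \<in> polys B" "u \<in> mm"
  shows "quot_ad u (coset p) = coset (sym_ad B u p)"
proof -
  have "coset (sym_ad B u q) = coset (sym_ad B u p)" if "q \<in> coset p" for q
    using that assms by (auto simp: coset_mem_iff coset_eq_iff sym_ad_polys_B red_sym_ad)
  moreover have "p \<in> coset p" using assms by (simp add: coset_mem_iff)
  ultimately show ?thesis
    unfolding quot_ad_def coset_def[symmetric] by blast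
qed

lemma zero_quot_ring: "\<zero>\<^bsub>quot_ring\<^esub> = chi_ideal"
  by (simp add: quot_ring_def FactRing_def)

lemma carrier_quot_ring: "carrier quot_ring = coset ` polys qbasis"
proof -
  have "carrier quot_ring = coset ` polys B"
    by (auto simp: quot_ring_def FactRing_def A_RCOSETS_def' coset_def)
  also have "\<dots> = coset ` polys qbasis"
    by (intro equalityI image_subsetI) (metis coset_red red_polys polys_qbasis_B image_eqI)+
  finally show ?thesis .
qed

lemma carrier_invariant_ring: "carrier invariant_ring = coset ` invs"
proof -
  have "(\<forall>u\<in>mm. quot_ad u (coset p) = \<zero>\<^bsub>quot_ring\<^esub>) \<longleftrightarrow> p \<in> invs" if p: "p \<in> polys qbasis" for p
  proof -
    have "quot_ad u (coset p) = \<zero>\<^bsub>quot_ring\<^esub> \<longleftrightarrow> act u p = 0" if u: "u \<in> mm" for u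
      using p u red_id[OF p] polys_qbasis_B[OF p]
      by (simp add: quot_ad_coset zero_quot_ring coset_0[symmetric] coset_eq_iff sym_ad_polys_B red_sym_ad)
    then show ?thesis using p by (auto simp: invs_def)
  qed
  then show ?thesis
    by (auto simp: invariant_ring_def carrier_quot_ring) (auto simp: invs_def)
qed

lemma invs_polys: "p \<in> invs \<Longrightarrow> p \<in> polys qbasis" and invs_polys_B: "p \<in> invs \<Longrightarrow> p \<in> polys B"
  by (auto simp: invs_def polys_qbasis_B)

lemma coset_inj_on: "inj_on coset (polys qbasis)"
  by (rule inj_onI) (metis coset_eq_iff polys_qbasis_B red_id)

lemma invariant_ring_ops:
  assumes "p \<in> polys B" "q \<in> polys B"
  shows "coset p \<otimes>\<^bsub>invariant_ring\<^esub> coset q = coset (p * q)"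
    "coset p \<oplus>\<^bsub>invariant_ring\<^esub> coset q = coset (p + q)"
    "\<one>\<^bsub>invariant_ring\<^esub> = coset 1" "\<zero>\<^bsub>invariant_ring\<^esub> = coset 0"
proof -
  have hom: "coset \<in> ring_hom (poly_ring B) quot_ring"
    using ideal.rcos_ring_hom[OF ideal_chi_ideal] unfolding coset_def quot_ring_def .
  show "coset p \<otimes>\<^bsub>invariant_ring\<^esub> coset q = coset (p * q)"
    using ring_hom_mult[OF hom assms] by (simp add: invariant_ring_def)
  show "coset p \<oplus>\<^bsub>invariant_ring\<^esub> coset q = coset (p + q)"
    using ring_hom_add[OF hom assms] by (simp add: invariant_ring_def)
  show "\<one>\<^bsub>invariant_ring\<^esub> = coset 1"
    using ring_hom_one[OF hom] by (simp add: invariant_ring_def)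
  show "\<zero>\<^bsub>invariant_ring\<^esub> = coset 0"
    by (simp add: invariant_ring_def zero_quot_ring coset_0)
qed

text \<open>A coset contains at most one polynomial in \<open>qbasis\<close>, here \<open>p\<close>,
  which removes the quantifier. For invariants the condition on lowest terms follows from the one on
  the restriction.\<close>

lemma has_initial_term_iff:
  assumes "p \<in> invs"
  shows "has_initial_term k Q (coset p) \<longleftrightarrow> homog kdeg k p \<and> restrict_vars X p = Q"
proof -
  have "p' = p" if "p' \<in> polys qbasis" "p' \<in> coset p" for p'
    using that red_id[of p'] red_id[of p] invs_polys[OF assms] invs_polys_B[OF assms] by (simp add: coset_mem_iff)
  moreover have "p \<in> coset p" using invs_polys_B[OF assms] by (simp add: coset_mem_iff)
  ultimately have "has_initial_term k Q (coset p) \<longleftrightarrow>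
      kazhdan_homogeneous B h k p \<and> lowest_part p = lowest_part Q \<and> restrict_vars X p = Q"
    unfolding has_initial_term_def using invs_polys[OF assms] by blast
  then show ?thesis
    using kazhdan_homogeneous_iff[OF invs_polys[OF assms]] lowest_part_invs(1)[OF assms] by auto
qed

section \<open>The isomorphism and its inverse\<close>

definition gen :: "'g \<Rightarrow> ('g, 'k) mpoly" where
  "gen v = (SOME p. p \<in> invs \<and> homog kdeg (kdeg v) p \<and> restrict_vars X p = mvar v)"

text \<open>Only the variables are extended by the one-form argument. All other polynomials follow
  by substitution, which makes the map multiplicative by construction.\<close>

definition lift_inv :: "('g, 'k) mpoly \<Rightarrow> ('g, 'k) mpoly" where
  "lift_inv = psubst gen"

definition nu :: "('g, 'k) mpoly \<Rightarrow> ('g, 'k) mpoly set" where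
  "nu Q = coset (lift_inv Q)"

lemma gen:
  assumes "v \<in> X"
  shows "gen v \<in> invs" "homog kdeg (kdeg v) (gen v)" "restrict_vars X (gen v) = mvar v"
proof -
  have "mvar v \<in> polys qbasis" using assms X_subset by auto
  from invariant_extension[OF this homog_mvar[of kdeg v]]
  have "\<exists>p. p \<in> invs \<and> homog kdeg (kdeg v) p \<and> restrict_vars X p = mvar v"
    using restrict_vars_id[OF polys_mvar[OF assms]] by auto
  from someI_ex[OF this, folded gen_def]
  show "gen v \<in> invs" "homog kdeg (kdeg v) (gen v)" "restrict_vars X (gen v) = mvar v" by auto
qed

lemma lift_inv_invs: "Q \<in> polys X \<Longrightarrow> lift_inv Q \<in> invs"
  by (induction rule: mpoly_induct)
    (simp_all add: lift_inv_def psubst_add psubst_mult invs_add invs_mult invs_mconst gen)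

lemma restrict_lift_inv: "Q \<in> polys X \<Longrightarrow> restrict_vars X (lift_inv Q) = Q"
  unfolding lift_inv_def restrict_vars_eq_psubst
  using psubst_comp[of Q X _ gen mvar] gen(3) psubst_mvar_id by (simp add: restrict_vars_eq_psubst)

text \<open>Both sides are invariants with the same restriction.\<close>

lemma lift_inv_restrict: "p \<in> invs \<Longrightarrow> lift_inv (restrict_vars X p) = p"
  by (rule invs_eqI) (simp_all add: lift_inv_invs restrict_lift_inv restrict_vars_polys)

text \<open>Each \<open>gen v\<close> has the Kazhdan degree of the variable that it
  replaces.\<close>

lemma lift_inv_homog: "Q \<in> polys X \<Longrightarrow> homog kdeg k Q \<Longrightarrow> homog kdeg k (lift_inv Q)"
  unfolding lift_inv_def using homog_psubst gen(2) by blast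

lemma polys_X_qbasis: "Q \<in> polys X \<Longrightarrow> Q \<in> polys qbasis"
  using polys_mono[OF X_subset] by blast

lemma nu_iso: "nu \<in> ring_iso (poly_ring X) invariant_ring"
proof (rule ring_iso_memI)
  show "bij_betw nu (polys X) (carrier invariant_ring)"
    unfolding bij_betw_def
  proof
    show "inj_on nu (polys X)"
    proof (rule inj_onI)
      fix P Q assume PQ: "P \<in> polys X" "Q \<in> polys X" "nu P = nu Q"
      then have "lift_inv P = lift_inv Q"
        using inj_onD[OF coset_inj_on] lift_inv_invs invs_polys unfolding nu_def by blast
      then show "P = Q" using PQ restrict_lift_inv by metis
    qed
    show "nu ` polys X = carrier invariant_ring"
      unfolding carrier_invariant_ring
    proof (intro equalityI subsetI)
      fix P assume "P \<in> coset ` invs"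
      then obtain p where p: "p \<in> invs" "P = coset p" by blast
      then have "P = nu (restrict_vars X p)" by (simp add: nu_def lift_inv_restrict)
      then show "P \<in> nu ` polys X" using restrict_vars_polys by blast
    qed (auto simp: nu_def lift_inv_invs)
  qed
next
  fix P Q :: "('g, 'k) mpoly" assume PQ: "P \<in> polys X" "Q \<in> polys X"
  note inv = invs_polys_B[OF lift_inv_invs[OF PQ(1)]] invs_polys_B[OF lift_inv_invs[OF PQ(2)]]
  show "nu P \<in> carrier invariant_ring"
    using PQ by (simp add: carrier_invariant_ring nu_def lift_inv_invs)
  show "nu (P \<otimes>\<^bsub>poly_ring X\<^esub> Q) = nu P \<otimes>\<^bsub>invariant_ring\<^esub> nu Q"
    using invariant_ring_ops(1)[OF inv] by (simp add: nu_def lift_inv_def psubst_mult)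
  show "nu (P \<oplus>\<^bsub>poly_ring X\<^esub> Q) = nu P \<oplus>\<^bsub>invariant_ring\<^esub> nu Q"
    using invariant_ring_ops(2)[OF inv] by (simp add: nu_def lift_inv_def psubst_add)
next
  show "nu \<one>\<^bsub>poly_ring X\<^esub> = \<one>\<^bsub>invariant_ring\<^esub>"
    using invariant_ring_ops(3)[of 0 0] by (simp add: nu_def lift_inv_def)
qed

lemma nu_mconst: "nu (mconst c) = quot_const c"
  by (simp add: nu_def lift_inv_def coset_def quot_const_def)

lemma nu_initial:
  assumes "Q \<in> polys X" "kazhdan_homogeneous B h k Q"
  shows "has_initial_term k Q (nu Q)"
  using assms kazhdan_homogeneous_iff[OF polys_X_qbasis[OF assms(1)]]
  by (simp add: nu_def has_initial_term_iff lift_inv_invs restrict_lift_inv lift_inv_homog)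

lemma initial_unique:
  assumes "P \<in> carrier invariant_ring" "P' \<in> carrier invariant_ring"
    and "has_initial_term k Q P" "has_initial_term k Q P'"
  shows "P = P'"
proof -
  obtain p p' where p: "p \<in> invs" "P = coset p" and p': "p' \<in> invs" "P' = coset p'"
    using assms(1,2) unfolding carrier_invariant_ring by blast
  have "restrict_vars X p = Q" "restrict_vars X p' = Q"
    using has_initial_term_iff[OF p(1)] has_initial_term_iff[OF p'(1)] assms(3,4) unfolding p(2) p'(2) by blast+
  then have "p = p'" using invs_eqI[OF p(1) p'(1)] by simp
  then show ?thesis unfolding p(2) p'(2) by (rule arg_cong)
qed

text \<open>The ring axioms are carried over from the polynomial ring along
  \<open>nu\<close>.\<close>

lemma ring_invariant_ring: "ring invariant_ring"
proof -
  have "nu \<zero>\<^bsub>poly_ring X\<^esub> = \<zero>\<^bsub>invariant_ring\<^esub>" "nu \<one>\<^bsub>poly_ring X\<^esub> = \<one>\<^bsub>invariant_ring\<^esub>"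
    using invariant_ring_ops(3,4)[of 0 0] by (simp_all add: nu_def lift_inv_def)
  then show ?thesis
    using ring.ring_iso_imp_img_ring[OF poly_ring_ring nu_iso] by simp
qed

text \<open>The substitution is a linear change of variables between two bases of the centralizer.
  Its inverse substitutes for each \<open>x i\<close> its coordinates in the basis
  \<open>b\<close>.\<close>

lemma linear_substitution_iso:
  assumes b: "family_basis b {1..r} (centralizer e)"
  shows "psubst (\<lambda>i. sym_emb B (b i)) \<in> ring_iso (poly_ring {1..r}) (poly_ring X)"
proof -
  let ?L = "psubst (\<lambda>i. sym_emb B (b i)) :: (nat, 'k) mpoly \<Rightarrow> ('g, 'k) mpoly"
  define C where "C = b ` {1..r}"
  have C: "independent C" "span C = centralizer e" "inj_on b {1..r}"
    using b by (auto simp: family_basis_def C_def)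
  have X: "span X = centralizer e" using x_centralizer by (simp add: family_basis_def)
  have bX: "b i \<in> span X" if "i \<in> {1..r}" for i
    using that C(2) X span_base[of "b i" C] by (auto simp: C_def)
  have XC: "v \<in> span C" if "v \<in> X" for v
    using that C(2) X span_base[of v X] by auto
  have XB: "X \<subseteq> B" using X_subset qbasis_subset_B by blast
  \<comment> \<open>Linearity of \<open>coord\<close> is available on the span of \<open>C\<close>,
    hence the side conditions in the rules below.\<close>
  define coord where "coord v = (\<Sum>i\<in>{1..r}. mconst (representation C v (b i)) * mvar i)" for v
  let ?M = "psubst coord :: ('g, 'k) mpoly \<Rightarrow> (nat, 'k) mpoly"
  have coord_add: "coord (u + v) = coord u + coord v" if "u \<in> span C" "v \<in> span C" for u v
    using that by (simp add: coord_def representation_add[OF C(1)] mconst_add algebra_simps sum.distrib)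
  have coord_scale: "coord (scale c v) = mconst c * coord v" if "v \<in> span C" for c v
    using that by (simp add: coord_def representation_scale[OF C(1)] mconst_mult sum_distrib_left algebra_simps)
  have coord_0: "coord 0 = 0" using coord_scale[of 0 0] by (simp add: span_zero)
  have coord_sum: "coord (\<Sum>v\<in>A. scale (c v) v) = (\<Sum>v\<in>A. mconst (c v) * coord v)" if "A \<subseteq> span C" for A c
    using that
  proof (induction A rule: infinite_finite_induct)
    case (insert v A)
    then have "(\<Sum>v\<in>A. scale (c v) v) \<in> span C" "v \<in> span C"
      by (auto intro: span_sum span_scale)
    then have "coord (scale (c v) v + (\<Sum>v\<in>A. scale (c v) v)) = mconst (c v) * coord v + coord (\<Sum>v\<in>A. scale (c v) v)"
      by (simp only: coord_add coord_scale span_scale)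
    then show ?case using insert by simp
  qed (simp_all add: coord_0)
  have M_emb: "?M (sym_emb B v) = coord v" if "v \<in> span X" for v
  proof -
    have "?M (sym_emb B v) = (\<Sum>a\<in>X. mconst (representation B v a) * coord a)"
      unfolding sym_emb_restrict[OF that XB] by (simp add: psubst_sum psubst_mult)
    also have "\<dots> = coord (\<Sum>a\<in>X. scale (representation B v a) a)"
      using XC by (intro coord_sum[symmetric]) auto
    also have "\<dots> = coord v" by (simp only: sum_representation_restrict[OF that XB, symmetric])
    finally show ?thesis .
  qed
  have L_coord: "?L (coord v) = sym_emb B v" if "v \<in> span C" for v
  proof -
    have fin: "finite C" by (simp add: C_def)
    have sum: "sym_emb B (\<Sum>i\<in>A. scale (c i) (b i)) = (\<Sum>i\<in>A. mconst (c i) * sym_emb B (b i))" for A c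
      by (induction A rule: infinite_finite_induct) (simp_all add: sym_emb_add sym_emb_scale)
    have "v = (\<Sum>a\<in>C. scale (representation C v a) a)"
      using sum_representation_eq[OF C(1) that fin order_refl] by (rule sym)
    also have "\<dots> = (\<Sum>i\<in>{1..r}. scale (representation C v (b i)) (b i))"
      unfolding C_def using sum.reindex[OF C(3)] by simp
    finally show ?thesis unfolding coord_def
      using sum[of "\<lambda>i. representation C v (b i)" "{1..r}"] by (simp add: psubst_sum psubst_mult)
  qed
  have coord_b: "coord (b i) = mvar i" if i: "i \<in> {1..r}" for i
  proof -
    have rep: "representation C (b i) = (\<lambda>v. if v = b i then 1 else 0)"
      using i by (intro representation_basis[OF C(1)]) (simp add: C_def)
    have "coord (b i) = (\<Sum>j\<in>{1..r}. if j = i then mvar i else 0)"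
      unfolding coord_def
    proof (intro sum.cong refl)
      fix j assume "j \<in> {1..r}"
      then have "b j = b i \<longleftrightarrow> j = i" using inj_on_eq_iff[OF C(3)] i by blast
      then show "mconst (representation C (b i) (b j)) * mvar j = (if j = i then mvar i else 0)"
        unfolding rep by simp
    qed
    then show ?thesis using i by simp
  qed
  have coord_polys: "coord v \<in> polys {1..r}" for v
    unfolding coord_def by (intro polys_sum polys_mult) auto
  have L_polys: "sym_emb B (b i) \<in> polys X" if "i \<in> {1..r}" for i
    using sym_emb_polys[OF bX[OF that] XB] .
  have M_L: "?M (?L p) = p" if "p \<in> polys {1..r}" for p
  proof -
    have "?M (?L p) = psubst mvar p"
    proof (rule psubst_comp[OF that])
      fix i assume "i \<in> {1..r}"
      then show "?M (sym_emb B (b i)) = mvar i" by (simp only: M_emb[OF bX] coord_b)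
    qed
    then show ?thesis by (simp only: psubst_mvar_id)
  qed
  have L_M: "?L (?M q) = q" if "q \<in> polys X" for q
  proof -
    have "?L (?M q) = psubst mvar q"
    proof (rule psubst_comp[OF that])
      fix v assume "v \<in> X"
      then show "?L (coord v) = mvar v" using XB by (simp only: L_coord[OF XC] sym_emb_basis subsetD)
    qed
    then show ?thesis by (simp only: psubst_mvar_id)
  qed
  have Lp: "?L p \<in> polys X" if "p \<in> polys {1..r}" for p
    using that L_polys by (rule psubst_polys)
  have Mp: "?M q \<in> polys {1..r}" if "q \<in> polys X" for q
    using that coord_polys by (rule psubst_polys)
  have "bij_betw ?L (polys {1..r}) (polys X)"
    by (rule bij_betw_byWitness[of _ ?M]) (use M_L L_M Lp Mp in auto)
  then show ?thesis
    using psubst_ring_hom[of "{1..r}" "\<lambda>i. sym_emb B (b i)" X] L_polys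
    by (simp add: ring_iso_def)
qed

text \<open>The change of variables followed by \<open>nu\<close> presents the invariants by
  numbered variables. Generation is then the image of the generation of a polynomial ring by its
  constants and variables.\<close>

lemma generators:
  assumes b: "family_basis b {1..r} (centralizer e)"
  shows "generate_ring invariant_ring (range quot_const \<union> (\<lambda>i. nu (sym_emb B (b i))) ` {1..r}) = carrier invariant_ring"
    and "\<exists>\<phi>. \<phi> \<in> ring_iso (poly_ring {1..r}) invariant_ring \<and> (\<forall>c. \<phi> (mconst c) = quot_const c) \<and>
      (\<forall>i\<in>{1..r}. \<phi> (mvar i) = nu (sym_emb B (b i)))"
proof -
  define \<phi> where "\<phi> = nu \<circ> psubst (\<lambda>i. sym_emb B (b i))"
  have iso: "\<phi> \<in> ring_iso (poly_ring {1..r}) invariant_ring"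
    unfolding \<phi>_def by (rule ring_iso_set_trans[OF linear_substitution_iso[OF b] nu_iso])
  have const: "\<phi> (mconst c) = quot_const c" for c
    by (simp add: \<phi>_def nu_mconst)
  have var: "\<phi> (mvar i) = nu (sym_emb B (b i))" for i
    by (simp add: \<phi>_def)
  show "\<exists>\<phi>. \<phi> \<in> ring_iso (poly_ring {1..r}) invariant_ring \<and> (\<forall>c. \<phi> (mconst c) = quot_const c) \<and>
      (\<forall>i\<in>{1..r}. \<phi> (mvar i) = nu (sym_emb B (b i)))"
    by (intro exI[of _ \<phi>] conjI allI ballI iso const var)
  let ?H = "range quot_const \<union> (\<lambda>i. nu (sym_emb B (b i))) ` {1..r}"
  note hom = ring_iso_memE[OF iso]
  have "\<phi> p \<in> generate_ring invariant_ring ?H" if "p \<in> polys {1..r}" for p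
    using that
  proof (induction rule: mpoly_induct)
    case (const c)
    then show ?case unfolding \<open>\<And>c. \<phi> (mconst c) = quot_const c\<close> by (intro generate_ring.incl) simp
  next
    case (var i)
    then show ?case unfolding \<open>\<And>i. \<phi> (mvar i) = nu (sym_emb B (b i))\<close> by (intro generate_ring.incl) simp
  next
    case (add p q)
    then have "\<phi> (p + q) = \<phi> p \<oplus>\<^bsub>invariant_ring\<^esub> \<phi> q" using hom(3)[of p q] by simp
    then show ?case using generate_ring.eng_add[OF add.IH] by (simp only:)
  next
    case (mult p q)
    then have "\<phi> (p * q) = \<phi> p \<otimes>\<^bsub>invariant_ring\<^esub> \<phi> q" using hom(2)[of p q] by simp
    then show ?case using generate_ring.eng_mult[OF mult.IH] by (simp only:)
  qed
  moreover have "\<phi> ` polys {1..r} = carrier invariant_ring"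
    using hom(5) unfolding bij_betw_def by (rule conjunct2)
  moreover have "?H \<subseteq> carrier invariant_ring"
  proof -
    have "quot_const c \<in> carrier invariant_ring" for c
      using hom(1)[OF polys_mconst] unfolding const .
    moreover have "nu (sym_emb B (b i)) \<in> carrier invariant_ring" if "i \<in> {1..r}" for i
      using hom(1)[OF polys_mvar[OF that]] unfolding var .
    ultimately show ?thesis by blast
  qed
  then have "generate_ring invariant_ring ?H \<subseteq> carrier invariant_ring"
    by (rule ring.generate_ring_incl[OF ring_invariant_ring])
  ultimately show "generate_ring invariant_ring ?H = carrier invariant_ring"
    by (metis equalityI image_subsetI)
qed

end

theorem mainTheorem4:
  fixes scale :: "'k::real_field \<Rightarrow> 'g::ab_group_add \<Rightarrow> 'g"
    and bracket :: "'g \<Rightarrow> 'g \<Rightarrow> 'g"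
    and e h f :: 'g
    and form :: "'g \<Rightarrow> 'g \<Rightarrow> 'k"
    and lag :: "'g set"
    and r m s :: nat
    and n :: "nat \<Rightarrow> int"
    and x y z :: "nat \<Rightarrow> 'g"
    and B :: "'g set"
  assumes "W_algebra_data scale bracket e h f form lag r m s n x y z B"
  shows
    "let S_ge = poly_ring (x ` {1..r});
         Inv = W_algebra_data.invariant_ring scale bracket e h form lag B;
         const = W_algebra_data.quot_const scale bracket e h form lag B;
         homogeneous = lie_algebra.kazhdan_homogeneous scale bracket B h;
         initial = W_algebra_data.has_initial_term scale bracket h r m s x z B;
         emb = lie_algebra.sym_emb scale B
     in
       (\<forall>k Q. Q \<in> carrier S_ge \<and> Q \<noteq> 0 \<and> homogeneous k Q \<longrightarrow>
          (\<exists>!P. P \<in> carrier Inv \<and> initial k Q P)) \<and>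
       (\<exists>\<nu>. \<nu> \<in> ring_iso S_ge Inv \<and> (\<forall>c. \<nu> (mconst c) = const c) \<and>
          (\<forall>k Q. Q \<in> carrier S_ge \<and> Q \<noteq> 0 \<and> homogeneous k Q \<longrightarrow> initial k Q (\<nu> Q)) \<and>
          (\<forall>b. lie_algebra.family_basis scale b {1..r} (lie_algebra.centralizer bracket e) \<longrightarrow>
             generate_ring Inv (range const \<union> (\<lambda>i. \<nu> (emb (b i))) ` {1..r}) = carrier Inv \<and>
             (\<exists>\<phi>. \<phi> \<in> ring_iso (poly_ring {1..r}) Inv \<and> (\<forall>c. \<phi> (mconst c) = const c) \<and>
                (\<forall>i\<in>{1..r}. \<phi> (mvar i) = \<nu> (emb (b i))))))"
proof -
  interpret W_algebra_data scale bracket e h f form lag r m s n x y z B by fact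
  \<comment> \<open>The witness is \<open>nu Q\<close>, so that existence and the isomorphism come
    from one construction.\<close>
  have ex1: "\<exists>!P. P \<in> carrier invariant_ring \<and> has_initial_term k Q P"
    if "Q \<in> polys (x ` {1..r})" "kazhdan_homogeneous B h k Q" for k Q
    using nu_initial[OF that] initial_unique ring_iso_memE(1)[OF nu_iso that(1)] by blast
  show ?thesis
    unfolding Let_def
  proof (intro conjI allI impI exI[of _ nu])
    show "\<exists>!P. P \<in> carrier invariant_ring \<and> has_initial_term k Q P"
      if "Q \<in> polys (x ` {1..r}) \<and> Q \<noteq> 0 \<and> kazhdan_homogeneous B h k Q" for k Q
      using ex1 that by blast
    show "nu \<in> ring_iso (poly_ring (x ` {1..r})) invariant_ring" by (rule nu_iso)
    show "nu (mconst c) = quot_const c" for c by (rule nu_mconst)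
    show "has_initial_term k Q (nu Q)"
      if "Q \<in> polys (x ` {1..r}) \<and> Q \<noteq> 0 \<and> kazhdan_homogeneous B h k Q" for k Q
      using nu_initial that by blast
  qed (rule generators; assumption)+
qed

end
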